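(* Let $R$ be a Dedekind domain with field of fractions $K$ and let $M$ be a nonzero $R$-module. Then the following are equivalent: (1) $M$ is a weakly IN $R$-module; (2) $M$ is isomorphic to an $R$-submodule of $K$, or $M\cong E(R/\mathfrak{p})$ for some maximal ideal $\mathfrak{p}$ of $R$, or $M\cong R/\mathfrak{p}_1^{n_1}\oplus\cdots\oplus R/\mathfrak{p}_k^{n_k}$ for some positive integers $n_i$ $(1\le i\le k)$ and distinct maximal ideals $\mathfrak{p}_1,\dots,\mathfrak{p}_k$ of $R$.
   Context: All modules are unital. For an $R$-module $N$, $\mathrm{Ann}_R(N)=\{r\in R\mid rN=0\}$. An $R$-module $M$ is weakly IN if $\mathrm{Ann}_R(N)+\mathrm{Ann}_R(L)=R$ for all submodules $N,L$ of $M$ with $N\cap L=0$. $E(N)$ denotes the injective hull of an $R$-module $N$. *)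

theory Defs
  imports "HOL-Algebra.Algebra"
begin

section \<open>Homomorphisms and constructions of modules\<close>

text \<open>The record \<^typ>\<open>('a, 'b) module\<close> extends the ring record, so a module also carries the fields
  \<^const>\<open>monoid.mult\<close> and \<^const>\<open>one\<close>. They play no role for modules: no notion below depends on them.\<close>

definition module_hom ::
    "('a, 'r) ring_scheme \<Rightarrow> ('a, 'b, 'm) module_scheme \<Rightarrow> ('a, 'c, 'n) module_scheme \<Rightarrow> ('b \<Rightarrow> 'c) set"
  where "module_hom R M N =
    {h. h \<in> carrier M \<rightarrow> carrier N \<and>
        (\<forall>x\<in>carrier M. \<forall>y\<in>carrier M. h (x \<oplus>\<^bsub>M\<^esub> y) = h x \<oplus>\<^bsub>N\<^esub> h y) \<and>
        (\<forall>r\<in>carrier R. \<forall>x\<in>carrier M. h (r \<odot>\<^bsub>M\<^esub> x) = r \<odot>\<^bsub>N\<^esub> h x)}"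

definition module_iso ::
    "('a, 'r) ring_scheme \<Rightarrow> ('a, 'b, 'm) module_scheme \<Rightarrow> ('a, 'c, 'n) module_scheme \<Rightarrow> bool"
  where "module_iso R M N \<longleftrightarrow> (\<exists>h\<in>module_hom R M N. bij_betw h (carrier M) (carrier N))"

text \<open>A ring \<open>S\<close> as a module over the domain of a ring homomorphism \<open>\<phi>\<close> into \<open>S\<close>.\<close>

definition restrict_scalars :: "('a \<Rightarrow> 'b) \<Rightarrow> ('b, 's) ring_scheme \<Rightarrow> ('a, 'b) module"
  where "restrict_scalars \<phi> S =
    \<lparr>carrier = carrier S, monoid.mult = monoid.mult S, monoid.one = monoid.one S,
     ring.zero = ring.zero S, ring.add = ring.add S,
     module.smult = (\<lambda>r x. \<phi> r \<otimes>\<^bsub>S\<^esub> x)\<rparr>"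

definition quot_module :: "('a, 'r) ring_scheme \<Rightarrow> 'a set \<Rightarrow> ('a, 'a set) module"
  where "quot_module R I = restrict_scalars (\<lambda>r. I +>\<^bsub>R\<^esub> r) (R Quot I)"

definition direct_sum_module :: "'i set \<Rightarrow> ('i \<Rightarrow> ('a, 'b) module) \<Rightarrow> ('a, 'i \<Rightarrow> 'b) module"
  where "direct_sum_module I N =
    \<lparr>carrier = {x \<in> (\<Pi>\<^sub>E i\<in>I. carrier (N i)). finite {i\<in>I. x i \<noteq> \<zero>\<^bsub>N i\<^esub>}},
     monoid.mult = (\<lambda>x y. \<lambda>i\<in>I. x i \<otimes>\<^bsub>N i\<^esub> y i),
     monoid.one = (\<lambda>i\<in>I. \<one>\<^bsub>N i\<^esub>),
     ring.zero = (\<lambda>i\<in>I. \<zero>\<^bsub>N i\<^esub>),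
     ring.add = (\<lambda>x y. \<lambda>i\<in>I. x i \<oplus>\<^bsub>N i\<^esub> y i),
     module.smult = (\<lambda>r x. \<lambda>i\<in>I. r \<odot>\<^bsub>N i\<^esub> x i)\<rparr>"

section \<open>Weakly IN modules\<close>

definition Ann :: "('a, 'r) ring_scheme \<Rightarrow> ('a, 'b, 'm) module_scheme \<Rightarrow> 'b set \<Rightarrow> 'a set"
  where "Ann R M N = {r \<in> carrier R. \<forall>x\<in>N. r \<odot>\<^bsub>M\<^esub> x = \<zero>\<^bsub>M\<^esub>}"

definition weakly_IN :: "('a, 'r) ring_scheme \<Rightarrow> ('a, 'b, 'm) module_scheme \<Rightarrow> bool"
  where "weakly_IN R M \<longleftrightarrow>
    (\<forall>N L. submodule N R M \<longrightarrow> submodule L R M \<longrightarrow> N \<inter> L = {\<zero>\<^bsub>M\<^esub>} \<longrightarrow>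
       Ann R M N <+>\<^bsub>R\<^esub> Ann R M L = carrier R)"

section \<open>Dedekind domains and fields of fractions\<close>

text \<open>\<open>K\<close> is a field of fractions of \<open>R\<close> via the embedding \<open>\<phi>\<close>.\<close>

locale field_of_fractions =
  R?: domain R + K?: field K for R (structure) and K (structure) +
  fixes \<phi>
  assumes frac_hom: "\<phi> \<in> ring_hom R K"
    and frac_inj: "inj_on \<phi> (carrier R)"
    and frac_repr: "x \<in> carrier K \<Longrightarrow>
      \<exists>a\<in>carrier R. \<exists>b\<in>carrier R - {\<zero>\<^bsub>R\<^esub>}. x = \<phi> a \<otimes>\<^bsub>K\<^esub> inv\<^bsub>K\<^esub> (\<phi> b)"

text \<open>\<open>x\<close> is a root of the monic polynomial with lower coefficients \<open>c 0, \<dots>, c (n - 1)\<close>.\<close>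

definition integral_elem :: "('a, 'r) ring_scheme \<Rightarrow> ('k, 's) ring_scheme \<Rightarrow> ('a \<Rightarrow> 'k) \<Rightarrow> 'k \<Rightarrow> bool"
  where "integral_elem R K \<phi> x \<longleftrightarrow>
    (\<exists>n::nat. n > 0 \<and> (\<exists>c\<in>{..<n} \<rightarrow> carrier R.
       x [^]\<^bsub>K\<^esub> n \<oplus>\<^bsub>K\<^esub> (\<Oplus>\<^bsub>K\<^esub>i\<in>{..<n}. \<phi> (c i) \<otimes>\<^bsub>K\<^esub> x [^]\<^bsub>K\<^esub> i) = \<zero>\<^bsub>K\<^esub>))"

text \<open>A Dedekind domain \<open>R\<close> together with its field of fractions: a Noetherian domain that is integrally
  closed in its field of fractions and in which nonzero prime ideals are maximal. Fields are included.\<close>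

locale dedekind_domain =
  noetherian_domain R + field_of_fractions R K \<phi> for R (structure) and K (structure) and \<phi> +
  assumes integrally_closed:
      "\<lbrakk>x \<in> carrier K; integral_elem R K \<phi> x\<rbrakk> \<Longrightarrow> x \<in> \<phi> ` carrier R"
    and nonzero_prime_maximal:
      "\<lbrakk>primeideal P R; P \<noteq> {\<zero>\<^bsub>R\<^esub>}\<rbrakk> \<Longrightarrow> maximalideal P R"

section \<open>Injective modules and injective hulls\<close>

text \<open>A definition cannot quantify over all types, so the modules \<open>A\<close> and \<open>B\<close> in the extension property
  live on the type of the ring elements. By Baer's criterion, this is no restriction; see the
  lemma \<open>injective_module_extend\<close> below, where \<open>A\<close> and \<open>B\<close> live on arbitrary types.\<close>

definition injective_module :: "('a, 'r) ring_scheme \<Rightarrow> ('a, 'e, 'm) module_scheme \<Rightarrow> bool"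
  where "injective_module R E \<longleftrightarrow> module R E \<and>
    (\<forall>(A :: ('a, 'a) module) (B :: ('a, 'a) module) f g.
       module R A \<longrightarrow> module R B \<longrightarrow> f \<in> module_hom R A B \<longrightarrow> inj_on f (carrier A) \<longrightarrow>
       g \<in> module_hom R A E \<longrightarrow>
       (\<exists>h\<in>module_hom R B E. \<forall>x\<in>carrier A. h (f x) = g x))"

definition essential_submodule ::
    "('a, 'r) ring_scheme \<Rightarrow> ('a, 'b, 'm) module_scheme \<Rightarrow> 'b set \<Rightarrow> bool"
  where "essential_submodule R M N \<longleftrightarrow> submodule N R M \<and>
    (\<forall>H. submodule H R M \<longrightarrow> H \<inter> N = {\<zero>\<^bsub>M\<^esub>} \<longrightarrow> H = {\<zero>\<^bsub>M\<^esub>})"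

definition injective_hull ::
    "('a, 'r) ring_scheme \<Rightarrow> ('a, 'b, 'm) module_scheme \<Rightarrow> ('a, 'e, 'n) module_scheme \<Rightarrow> bool"
  where "injective_hull R N E \<longleftrightarrow> injective_module R E \<and>
    (\<exists>\<iota>\<in>module_hom R N E. inj_on \<iota> (carrier N) \<and> essential_submodule R E (\<iota> ` carrier N))"

lemma restrict_scalars_simps [simp]:
  "carrier (restrict_scalars \<phi> S) = carrier S"
  "ring.add (restrict_scalars \<phi> S) = ring.add S"
  "ring.zero (restrict_scalars \<phi> S) = ring.zero S"
  "module.smult (restrict_scalars \<phi> S) = (\<lambda>r x. \<phi> r \<otimes>\<^bsub>S\<^esub> x)"
  by (simp_all add: restrict_scalars_def)

lemma module_restrict_scalars:
  assumes "cring R" "cring S" "\<phi> \<in> ring_hom R S"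
  shows "module R (restrict_scalars \<phi> S)"
proof -
  interpret R: cring R by fact
  interpret S: cring S by fact
  have ab: "abelian_group (restrict_scalars \<phi> S)"
    by (rule abelian_groupI)
      (auto simp: S.a_assoc intro: S.a_comm bexI [of _ "\<ominus>\<^bsub>S\<^esub> x" for x] S.l_neg)
  show ?thesis
    using assms(3) ab
    by (intro moduleI)
      (auto simp: R.is_cring ring_hom_closed ring_hom_add ring_hom_mult ring_hom_one
        S.l_distr S.r_distr S.m_assoc)
qed

lemma injective_module_extend:
  fixes A :: "('a, 'b, 'm) module_scheme" and B :: "('a, 'c, 'n) module_scheme"
    and E :: "('a, 'e, 'p) module_scheme"
  assumes inj: "injective_module R E" and A: "module R A" and B: "module R B"
    and f: "f \<in> module_hom R A B" "inj_on f (carrier A)" and g: "g \<in> module_hom R A E"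
  shows "\<exists>h\<in>module_hom R B E. \<forall>x\<in>carrier A. h (f x) = g x"
proof -
  interpret A: module R A by fact
  interpret B: module R B by fact
  interpret E: module R E using inj by (simp add: injective_module_def)
  define P where "P G \<longleftrightarrow> G \<subseteq> carrier B \<times> carrier E \<and> (\<lambda>x. (f x, g x)) ` carrier A \<subseteq> G \<and>
     (\<forall>b e b' e'. (b, e) \<in> G \<longrightarrow> (b', e') \<in> G \<longrightarrow> (b \<oplus>\<^bsub>B\<^esub> b', e \<oplus>\<^bsub>E\<^esub> e') \<in> G) \<and>
     (\<forall>r b e. r \<in> carrier R \<longrightarrow> (b, e) \<in> G \<longrightarrow> (r \<odot>\<^bsub>B\<^esub> b, r \<odot>\<^bsub>E\<^esub> e) \<in> G) \<and>
     (\<forall>e. (\<zero>\<^bsub>B\<^esub>, e) \<in> G \<longrightarrow> e = \<zero>\<^bsub>E\<^esub>)" for G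
  have f': "f x \<in> carrier B" "g x \<in> carrier E" if "x \<in> carrier A" for x
    using that f g by (auto simp: module_hom_def)
  have fadd: "f (x \<oplus>\<^bsub>A\<^esub> y) = f x \<oplus>\<^bsub>B\<^esub> f y" "g (x \<oplus>\<^bsub>A\<^esub> y) = g x \<oplus>\<^bsub>E\<^esub> g y"
    if "x \<in> carrier A" "y \<in> carrier A" for x y
    using that f g by (auto simp: module_hom_def)
  have fsm: "f (r \<odot>\<^bsub>A\<^esub> x) = r \<odot>\<^bsub>B\<^esub> f x" "g (r \<odot>\<^bsub>A\<^esub> x) = r \<odot>\<^bsub>E\<^esub> g x"
    if "r \<in> carrier R" "x \<in> carrier A" for r x
    using that f g by (auto simp: module_hom_def)
  have f0: "f \<zero>\<^bsub>A\<^esub> = \<zero>\<^bsub>B\<^esub>" "g \<zero>\<^bsub>A\<^esub> = \<zero>\<^bsub>E\<^esub>"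
    using fsm[of "\<zero>\<^bsub>R\<^esub>" "\<zero>\<^bsub>A\<^esub>"] f'[of "\<zero>\<^bsub>A\<^esub>"] by auto
  have P0: "P ((\<lambda>x. (f x, g x)) ` carrier A)"
    unfolding P_def
  proof (intro conjI allI impI)
    fix e assume "(\<zero>\<^bsub>B\<^esub>, e) \<in> (\<lambda>x. (f x, g x)) ` carrier A"
    then obtain x where x: "x \<in> carrier A" "f x = f \<zero>\<^bsub>A\<^esub>" "e = g x" using f0 by auto
    then have "x = \<zero>\<^bsub>A\<^esub>" using f(2) by (auto dest: inj_onD)
    then show "e = \<zero>\<^bsub>E\<^esub>" using x f0 by simp
  next
    fix b e b' e' assume "(b, e) \<in> (\<lambda>x. (f x, g x)) ` carrier A" "(b', e') \<in> (\<lambda>x. (f x, g x)) ` carrier A"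
    then obtain x y where "x \<in> carrier A" "y \<in> carrier A" "b = f x" "e = g x" "b' = f y" "e' = g y" by auto
    then show "(b \<oplus>\<^bsub>B\<^esub> b', e \<oplus>\<^bsub>E\<^esub> e') \<in> (\<lambda>x. (f x, g x)) ` carrier A"
      by (auto intro!: image_eqI[of _ _ "x \<oplus>\<^bsub>A\<^esub> y"] simp: fadd)
  next
    fix r b e assume "r \<in> carrier R" "(b, e) \<in> (\<lambda>x. (f x, g x)) ` carrier A"
    then obtain x where "r \<in> carrier R" "x \<in> carrier A" "b = f x" "e = g x" by auto
    then show "(r \<odot>\<^bsub>B\<^esub> b, r \<odot>\<^bsub>E\<^esub> e) \<in> (\<lambda>x. (f x, g x)) ` carrier A"
      by (auto intro!: image_eqI[of _ _ "r \<odot>\<^bsub>A\<^esub> x"] simp: fsm)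
  qed (use f' in auto)
  have "\<exists>G\<in>{G. P G}. \<forall>Y\<in>{G. P G}. G \<subseteq> Y \<longrightarrow> Y = G"
  proof (rule subset_Zorn_nonempty)
    show "{G. P G} \<noteq> {}" using P0 by blast
  next
    fix C assume ne: "C \<noteq> {}" and ch: "subset.chain {G. P G} C"
    then have PC: "\<And>G. G \<in> C \<Longrightarrow> P G" by (auto simp: subset.chain_def)
    have two: "\<exists>G\<in>C. p \<in> G \<and> q \<in> G" if pq: "p \<in> \<Union>C" "q \<in> \<Union>C" for p q
    proof -
      obtain G1 G2 where "G1 \<in> C" "p \<in> G1" "G2 \<in> C" "q \<in> G2" using pq by blast
      moreover have "G1 \<subseteq> G2 \<or> G2 \<subseteq> G1"
        using ch \<open>G1 \<in> C\<close> \<open>G2 \<in> C\<close> unfolding subset_chain_def by blast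
      ultimately show ?thesis by blast
    qed
    have "P (\<Union>C)"
      unfolding P_def
    proof (intro conjI allI impI)
      show "\<Union>C \<subseteq> carrier B \<times> carrier E" using PC unfolding P_def by blast
      show "(\<lambda>x. (f x, g x)) ` carrier A \<subseteq> \<Union>C" using PC ne unfolding P_def by blast
    next
      fix b e b' e' assume "(b, e) \<in> \<Union>C" "(b', e') \<in> \<Union>C"
      then obtain G where "G \<in> C" "(b, e) \<in> G" "(b', e') \<in> G" using two by blast
      then have "(b \<oplus>\<^bsub>B\<^esub> b', e \<oplus>\<^bsub>E\<^esub> e') \<in> G" using PC[of G] unfolding P_def by blast
      then show "(b \<oplus>\<^bsub>B\<^esub> b', e \<oplus>\<^bsub>E\<^esub> e') \<in> \<Union>C" using \<open>G \<in> C\<close> by blast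
    next
      fix r b e assume "r \<in> carrier R" "(b, e) \<in> \<Union>C"
      then obtain G where "G \<in> C" "(b, e) \<in> G" by blast
      then have "(r \<odot>\<^bsub>B\<^esub> b, r \<odot>\<^bsub>E\<^esub> e) \<in> G" using PC[of G] \<open>r \<in> carrier R\<close> unfolding P_def by blast
      then show "(r \<odot>\<^bsub>B\<^esub> b, r \<odot>\<^bsub>E\<^esub> e) \<in> \<Union>C" using \<open>G \<in> C\<close> by blast
    next
      fix e assume "(\<zero>\<^bsub>B\<^esub>, e) \<in> \<Union>C"
      then show "e = \<zero>\<^bsub>E\<^esub>" using PC unfolding P_def by blast
    qed
    then show "\<Union>C \<in> {G. P G}" by simp
  qed
  then obtain G where G: "P G" and max: "\<And>Y. P Y \<Longrightarrow> G \<subseteq> Y \<Longrightarrow> Y = G" by auto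
  have Gc: "b \<in> carrier B" "e \<in> carrier E" if "(b, e) \<in> G" for b e using G that by (auto simp: P_def)
  have Gadd: "(b \<oplus>\<^bsub>B\<^esub> b', e \<oplus>\<^bsub>E\<^esub> e') \<in> G" if "(b, e) \<in> G" "(b', e') \<in> G" for b e b' e'
    using G that by (auto simp: P_def)
  have Gsm: "(r \<odot>\<^bsub>B\<^esub> b, r \<odot>\<^bsub>E\<^esub> e) \<in> G" if "r \<in> carrier R" "(b, e) \<in> G" for r b e
    using G that by (auto simp: P_def)
  have Gz: "e = \<zero>\<^bsub>E\<^esub>" if "(\<zero>\<^bsub>B\<^esub>, e) \<in> G" for e using G that by (auto simp: P_def)
  have Gfg: "(f x, g x) \<in> G" if "x \<in> carrier A" for x using G that by (auto simp: P_def)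
  have Gneg: "(\<ominus>\<^bsub>B\<^esub> b, \<ominus>\<^bsub>E\<^esub> e) \<in> G" if "(b, e) \<in> G" for b e
    using Gsm[OF _ that, of "\<ominus>\<^bsub>R\<^esub> \<one>\<^bsub>R\<^esub>"] Gc[OF that] by (simp add: B.smult_l_minus E.smult_l_minus)
  have G00: "(\<zero>\<^bsub>B\<^esub>, \<zero>\<^bsub>E\<^esub>) \<in> G" using Gfg[of "\<zero>\<^bsub>A\<^esub>"] f0 by simp
  have Guniq: "e = e'" if "(b, e) \<in> G" "(b, e') \<in> G" for b e e'
  proof -
    have "(b \<oplus>\<^bsub>B\<^esub> \<ominus>\<^bsub>B\<^esub> b, e \<oplus>\<^bsub>E\<^esub> \<ominus>\<^bsub>E\<^esub> e') \<in> G" using Gadd Gneg that by blast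
    then have "e \<oplus>\<^bsub>E\<^esub> \<ominus>\<^bsub>E\<^esub> e' = \<zero>\<^bsub>E\<^esub>" using Gz that Gc by (simp add: B.r_neg)
    then show ?thesis using Gc that by (metis E.add.inv_solve_right' E.l_zero E.zero_closed)
  qed
  have total: "\<exists>e. (b, e) \<in> G" if b: "b \<in> carrier B" for b
  proof (rule ccontr)
    assume nb: "\<nexists>e. (b, e) \<in> G"
    define I where "I = {r \<in> carrier R. \<exists>e. (r \<odot>\<^bsub>B\<^esub> b, e) \<in> G}"
    define k where "k r = (THE e. (r \<odot>\<^bsub>B\<^esub> b, e) \<in> G)" for r
    have kG: "(r \<odot>\<^bsub>B\<^esub> b, k r) \<in> G" if "r \<in> I" for r
      using that Guniq unfolding I_def k_def by (auto intro: theI2)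
    have kI: "k r = e" if "(r \<odot>\<^bsub>B\<^esub> b, e) \<in> G" for r e
      using that Guniq unfolding k_def by blast
    have IR: "r \<in> carrier R" if "r \<in> I" for r using that by (simp add: I_def)
    have Iadd: "r \<oplus>\<^bsub>R\<^esub> s \<in> I \<and> k (r \<oplus>\<^bsub>R\<^esub> s) = k r \<oplus>\<^bsub>E\<^esub> k s" if "r \<in> I" "s \<in> I" for r s
    proof -
      have "((r \<oplus>\<^bsub>R\<^esub> s) \<odot>\<^bsub>B\<^esub> b, k r \<oplus>\<^bsub>E\<^esub> k s) \<in> G"
        using Gadd[OF kG kG, OF that] IR that b by (simp add: B.smult_l_distr)
      then show ?thesis using kI that by (auto simp: I_def)
    qed
    have Ism: "r \<otimes>\<^bsub>R\<^esub> s \<in> I \<and> k (r \<otimes>\<^bsub>R\<^esub> s) = r \<odot>\<^bsub>E\<^esub> k s" if "r \<in> carrier R" "s \<in> I" for r s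
    proof -
      have "((r \<otimes>\<^bsub>R\<^esub> s) \<odot>\<^bsub>B\<^esub> b, r \<odot>\<^bsub>E\<^esub> k s) \<in> G"
        using Gsm[OF that(1) kG[OF that(2)]] IR that b by (simp add: B.smult_assoc1)
      then show ?thesis using kI that by (auto simp: I_def)
    qed
    have I0: "\<zero>\<^bsub>R\<^esub> \<in> I" using G00 b by (auto simp: I_def)
    have Ineg: "\<ominus>\<^bsub>R\<^esub> r \<in> I" if "r \<in> I" for r
      using Ism[OF _ that, of "\<ominus>\<^bsub>R\<^esub> \<one>\<^bsub>R\<^esub>"] IR[OF that] by (simp add: A.R.l_minus)
    let ?B = "restrict_scalars id R"
    have mB: "module R ?B"
      by (rule module_restrict_scalars) (auto simp: A.R.is_cring ring_hom_def)
    interpret RB: module R ?B by (rule mB)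
    have minv: "\<ominus>\<^bsub>?B\<^esub> r = \<ominus>\<^bsub>R\<^esub> r" for r
      by (simp add: a_inv_def m_inv_def)
    have "submodule I R ?B"
      by (rule RB.submoduleI) (use IR I0 Ineg Iadd Ism in \<open>auto simp: minv\<close>)
    then have mI: "module R (?B\<lparr>carrier := I\<rparr>)" using mB by (rule submodule.submodule_is_module)
    have idh: "id \<in> module_hom R (?B\<lparr>carrier := I\<rparr>) ?B" using IR by (auto simp: module_hom_def)
    have kh: "k \<in> module_hom R (?B\<lparr>carrier := I\<rparr>) E"
      using Gc(2)[OF kG] Iadd Ism by (auto simp: module_hom_def)
    have "\<exists>h\<in>module_hom R ?B E. \<forall>x\<in>carrier (?B\<lparr>carrier := I\<rparr>). h (id x) = k x"
      by (rule inj [unfolded injective_module_def, THEN conjunct2, rule_format, OF mI mB idh inj_on_id kh])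
    then obtain h where h: "h \<in> module_hom R ?B E" and hk: "\<And>r. r \<in> I \<Longrightarrow> h r = k r" by auto
    define e0 where "e0 = h \<one>\<^bsub>R\<^esub>"
    have e0: "e0 \<in> carrier E" using h by (auto simp: module_hom_def e0_def)
    have hr: "h r = r \<odot>\<^bsub>E\<^esub> e0" if "r \<in> carrier R" for r
    proof -
      have "h (r \<otimes>\<^bsub>R\<^esub> \<one>\<^bsub>R\<^esub>) = r \<odot>\<^bsub>E\<^esub> h \<one>\<^bsub>R\<^esub>" using h that
        by (simp add: module_hom_def del: A.R.r_one)
      then show ?thesis using that by (simp add: e0_def)
    qed
    define G' where "G' = {(d \<oplus>\<^bsub>B\<^esub> r \<odot>\<^bsub>B\<^esub> b, e \<oplus>\<^bsub>E\<^esub> r \<odot>\<^bsub>E\<^esub> e0) | d e r. (d, e) \<in> G \<and> r \<in> carrier R}"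
    have G'I: "(d \<oplus>\<^bsub>B\<^esub> r \<odot>\<^bsub>B\<^esub> b, e \<oplus>\<^bsub>E\<^esub> r \<odot>\<^bsub>E\<^esub> e0) \<in> G'" if "(d, e) \<in> G" "r \<in> carrier R" for d e r
      using that by (auto simp: G'_def)
    have sub: "G \<subseteq> G'"
    proof
      fix p assume "p \<in> G"
      then obtain d e where p: "p = (d, e)" "(d, e) \<in> G" by (cases p) auto
      show "p \<in> G'" using G'I[OF p(2), of "\<zero>\<^bsub>R\<^esub>"] Gc[OF p(2)] p b e0 by simp
    qed
    have "P G'"
      unfolding P_def
    proof (intro conjI allI impI)
      show "G' \<subseteq> carrier B \<times> carrier E" using Gc b e0 by (auto simp: G'_def)
      show "(\<lambda>x. (f x, g x)) ` carrier A \<subseteq> G'" using Gfg sub by auto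
    next
      fix x y x' y' assume "(x, y) \<in> G'" "(x', y') \<in> G'"
      then obtain d e r d' e' r' where *: "x = d \<oplus>\<^bsub>B\<^esub> r \<odot>\<^bsub>B\<^esub> b" "y = e \<oplus>\<^bsub>E\<^esub> r \<odot>\<^bsub>E\<^esub> e0"
        "(d, e) \<in> G" "r \<in> carrier R" "x' = d' \<oplus>\<^bsub>B\<^esub> r' \<odot>\<^bsub>B\<^esub> b" "y' = e' \<oplus>\<^bsub>E\<^esub> r' \<odot>\<^bsub>E\<^esub> e0"
        "(d', e') \<in> G" "r' \<in> carrier R"
        unfolding G'_def by blast
      note c = Gc[OF *(3)] Gc[OF *(7)] b e0 *(4,8)
      have "x \<oplus>\<^bsub>B\<^esub> x' = (d \<oplus>\<^bsub>B\<^esub> d') \<oplus>\<^bsub>B\<^esub> (r \<oplus>\<^bsub>R\<^esub> r') \<odot>\<^bsub>B\<^esub> b"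
        "y \<oplus>\<^bsub>E\<^esub> y' = (e \<oplus>\<^bsub>E\<^esub> e') \<oplus>\<^bsub>E\<^esub> (r \<oplus>\<^bsub>R\<^esub> r') \<odot>\<^bsub>E\<^esub> e0"
        using c by (simp_all add: * B.smult_l_distr E.smult_l_distr B.M.a_ac E.M.a_ac)
      then show "(x \<oplus>\<^bsub>B\<^esub> x', y \<oplus>\<^bsub>E\<^esub> y') \<in> G'"
        using G'I[OF Gadd[OF *(3,7)], of "r \<oplus>\<^bsub>R\<^esub> r'"] *(4,8) by simp
    next
      fix s x y assume s: "s \<in> carrier R" and "(x, y) \<in> G'"
      then obtain d e r where *: "x = d \<oplus>\<^bsub>B\<^esub> r \<odot>\<^bsub>B\<^esub> b" "y = e \<oplus>\<^bsub>E\<^esub> r \<odot>\<^bsub>E\<^esub> e0"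
        "(d, e) \<in> G" "r \<in> carrier R"
        unfolding G'_def by blast
      note c = Gc[OF *(3)] b e0 *(4) s
      have "s \<odot>\<^bsub>B\<^esub> x = s \<odot>\<^bsub>B\<^esub> d \<oplus>\<^bsub>B\<^esub> (s \<otimes>\<^bsub>R\<^esub> r) \<odot>\<^bsub>B\<^esub> b"
        "s \<odot>\<^bsub>E\<^esub> y = s \<odot>\<^bsub>E\<^esub> e \<oplus>\<^bsub>E\<^esub> (s \<otimes>\<^bsub>R\<^esub> r) \<odot>\<^bsub>E\<^esub> e0"
        using c by (simp_all add: * B.smult_r_distr E.smult_r_distr B.smult_assoc1 E.smult_assoc1)
      then show "(s \<odot>\<^bsub>B\<^esub> x, s \<odot>\<^bsub>E\<^esub> y) \<in> G'"
        using G'I[OF Gsm[OF s *(3)], of "s \<otimes>\<^bsub>R\<^esub> r"] *(4) s by simp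
    next
      fix y assume "(\<zero>\<^bsub>B\<^esub>, y) \<in> G'"
      then obtain d e r where *: "\<zero>\<^bsub>B\<^esub> = d \<oplus>\<^bsub>B\<^esub> r \<odot>\<^bsub>B\<^esub> b" "y = e \<oplus>\<^bsub>E\<^esub> r \<odot>\<^bsub>E\<^esub> e0"
        "(d, e) \<in> G" "r \<in> carrier R"
        unfolding G'_def by blast
      note c = Gc[OF *(3)] b e0 *(4)
      have "r \<odot>\<^bsub>B\<^esub> b = \<ominus>\<^bsub>B\<^esub> d"
        using *(1) c by (metis B.M.minus_equality B.M.a_comm B.smult_closed B.M.minus_minus)
      then have rG: "(r \<odot>\<^bsub>B\<^esub> b, \<ominus>\<^bsub>E\<^esub> e) \<in> G" using Gneg[OF *(3)] by simp
      then have "r \<in> I" using *(4) by (auto simp: I_def)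
      then have "r \<odot>\<^bsub>E\<^esub> e0 = \<ominus>\<^bsub>E\<^esub> e" using hk[of r] hr[OF *(4)] kI[OF rG] by simp
      then show "y = \<zero>\<^bsub>E\<^esub>" using *(2) c by (simp add: E.r_neg)
    qed
    then have "G' = G" using max sub by blast
    moreover have "(b, e0) \<in> G'" using G'I[OF G00, of "\<one>\<^bsub>R\<^esub>"] b e0 by simp
    ultimately show False using nb by blast
  qed
  define h where "h b = (THE e. (b, e) \<in> G)" for b
  have hG: "(b, h b) \<in> G" if "b \<in> carrier B" for b
    using total[OF that] Guniq unfolding h_def by (auto intro: theI2)
  have hI: "h b = e" if "(b, e) \<in> G" for b e
    using that Guniq unfolding h_def by blast
  have "h \<in> module_hom R B E"
    using Gc(2)[OF hG] hI[OF Gadd[OF hG hG]] hI[OF Gsm[OF _ hG]] by (auto simp: module_hom_def)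
  moreover have "h (f x) = g x" if "x \<in> carrier A" for x using hI[OF Gfg[OF that]] .
  ultimately show ?thesis by blast
qed

end

theory Submission
  imports Defs
begin

text \<open>Besides the ascending chain condition, one local fact about a Dedekind domain \<open>R\<close> carries the proof: for a nonzero maximal ideal \<open>p\<close> there
  are \<open>v \<in> p\<close> and \<open>s \<notin> p\<close> with \<open>s p \<subseteq> R v\<close> (\<open>dedekind_exists_uniformizer\<close>). Elements outside \<open>p\<close> then
  play the role of units, so that \<open>R\<close> behaves at \<open>p\<close> like a discrete valuation ring: a nonzero \<open>x\<close>
  satisfies \<open>t x = u v^j\<close> with \<open>t, u \<notin> p\<close> (\<open>normal_form\<close>), and a nonzero ideal in \<open>p\<close> is \<open>p^j \<inter> J\<close> for a
  strictly larger ideal \<open>J\<close> not contained in \<open>p\<close>. The latter gives an induction principle for nonzero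
  ideals (\<open>nonzero_ideal_induct\<close>) and their decomposition into powers of distinct maximal ideals.

  Let \<open>M\<close> be weakly IN. If \<open>R x\<close> and \<open>R y\<close> meet in \<open>0\<close>, then \<open>x\<close> and \<open>y\<close> have comaximal annihilators
  (\<open>weakly_IN_independent\<close>). There are three cases.

  \<^item> Some \<open>x0\<close> has annihilator \<open>0\<close>. The map \<open>r x0 \<mapsto> r\<close> into \<open>K\<close> extends to \<open>M\<close> because \<open>K\<close> is injective.
    An element \<open>x\<close> of the kernel satisfies \<open>R x \<inter> R x0 = 0\<close>, so its annihilator is comaximal with \<open>0\<close>
    and \<open>x = 0\<close>. Hence \<open>M\<close> embeds into \<open>K\<close> (\<open>weakly_IN_torsion_free_element_embeds\<close>).

  \<^item> \<open>a M = 0\<close> for some \<open>a \<noteq> 0\<close>. Two nonzero elements killed by a power of the same \<open>p\<close> have annihilators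
    inside \<open>p\<close>, so they are never independent, and the submodules generated by such elements form a
    chain (\<open>weakly_IN_uniserial\<close>). So the part of \<open>M\<close> killed by \<open>p^n\<close> is cyclic, by ideal induction
    the part killed by any nonzero ideal is cyclic, and \<open>M\<close> is \<open>R/I\<close> for a nonzero ideal \<open>I\<close>. The
    Chinese remainder theorem finishes this case.

  \<^item> \<open>M\<close> is torsion and faithful. For a suitable \<open>p\<close> the \<open>p\<close>-primary part \<open>N\<close> and its complement \<open>L\<close> have
    comaximal annihilators whose product kills \<open>M\<close> and so is \<open>0\<close>; this forces \<open>L = 0\<close>. Now the chain
    of cyclic submodules is unbounded, which makes \<open>M\<close> divisible and, by Baer's criterion, injective;
    the elements killed by \<open>p\<close> form an essential copy of \<open>R/p\<close> (\<open>injective_hull_quot\<close>).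

  Conversely, in a submodule of \<open>K\<close> and in an essential extension of a simple module, any two nonzero
  elements have a common nonzero multiple, so one of two submodules with intersection \<open>0\<close> is \<open>0\<close>. The
  direct sums of the third kind are cyclic by the Chinese remainder theorem, and every cyclic module is
  weakly IN (\<open>cyclic_imp_weakly_IN\<close>): ideals are totally ordered by inclusion after localisation at \<open>p\<close>.\<close>

section \<open>Ideals of Noetherian domains\<close>

lemma (in noetherian_ring) exists_maximal_ideal_in:
  assumes "F \<noteq> {}" "\<And>I. I \<in> F \<Longrightarrow> ideal I R"
  shows "\<exists>I\<in>F. \<forall>J\<in>F. I \<subseteq> J \<longrightarrow> J = I"
proof (rule subset_Zorn_nonempty)
  fix C assume C: "C \<noteq> {}" "subset.chain F C"
  then have "subset.chain {I. ideal I R} C"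
    using assms(2) by (auto simp: subset_chain_def)
  then have "\<Union>C \<in> C" using ideal_chain_is_trivial C(1) by blast
  then show "\<Union>C \<in> F" using C(2) by (auto simp: subset_chain_def)
qed (use assms in auto)

lemma (in noetherian_ring) exists_maximalideal_above:
  assumes "ideal I R" "I \<noteq> carrier R"
  obtains p where "maximalideal p R" "I \<subseteq> p"
proof -
  let ?F = "{J. ideal J R \<and> I \<subseteq> J \<and> J \<noteq> carrier R}"
  have "\<exists>p\<in>?F. \<forall>J\<in>?F. p \<subseteq> J \<longrightarrow> J = p"
    by (rule exists_maximal_ideal_in) (use assms in auto)
  then obtain p where "p \<in> ?F" and pmax: "\<forall>J\<in>?F. p \<subseteq> J \<longrightarrow> J = p"
    by (rule bexE)
  then have p: "ideal p R" "I \<subseteq> p" "p \<noteq> carrier R" by simp_all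
  have max: "J = p" if "ideal J R" "J \<noteq> carrier R" "p \<subseteq> J" for J
    using pmax that p(2) by simp
  have "maximalideal p R"
  proof (rule maximalidealI[OF p(1)])
    show "carrier R \<noteq> p" using p(3) by (rule not_sym)
    show "J = p \<or> J = carrier R" if "ideal J R" "p \<subseteq> J" for J
      using max that by blast
  qed
  from this p(2) show thesis by (rule that)
qed

lemma (in cring) cgenideal_iff: "y \<in> PIdl a \<longleftrightarrow> (\<exists>x\<in>carrier R. y = x \<otimes> a)"
  by (auto simp: cgenideal_def)

lemma (in cring) idealI_closed:
  assumes "I \<subseteq> carrier R" "I \<noteq> {}"
    and add: "\<And>x y. x \<in> I \<Longrightarrow> y \<in> I \<Longrightarrow> x \<oplus> y \<in> I"
    and mult: "\<And>a x. a \<in> carrier R \<Longrightarrow> x \<in> I \<Longrightarrow> a \<otimes> x \<in> I"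
  shows "ideal I R"
proof (rule idealI[OF ring_axioms])
  have IR: "x \<in> carrier R" if "x \<in> I" for x using assms(1) that by blast
  show "subgroup I (add_monoid R)"
  proof (rule add.subgroupI)
    show "\<ominus> x \<in> I" if "x \<in> I" for x
      using mult[of "\<ominus> \<one>" x] that IR[OF that] by (simp add: l_minus)
  qed (use assms in auto)
  show "x \<otimes> a \<in> I" if "x \<in> I" "a \<in> carrier R" for a x
    using mult[OF that(2,1)] IR[OF that(1)] that(2) by (simp add: m_comm)
qed (rule mult)

lemma (in cring) colon_ideal:
  assumes "ideal I R" "c \<in> carrier R"
  shows "ideal {r \<in> carrier R. r \<otimes> c \<in> I} R"
proof -
  interpret I: ideal I R by fact
  show ?thesis
  proof (rule idealI_closed)
    have "\<zero> \<in> {r \<in> carrier R. r \<otimes> c \<in> I}" using assms(2) I.zero_closed by simp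
    then show "{r \<in> carrier R. r \<otimes> c \<in> I} \<noteq> {}" by blast
  qed (use assms(2) I.I_l_closed in \<open>auto simp: l_distr m_assoc\<close>)
qed

lemma (in cring) maximalideal_comaximal:
  assumes "maximalideal p R" "t \<in> carrier R" "t \<notin> p"
  obtains a b where "a \<in> carrier R" "b \<in> p" "a \<otimes> t \<oplus> b = \<one>"
proof -
  interpret p: maximalideal p R by fact
  have id: "ideal (PIdl t <+>\<^bsub>R\<^esub> p) R"
    by (rule add_ideals) (use assms cgenideal_ideal p.is_ideal in auto)
  have "p \<subseteq> PIdl t <+>\<^bsub>R\<^esub> p"
  proof
    fix x assume "x \<in> p"
    then have "x = \<zero> \<otimes> t \<oplus> x" using assms(2) p.a_subset by auto
    then show "x \<in> PIdl t <+>\<^bsub>R\<^esub> p" using \<open>x \<in> p\<close> unfolding set_add_def' cgenideal_def by blast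
  qed
  moreover have "t \<in> PIdl t <+>\<^bsub>R\<^esub> p"
  proof -
    have "t = \<one> \<otimes> t \<oplus> \<zero>" using assms(2) by auto
    then show ?thesis using p.zero_closed unfolding set_add_def' cgenideal_def by blast
  qed
  ultimately have "PIdl t <+>\<^bsub>R\<^esub> p = carrier R"
    using p.I_maximal[OF id] id assms(3) by (auto dest: ideal.Icarr)
  then have "\<one> \<in> PIdl t <+>\<^bsub>R\<^esub> p" by simp
  then show thesis using that unfolding set_add_def' cgenideal_def by force
qed

lemma (in cring) maximalideal_primeE:
  assumes "maximalideal p R" "a \<in> carrier R" "b \<in> carrier R" "a \<otimes> b \<in> p"
  shows "a \<in> p \<or> b \<in> p"
  using primeideal.I_prime[OF maximalideal_prime[OF assms(1)]] assms(2-) by blast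

lemma (in cring) maximalideal_one_notin: "maximalideal p R \<Longrightarrow> \<one> \<notin> p"
  using ideal.one_imp_carrier maximalideal.I_notcarr maximalideal.axioms(1) by metis

subsection \<open>Powers of maximal ideals and the Chinese remainder theorem\<close>

lemma (in cring) ideal_power_0: "p [^]\<^bsub>ideals_set R\<^esub> (0::nat) = carrier R"
  by (simp add: ideals_set_def nat_pow_def)

lemma (in cring) ideal_power_Suc:
  "p [^]\<^bsub>ideals_set R\<^esub> Suc n = (p [^]\<^bsub>ideals_set R\<^esub> n) \<cdot>\<^bsub>R\<^esub> p"
  by (simp add: ideals_set_def nat_pow_def)

lemma (in cring) ideal_power_ideal:
  assumes "ideal p R"
  shows "ideal (p [^]\<^bsub>ideals_set R\<^esub> (n::nat)) R"
proof (induction n)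
  case 0 show ?case unfolding ideal_power_0 by (rule oneideal)
next
  case (Suc n) show ?case unfolding ideal_power_Suc by (rule ideal_prod_is_ideal[OF Suc assms])
qed

lemma (in cring) ideal_power_subset:
  assumes "ideal p R" "n \<ge> 1"
  shows "p [^]\<^bsub>ideals_set R\<^esub> (n::nat) \<subseteq> p"
proof -
  obtain m where m: "n = Suc m" using assms(2) by (cases n) auto
  show ?thesis
    unfolding m ideal_power_Suc using ideal_prod_inter[OF ideal_power_ideal[OF assms(1)] assms(1)] by blast
qed

lemma (in cring) pow_mem_ideal_power:
  assumes "ideal p R" "t \<in> p"
  shows "t [^] n \<in> p [^]\<^bsub>ideals_set R\<^esub> (n::nat)"
proof (induction n)
  case 0 show ?case unfolding ideal_power_0 by simp
next
  case (Suc n) show ?case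
    unfolding ideal_power_Suc using ideal_prod.prod[OF Suc assms(2), of R] by simp
qed

text \<open>The relation for the exponent \<open>Suc n\<close> is the product of those for \<open>n\<close> and \<open>1\<close>.\<close>
lemma (in cring) ideal_power_comaximal:
  assumes p: "maximalideal p R" and t: "t \<in> carrier R" "t \<notin> p"
  shows "\<exists>a\<in>carrier R. \<exists>b\<in>p [^]\<^bsub>ideals_set R\<^esub> (n::nat). a \<otimes> t \<oplus> b = \<one>"
proof (induction n)
  case 0
  have "\<zero> \<otimes> t \<oplus> \<one> = \<one>" using t by simp
  then show ?case unfolding ideal_power_0 by blast
next
  case (Suc n)
  have id: "ideal p R" using p by (rule maximalideal.axioms)
  obtain a b where a: "a \<in> carrier R" and b: "b \<in> p [^]\<^bsub>ideals_set R\<^esub> n" and ab: "a \<otimes> t \<oplus> b = \<one>"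
    using Suc by blast
  obtain c d where c: "c \<in> carrier R" and d: "d \<in> p" and cd: "c \<otimes> t \<oplus> d = \<one>"
    using maximalideal_comaximal[OF p t] .
  note cl = a c t(1) ideal.Icarr[OF ideal_power_ideal[OF id] b] ideal.Icarr[OF id d]
  have "((c \<oplus> a \<otimes> d) \<otimes> t) \<oplus> b \<otimes> d = c \<otimes> t \<oplus> (a \<otimes> t \<oplus> b) \<otimes> d"
    using cl by (simp add: l_distr r_distr m_ac a_ac)
  also have "\<dots> = \<one>" unfolding ab using cl cd by simp
  finally show ?case using ideal_prod.prod[OF b d, of R] cl unfolding ideal_power_Suc by blast
qed

text \<open>For \<open>t \<in> p\<close> outside \<open>q\<close>, the power \<open>t^m\<close> lies in \<open>p^m\<close> and is still outside the prime ideal \<open>q\<close>, so that it is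
  comaximal with \<open>q^n\<close>.\<close>
lemma (in cring) maximal_powers_comaximal:
  assumes p: "maximalideal p R" and q: "maximalideal q R" and "p \<noteq> q"
  shows "\<exists>a\<in>p [^]\<^bsub>ideals_set R\<^esub> (m::nat). \<exists>b\<in>q [^]\<^bsub>ideals_set R\<^esub> (n::nat). a \<oplus> b = \<one>"
proof -
  have idp: "ideal p R" and idq: "ideal q R" using p q by (auto intro: maximalideal.axioms)
  have "\<not> p \<subseteq> q"
    using maximalideal.I_maximal[OF p idq] maximalideal.I_notcarr[OF q] assms(3) ideal.Icarr[OF idq] by blast
  then obtain t where t: "t \<in> p" "t \<notin> q" by blast
  have tR: "t \<in> carrier R" using ideal.Icarr[OF idp t(1)] .
  have "t [^] m \<notin> q"
  proof (induction m)
    case 0 then show ?case using maximalideal_one_notin[OF q] by simp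
  next
    case (Suc m) then show ?case using maximalideal_primeE[OF q _ tR, of "t [^] m"] tR t(2) by auto
  qed
  moreover have tm: "t [^] m \<in> carrier R" using tR by simp
  ultimately obtain a b where ab: "a \<in> carrier R" "b \<in> q [^]\<^bsub>ideals_set R\<^esub> n" "a \<otimes> t [^] m \<oplus> b = \<one>"
    using ideal_power_comaximal[OF q tm] by blast
  then show ?thesis
    using ideal.I_l_closed[OF ideal_power_ideal[OF idp] pow_mem_ideal_power[OF idp t(1)]] by blast
qed

text \<open>Multiply the relations \<open>a + b = 1\<close> for the single ideals \<open>I i\<close>.\<close>
lemma (in cring) comaximal_Inter:
  assumes "finite S" "ideal A R"
    and "\<And>i. i \<in> S \<Longrightarrow> ideal (I i) R"
    and "\<And>i. i \<in> S \<Longrightarrow> \<exists>a\<in>A. \<exists>b\<in>I i. a \<oplus> b = \<one>"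
  shows "\<exists>a\<in>A. \<exists>b\<in>carrier R. (\<forall>i\<in>S. b \<in> I i) \<and> a \<oplus> b = \<one>"
  using assms(1,3,4)
proof (induction S rule: finite_induct)
  case empty
  have "\<zero> \<in> A" using assms(2) by (simp add: additive_subgroup.zero_closed ideal.axioms(1))
  moreover have "\<zero> \<oplus> \<one> = \<one>" by simp
  ultimately show ?case by blast
next
  case (insert i S)
  have Ii: "ideal (I i) R" using insert.prems(1) by simp
  have "\<exists>a\<in>A. \<exists>b\<in>carrier R. (\<forall>i\<in>S. b \<in> I i) \<and> a \<oplus> b = \<one>"
    by (rule insert.IH) (use insert.prems in auto)
  then obtain a b where ab: "a \<in> A" "b \<in> carrier R" "\<forall>i\<in>S. b \<in> I i" "a \<oplus> b = \<one>" by blast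
  have "\<exists>a\<in>A. \<exists>b\<in>I i. a \<oplus> b = \<one>" using insert.prems(2)[of i] by simp
  then obtain c d where cd: "c \<in> A" "d \<in> I i" "c \<oplus> d = \<one>" by blast
  note cl = ideal.Icarr[OF assms(2) ab(1)] ab(2) ideal.Icarr[OF assms(2) cd(1)] ideal.Icarr[OF Ii cd(2)]
  have "(a \<oplus> b \<otimes> c) \<oplus> b \<otimes> d = a \<oplus> b \<otimes> (c \<oplus> d)"
    using cl by (simp add: r_distr a_assoc)
  also have "\<dots> = \<one>" unfolding cd(3) using cl ab(4) by simp
  finally have eq: "(a \<oplus> b \<otimes> c) \<oplus> b \<otimes> d = \<one>" .
  have A: "a \<oplus> b \<otimes> c \<in> A"
    using additive_subgroup.a_closed[OF ideal.axioms(1)[OF assms(2)] ab(1) ideal.I_l_closed[OF assms(2) cd(1) ab(2)]] .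
  have B: "b \<otimes> d \<in> I j" if "j \<in> insert i S" for j
  proof (cases "j = i")
    case True then show ?thesis using ideal.I_l_closed[OF Ii cd(2) ab(2)] by simp
  next
    case False
    then have "j \<in> S" using that by simp
    then have "ideal (I j) R" "b \<in> I j" using insert.prems(1) ab(3) by auto
    then show ?thesis using ideal.I_r_closed cl(4) by metis
  qed
  have "b \<otimes> d \<in> carrier R" using cl by simp
  then show ?case using eq A B by blast
qed

text \<open>Induction on \<open>S\<close>: if \<open>r\<close> solves the congruences for \<open>S\<close> and \<open>a + b = 1\<close> with \<open>a \<in> I j\<close> and \<open>b\<close> in all \<open>I i\<close> with
  \<open>i \<in> S\<close>, then \<open>a r + b c j\<close> is congruent to \<open>c j\<close> modulo \<open>I j\<close> and to \<open>r\<close> modulo the other ideals.\<close>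
lemma (in cring) chinese_remainder:
  assumes "finite S"
    and "\<And>i. i \<in> S \<Longrightarrow> ideal (I i) R"
    and "\<And>i j. i \<in> S \<Longrightarrow> j \<in> S \<Longrightarrow> i \<noteq> j \<Longrightarrow> \<exists>a\<in>I i. \<exists>b\<in>I j. a \<oplus> b = \<one>"
    and "\<And>i. i \<in> S \<Longrightarrow> c i \<in> carrier R"
  shows "\<exists>r\<in>carrier R. \<forall>i\<in>S. r \<ominus> c i \<in> I i"
  using assms
proof (induction S rule: finite_induct)
  case empty
  then show ?case by blast
next
  case (insert j S)
  have Ij: "ideal (I j) R" and cj: "c j \<in> carrier R" using insert.prems(1,3) by auto
  have "\<exists>r\<in>carrier R. \<forall>i\<in>S. r \<ominus> c i \<in> I i"
    by (rule insert.IH) (use insert.prems in auto)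
  then obtain r where r: "r \<in> carrier R" "\<And>i. i \<in> S \<Longrightarrow> r \<ominus> c i \<in> I i" by blast
  have "\<exists>a\<in>I j. \<exists>b\<in>carrier R. (\<forall>i\<in>S. b \<in> I i) \<and> a \<oplus> b = \<one>"
  proof (rule comaximal_Inter[OF insert.hyps(1) Ij])
    show "ideal (I i) R" if "i \<in> S" for i using insert.prems(1) that by simp
    show "\<exists>a\<in>I j. \<exists>b\<in>I i. a \<oplus> b = \<one>" if "i \<in> S" for i
      using insert.prems(2)[of j i] that insert.hyps(2) by auto
  qed
  then obtain a b where ab: "a \<in> I j" "b \<in> carrier R" "\<And>i. i \<in> S \<Longrightarrow> b \<in> I i" "a \<oplus> b = \<one>" by blast
  have aR: "a \<in> carrier R" using ideal.Icarr[OF Ij ab(1)] .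
  have a: "a = \<one> \<ominus> b" using ab(2,4) aR by (metis add.inv_solve_right minus_eq one_closed)
  have b: "b = \<one> \<ominus> a" using ab(2,4) aR by (metis a_comm add.inv_solve_right minus_eq one_closed)
  let ?r = "a \<otimes> r \<oplus> b \<otimes> c j"
  have "?r \<ominus> c i \<in> I i" if i: "i \<in> insert j S" for i
  proof (cases "i = j")
    case True
    have "?r = c j \<oplus> a \<otimes> (r \<ominus> c j)"
      unfolding b using aR r(1) cj by algebra
    then have "?r \<ominus> c j = a \<otimes> (r \<ominus> c j)" using aR r(1) cj by algebra
    then show ?thesis using True ideal.I_r_closed[OF Ij ab(1)] r(1) cj by simp
  next
    case False
    then have iS: "i \<in> S" using i by simp
    have Ii: "ideal (I i) R" and ci: "c i \<in> carrier R" using insert.prems(1,3) iS by auto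
    have "?r = r \<oplus> b \<otimes> (c j \<ominus> r)"
      unfolding a using ab(2) r(1) cj by algebra
    then have eq: "?r \<ominus> c i = (r \<ominus> c i) \<oplus> b \<otimes> (c j \<ominus> r)" using ab(2) r(1) cj ci by algebra
    have "b \<otimes> (c j \<ominus> r) \<in> I i" using ideal.I_r_closed[OF Ii ab(3)[OF iS]] r(1) cj by simp
    then show ?thesis
      unfolding eq using additive_subgroup.a_closed[OF ideal.axioms(1)[OF Ii] r(2)[OF iS]] by blast
  qed
  moreover have "?r \<in> carrier R" using aR ab(2) r(1) cj by simp
  ultimately show ?case by blast
qed

subsection \<open>Uniformizers\<close>

text \<open>Every maximal ideal \<open>p\<close> containing \<open>a \<noteq> 0\<close> is the annihilator of an element of \<open>R/Ra\<close>. Indeed, among the annihilators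
  of elements of \<open>R/Ra\<close> that are contained in \<open>p\<close> there is a maximal one. It is prime and contains \<open>a\<close>, so
  by \<open>dim1\<close> it is a maximal ideal and hence equal to \<open>p\<close>.\<close>
lemma (in noetherian_domain) maximalideal_eq_colon:
  assumes dim1: "\<And>P. primeideal P R \<Longrightarrow> P \<noteq> {\<zero>} \<Longrightarrow> maximalideal P R"
    and p: "maximalideal p R" and a: "a \<in> p" "a \<noteq> \<zero>"
  obtains c where "c \<in> carrier R" "p = {r \<in> carrier R. r \<otimes> c \<in> PIdl a}"
proof -
  interpret p: maximalideal p R by fact
  have aR: "a \<in> carrier R" using a p.Icarr by blast
  interpret A: ideal "PIdl a" R using aR by (rule cgenideal_ideal)
  let ?F = "(\<lambda>c. {r \<in> carrier R. r \<otimes> c \<in> PIdl a}) ` {c \<in> carrier R. {r \<in> carrier R. r \<otimes> c \<in> PIdl a} \<subseteq> p}"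
  let ?col = "\<lambda>c. {r \<in> carrier R. r \<otimes> c \<in> PIdl a}"
  have colI: "ideal (?col c) R" if "c \<in> carrier R" for c
    using colon_ideal[OF A.is_ideal that] .
  have "?col \<one> \<subseteq> p"
  proof
    fix r assume "r \<in> ?col \<one>"
    then have "r \<in> carrier R" "r \<otimes> \<one> \<in> PIdl a" by blast+
    then have "r \<in> PIdl a" by simp
    then obtain x where x: "x \<in> carrier R" "r = x \<otimes> a" unfolding cgenideal_iff by blast
    then show "r \<in> p" using p.I_l_closed[OF a(1) x(1)] by simp
  qed
  then have one: "?col \<one> \<in> ?F" by (intro image_eqI[where x = \<one>]) auto
  have ne: "?F \<noteq> {}" using one by blast
  have idF: "ideal I R" if "I \<in> ?F" for I using that colI by auto
  obtain q where q: "q \<in> ?F" and max': "\<forall>J\<in>?F. q \<subseteq> J \<longrightarrow> J = q"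
    using exists_maximal_ideal_in[OF ne idF] by (rule bexE)
  have max: "?col c = q" if "c \<in> carrier R" "?col c \<subseteq> p" "q \<subseteq> ?col c" for c
    using that by (intro max'[rule_format] image_eqI[where x = c]) auto
  from q obtain c where c: "c \<in> carrier R" "q = ?col c" "q \<subseteq> p" by (elim imageE) auto
  have prime: "y \<in> q" if xy: "x \<in> carrier R" "y \<in> carrier R" "x \<otimes> y \<in> q" "x \<notin> q" for x y
  proof (cases "?col (x \<otimes> c) \<subseteq> p")
    case True
    have "q \<subseteq> ?col (x \<otimes> c)"
    proof
      fix r assume "r \<in> q"
      then have r: "r \<in> carrier R" "r \<otimes> c \<in> PIdl a" using c(2) by blast+
      then show "r \<in> ?col (x \<otimes> c)"
        using A.I_l_closed[OF r(2) xy(1)] c(1) xy(1) by (simp add: m_lcomm)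
    qed
    then have "?col (x \<otimes> c) = q" using max[OF _ True] c(1) xy(1) by blast
    moreover have "y \<in> ?col (x \<otimes> c)" using xy c by (simp add: m_ac)
    ultimately show ?thesis by blast
  next
    case False
    then obtain t where t: "t \<in> carrier R" "t \<otimes> (x \<otimes> c) \<in> PIdl a" "t \<notin> p" by blast
    have "r \<in> p" if "r \<in> carrier R" "r \<otimes> (t \<otimes> c) \<in> PIdl a" for r
    proof -
      have "r \<otimes> t \<in> q" using that t(1) c by (simp add: m_assoc)
      then show ?thesis using c(3) maximalideal_primeE[OF p that(1) t(1)] t(3) by blast
    qed
    then have "?col (t \<otimes> c) \<subseteq> p" by blast
    moreover have "q \<subseteq> ?col (t \<otimes> c)"
    proof
      fix r assume "r \<in> q"
      then have r: "r \<in> carrier R" "r \<otimes> c \<in> PIdl a" using c(2) by blast+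
      then show "r \<in> ?col (t \<otimes> c)"
        using A.I_l_closed[OF r(2) t(1)] c(1) t(1) by (simp add: m_lcomm)
    qed
    ultimately have "?col (t \<otimes> c) = q" using max[of "t \<otimes> c"] c(1) t(1) by blast
    moreover have "x \<in> ?col (t \<otimes> c)" using xy(1) t c(1) by (simp add: m_lcomm)
    ultimately show ?thesis using xy(4) by blast
  qed
  have "carrier R \<noteq> q" using c(3) p.I_notcarr p.a_subset by blast
  then have "primeideal q R"
    using primeidealI[OF colI[OF c(1), folded c(2)] is_cring] prime by blast
  moreover have "a \<in> q" unfolding c(2) cgenideal_iff using c(1) aR m_comm by blast
  ultimately have "maximalideal q R" using dim1 a(2) by blast
  then have "p = q"
    using maximalideal.I_maximal[of q R p] p.is_ideal c(3) p.I_notcarr p.a_subset by blast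
  have "p = ?col c" by (rule trans[OF \<open>p = q\<close> c(2)])
  show thesis by (rule that[OF c(1) \<open>p = ?col c\<close>])
qed

text \<open>The fraction \<open>x = c/a\<close> is integral: the elements \<open>z n = a x^n\<close> all lie in the Noetherian ring \<open>R\<close>, so some
  \<open>z n\<close> with \<open>n > 0\<close> is a linear combination of the earlier ones, and dividing by \<open>a\<close> turns this into a monic equation.\<close>
lemma integrally_closed_quotient:
  fixes R (structure)
  assumes D: "dedekind_domain R K \<phi>"
    and a: "a \<in> carrier R" "a \<noteq> \<zero>" and c: "c \<in> carrier R"
    and z: "\<And>n::nat. z n \<in> carrier R" "z 0 = a" "\<And>n. c \<otimes> z n = a \<otimes> z (Suc n)"
  shows "\<exists>b\<in>carrier R. c = b \<otimes> a"
proof -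
  interpret R: noetherian_domain R using D by (simp add: dedekind_domain_def)
  interpret K: field K using D by (simp add: dedekind_domain_def field_of_fractions_def)
  interpret D: dedekind_domain R K \<phi> by fact
  interpret h: ring_hom_cring R K \<phi>
    by (unfold_locales) (rule D.frac_hom)
  define F where "F n = (\<lambda>d. \<Oplus>i\<in>{..<n}. d i \<otimes> z i) ` ({..<n} \<rightarrow> carrier R)" for n :: nat
  have FE: "\<exists>d. d \<in> {..<n} \<rightarrow> carrier R \<and> x = (\<Oplus>i\<in>{..<n}. d i \<otimes> z i)" if "x \<in> F n" for x n
    using that unfolding F_def image_def mem_Collect_eq Bex_def .
  have FI: "(\<Oplus>i\<in>{..<n}. d i \<otimes> z i) \<in> F n" if "d \<in> {..<n} \<rightarrow> carrier R" for d n
    using that unfolding F_def by (rule imageI)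
  have Fid: "ideal (F n) R" for n
  proof -
    have ml: "x \<otimes> y \<in> F n" if y: "y \<in> F n" and x: "x \<in> carrier R" for x y
    proof -
      obtain d where d: "d \<in> {..<n} \<rightarrow> carrier R" "y = (\<Oplus>i\<in>{..<n}. d i \<otimes> z i)"
        using FE[OF y] by blast
      have "x \<otimes> y = (\<Oplus>i\<in>{..<n}. (x \<otimes> d i) \<otimes> z i)"
      proof -
        have "x \<otimes> y = (\<Oplus>i\<in>{..<n}. x \<otimes> (d i \<otimes> z i))"
          unfolding d(2) by (rule R.finsum_rdistr) (use d(1) z(1) x in auto)
        also have "\<dots> = (\<Oplus>i\<in>{..<n}. (x \<otimes> d i) \<otimes> z i)"
          by (rule R.finsum_cong') (use d(1) z(1) x in \<open>auto simp: Pi_iff R.m_assoc\<close>)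
        finally show ?thesis .
      qed
      then show ?thesis using FI[of "\<lambda>i. x \<otimes> d i" n] d that by auto
    qed
    have FR: "F n \<subseteq> carrier R" using z(1) by (auto simp: F_def Pi_iff intro!: R.finsum_closed)
    show ?thesis
    proof (rule R.idealI_closed[OF FR])
      show "F n \<noteq> {}" using FI[of "\<lambda>_. \<zero>" n] by auto
      fix x y assume x: "x \<in> F n" and y: "y \<in> F n"
      obtain d e where d: "d \<in> {..<n} \<rightarrow> carrier R" "x = (\<Oplus>i\<in>{..<n}. d i \<otimes> z i)"
        and e: "e \<in> {..<n} \<rightarrow> carrier R" "y = (\<Oplus>i\<in>{..<n}. e i \<otimes> z i)"
        using FE[OF x] FE[OF y] by blast
      have "x \<oplus> y = (\<Oplus>i\<in>{..<n}. d i \<otimes> z i \<oplus> e i \<otimes> z i)"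
        unfolding d(2) e(2)
        by (rule R.finsum_addf[symmetric]) (use d(1) e(1) z(1) in \<open>auto simp: Pi_iff\<close>)
      also have "\<dots> = (\<Oplus>i\<in>{..<n}. (d i \<oplus> e i) \<otimes> z i)"
        by (rule R.finsum_cong') (use d(1) e(1) z(1) in \<open>auto simp: Pi_iff R.l_distr\<close>)
      finally show "x \<oplus> y \<in> F n" using FI[of "\<lambda>i. d i \<oplus> e i" n] d e by auto
    qed (rule ml)
  qed
  have Fz: "F n \<subseteq> F (Suc n)" "z n \<in> F (Suc n)" for n
  proof -
    have *: "(\<Oplus>i\<in>{..<Suc n}. (if i < n then d i else e) \<otimes> z i) = e \<otimes> z n \<oplus> (\<Oplus>i\<in>{..<n}. d i \<otimes> z i)"
      if "d \<in> {..<n} \<rightarrow> carrier R" "e \<in> carrier R" for d e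
    proof -
      have "(\<Oplus>i\<in>{..<Suc n}. (if i < n then d i else e) \<otimes> z i)
        = e \<otimes> z n \<oplus> (\<Oplus>i\<in>{..<n}. (if i < n then d i else e) \<otimes> z i)"
        unfolding lessThan_Suc using that z(1) by (subst R.finsum_insert) (auto simp: Pi_iff)
      also have "(\<Oplus>i\<in>{..<n}. (if i < n then d i else e) \<otimes> z i) = (\<Oplus>i\<in>{..<n}. d i \<otimes> z i)"
        using that z(1) by (intro R.finsum_cong') (auto simp: Pi_iff)
      finally show ?thesis .
    qed
    have cl: "(\<Oplus>i\<in>{..<n}. d i \<otimes> z i) \<in> carrier R" if "d \<in> {..<n} \<rightarrow> carrier R" for d
      using that z(1) by (auto simp: Pi_iff intro!: R.finsum_closed)
    show "F n \<subseteq> F (Suc n)"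
    proof
      fix x assume "x \<in> F n"
      then obtain d where d: "d \<in> {..<n} \<rightarrow> carrier R" "x = (\<Oplus>i\<in>{..<n}. d i \<otimes> z i)"
        using FE by blast
      then have "x = (\<Oplus>i\<in>{..<Suc n}. (if i < n then d i else \<zero>) \<otimes> z i)"
        using *[OF d(1), of \<zero>] cl[OF d(1)] z(1) by simp
      moreover have "(\<lambda>i. if i < n then d i else \<zero>) \<in> {..<Suc n} \<rightarrow> carrier R" using d(1) by auto
      ultimately show "x \<in> F (Suc n)" by (simp add: FI)
    qed
    have "(\<Oplus>i\<in>{..<n}. \<zero> \<otimes> z i) = \<zero>"
      using z(1) by (simp add: R.add.finprod_one_eqI)
    then have "z n = (\<Oplus>i\<in>{..<Suc n}. (if i < n then \<zero> else \<one>) \<otimes> z i)"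
      using *[of "\<lambda>_. \<zero>" \<one>] z(1) by simp
    moreover have "(\<lambda>i. if i < n then \<zero> else \<one>) \<in> {..<Suc n} \<rightarrow> carrier R" by auto
    ultimately show "z n \<in> F (Suc n)" using FI by metis
  qed
  obtain G where "G \<in> range F" and max: "\<forall>J\<in>range F. G \<subseteq> J \<longrightarrow> J = G"
    using R.exists_maximal_ideal_in[of "range F"] Fid by blast
  then obtain n where "G = F n" by blast
  then have zn: "z n \<in> F n" using Fz[of n] max by blast
  have "n > 0"
  proof (rule ccontr)
    assume "\<not> n > 0"
    then show False using zn z(2) a by (auto simp: F_def)
  qed
  obtain d where d: "d \<in> {..<n} \<rightarrow> carrier R" "z n = (\<Oplus>i\<in>{..<n}. d i \<otimes> z i)"
    using FE[OF zn] by blast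
  define x where "x = \<phi> c \<otimes>\<^bsub>K\<^esub> inv\<^bsub>K\<^esub> (\<phi> a)"
  have "\<phi> a \<noteq> \<zero>\<^bsub>K\<^esub>"
    using D.frac_inj a h.hom_zero by (metis R.zero_closed inj_onD)
  then have aU: "\<phi> a \<in> Units K" using a K.field_Units by auto
  have x: "x \<in> carrier K" using aU c by (auto simp: x_def)
  have xa: "x \<otimes>\<^bsub>K\<^esub> \<phi> a = \<phi> c"
    using aU c a by (simp add: x_def K.m_assoc)
  have zx: "\<phi> (z i) = \<phi> a \<otimes>\<^bsub>K\<^esub> x [^]\<^bsub>K\<^esub> i" for i
  proof (induction i)
    case 0 then show ?case using z a by simp
  next
    case (Suc i)
    have "\<phi> a \<otimes>\<^bsub>K\<^esub> \<phi> (z (Suc i)) = \<phi> c \<otimes>\<^bsub>K\<^esub> \<phi> (z i)"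
      using z(3)[of i] z(1) a c by (metis h.hom_mult)
    also have "\<dots> = \<phi> a \<otimes>\<^bsub>K\<^esub> (\<phi> a \<otimes>\<^bsub>K\<^esub> x [^]\<^bsub>K\<^esub> Suc i)"
      unfolding Suc xa[symmetric] using x a by (simp add: K.m_ac)
    finally show ?case
      using aU z(1) a x by (subst (asm) K.Units_l_cancel) auto
  qed
  let ?S = "\<lambda>d. \<Oplus>\<^bsub>K\<^esub>i\<in>{..<n}. \<phi> (d i) \<otimes>\<^bsub>K\<^esub> x [^]\<^bsub>K\<^esub> i"
  have Scl: "?S e \<in> carrier K" if "e \<in> {..<n} \<rightarrow> carrier R" for e
    using that x by (auto simp: Pi_iff intro!: K.finsum_closed)
  have "\<phi> a \<otimes>\<^bsub>K\<^esub> x [^]\<^bsub>K\<^esub> n = \<phi> (\<Oplus>i\<in>{..<n}. d i \<otimes> z i)"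
    using zx[of n] d(2) by simp
  also have "\<dots> = (\<Oplus>\<^bsub>K\<^esub>i\<in>{..<n}. (\<phi> \<circ> (\<lambda>i. d i \<otimes> z i)) i)"
    using h.hom_finsum[of "\<lambda>i. d i \<otimes> z i" "{..<n}"] d(1) z(1) by (simp add: Pi_iff)
  also have "\<dots> = (\<Oplus>\<^bsub>K\<^esub>i\<in>{..<n}. \<phi> a \<otimes>\<^bsub>K\<^esub> (\<phi> (d i) \<otimes>\<^bsub>K\<^esub> x [^]\<^bsub>K\<^esub> i))"
    by (rule K.finsum_cong') (use d(1) z(1) x a in \<open>auto simp: Pi_iff zx K.m_lcomm\<close>)
  also have "\<dots> = \<phi> a \<otimes>\<^bsub>K\<^esub> ?S d"
    by (rule K.finsum_rdistr[symmetric]) (use d(1) x a in \<open>auto simp: Pi_iff\<close>)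
  finally have xn: "x [^]\<^bsub>K\<^esub> n = ?S d"
    using aU a x Scl[OF d(1)] by (subst (asm) K.Units_l_cancel) auto
  have nd: "(\<lambda>i. \<ominus> d i) \<in> {..<n} \<rightarrow> carrier R" using d(1) by auto
  have "?S d \<oplus>\<^bsub>K\<^esub> ?S (\<lambda>i. \<ominus> d i)
      = (\<Oplus>\<^bsub>K\<^esub>i\<in>{..<n}. \<phi> (d i) \<otimes>\<^bsub>K\<^esub> x [^]\<^bsub>K\<^esub> i \<oplus>\<^bsub>K\<^esub> \<phi> (\<ominus> d i) \<otimes>\<^bsub>K\<^esub> x [^]\<^bsub>K\<^esub> i)"
    by (rule K.finsum_addf[symmetric]) (use d(1) x in \<open>auto simp: Pi_iff\<close>)
  also have "\<dots> = \<zero>\<^bsub>K\<^esub>"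
    using d(1) x by (intro K.add.finprod_one_eqI) (auto simp: Pi_iff K.l_minus K.r_neg)
  finally have "x [^]\<^bsub>K\<^esub> n \<oplus>\<^bsub>K\<^esub> ?S (\<lambda>i. \<ominus> d i) = \<zero>\<^bsub>K\<^esub>" unfolding xn .
  then have "integral_elem R K \<phi> x"
    unfolding integral_elem_def using \<open>n > 0\<close> nd
    by (intro exI[of _ n] conjI bexI[of _ "\<lambda>i. \<ominus> d i"])
  then obtain b where b: "b \<in> carrier R" "x = \<phi> b" using D.integrally_closed x by blast
  then have "\<phi> c = \<phi> (b \<otimes> a)" using xa a by simp
  then show ?thesis using D.frac_inj b a c by (meson R.m_closed inj_onD)
qed

text \<open>After localisation at \<open>p\<close> the ideal \<open>p\<close> is generated by \<open>v\<close>, with \<open>s\<close> as a common denominator.\<close>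
locale uniformizer = noetherian_domain R for R (structure) +
  fixes p v s
  assumes maximal: "maximalideal p R"
    and v: "v \<in> p" "v \<noteq> \<zero>"
    and s: "s \<in> carrier R" "s \<notin> p"
    and principal: "y \<in> p \<Longrightarrow> \<exists>r\<in>carrier R. s \<otimes> y = r \<otimes> v"

text \<open>For \<open>a\<close> and \<open>c\<close> with \<open>p = (Ra : c)\<close>, the fraction \<open>x = c/a\<close> maps \<open>p\<close> into \<open>R\<close>. If it mapped \<open>p\<close> into \<open>p\<close>,
  then all \<open>a x^n\<close> would lie in \<open>p\<close>, so \<open>x\<close> would be in \<open>R\<close> by integral closedness and \<open>1\<close> would be in \<open>p\<close>.
  So there is \<open>v \<in> p\<close> such that \<open>s = x v\<close> is outside \<open>p\<close>, and then \<open>s y = (x y) v\<close> for \<open>y \<in> p\<close>.\<close>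
lemma dedekind_exists_uniformizer:
  fixes R (structure)
  assumes D: "dedekind_domain R K \<phi>" and p: "maximalideal p R" "p \<noteq> {\<zero>}"
  shows "\<exists>v s. uniformizer R p v s"
proof -
  interpret R: noetherian_domain R using D by (simp add: dedekind_domain_def)
  interpret p: maximalideal p R by fact
  have dim1: "\<And>P. primeideal P R \<Longrightarrow> P \<noteq> {\<zero>} \<Longrightarrow> maximalideal P R"
    using D by (simp add: dedekind_domain_def dedekind_domain_axioms_def)
  have "\<not> p \<subseteq> {\<zero>}" using p(2) p.zero_closed by (metis empty_iff subset_singletonD)
  then obtain a where a: "a \<in> p" "a \<noteq> \<zero>" unfolding subset_iff by auto
  have aR: "a \<in> carrier R" using a p.Icarr by blast
  obtain c where c: "c \<in> carrier R" and pc: "p = {r \<in> carrier R. r \<otimes> c \<in> PIdl a}"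
    using R.maximalideal_eq_colon[OF dim1 p(1) a] by metis
  have ca: "\<exists>x\<in>carrier R. c \<otimes> y = a \<otimes> x" if "y \<in> p" for y
  proof -
    have "y \<otimes> c \<in> PIdl a" using that pc by blast
    then show ?thesis using p.Icarr[OF that] c aR by (metis R.cgenideal_iff R.m_comm)
  qed
  show ?thesis
  proof (cases "\<forall>y\<in>p. \<forall>x\<in>carrier R. c \<otimes> y = a \<otimes> x \<longrightarrow> x \<in> p")
    case True
    then have step: "\<exists>x. x \<in> p \<and> c \<otimes> y = a \<otimes> x" if "y \<in> p" for y using ca[OF that] that by blast
    \<comment> \<open>The sequence is \<open>z n = a (c/a)^n\<close>.\<close>
    obtain z where z: "\<And>n. z n \<in> p" "z 0 = a" "\<And>n. c \<otimes> z n = a \<otimes> z (Suc n)"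
      using dependent_nat_choice[of "\<lambda>n x. x \<in> p \<and> (n = 0 \<longrightarrow> x = a)" "\<lambda>_ y x. c \<otimes> y = a \<otimes> x"]
        a step by blast
    then obtain b where b: "b \<in> carrier R" "c = b \<otimes> a"
      using integrally_closed_quotient[OF D aR a(2) c, of z] p.Icarr by blast
    then have "\<one> \<in> p" unfolding pc using c by (auto simp: R.cgenideal_iff)
    then show ?thesis using R.maximalideal_one_notin[OF p(1)] by blast
  next
    case False
    then obtain v s where v: "v \<in> p" and s: "s \<in> carrier R" "s \<notin> p" and cv: "c \<otimes> v = a \<otimes> s"
      by blast
    have vR: "v \<in> carrier R" using v p.Icarr by blast
    have "v \<noteq> \<zero>"
    proof
      assume "v = \<zero>"
      then have "s = \<zero>" using cv c s(1) aR a(2) R.integral[of a s] by auto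
      then show False using s(2) p.zero_closed by blast
    qed
    moreover have "\<exists>r\<in>carrier R. s \<otimes> y = r \<otimes> v" if y: "y \<in> p" for y
    proof -
      obtain r where r: "r \<in> carrier R" "c \<otimes> y = a \<otimes> r" using ca[OF y] by blast
      have yR: "y \<in> carrier R" using y p.Icarr by blast
      have "a \<otimes> (s \<otimes> y) = (c \<otimes> v) \<otimes> y" using cv aR s yR by (simp add: R.m_assoc)
      also have "\<dots> = (c \<otimes> y) \<otimes> v" using c vR yR by (simp add: R.m_ac)
      also have "\<dots> = a \<otimes> (r \<otimes> v)" using r aR vR by (simp add: R.m_assoc)
      finally have "s \<otimes> y = r \<otimes> v" using R.m_lcancel[OF a(2) aR] s r vR yR by auto
      then show ?thesis using r by blast
    qed
    ultimately have "uniformizer R p v s"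
      by (intro uniformizer.intro R.noetherian_domain_axioms uniformizer_axioms.intro) (use p v s in auto)
    then show ?thesis by blast
  qed
qed

context uniformizer
begin

lemma p_ideal: "ideal p R" using maximal by (rule maximalideal.axioms)

lemma p_closed: "x \<in> p \<Longrightarrow> x \<in> carrier R"
  using ideal.Icarr[OF p_ideal] .

lemma v_closed [simp]: "v \<in> carrier R" using p_closed v(1) .

lemma s_closed [simp]: "s \<in> carrier R" by (rule s(1))

lemma p_mult: "r \<in> carrier R \<Longrightarrow> y \<in> p \<Longrightarrow> r \<otimes> y \<in> p"
  using ideal.I_l_closed[OF p_ideal] by blast

lemma notin_p_mult:
  "t \<in> carrier R \<Longrightarrow> u \<in> carrier R \<Longrightarrow> t \<notin> p \<Longrightarrow> u \<notin> p \<Longrightarrow> t \<otimes> u \<notin> p"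
  using maximalideal_primeE[OF maximal] by blast

lemma one_notin_p: "\<one> \<notin> p" using maximalideal_one_notin[OF maximal] .

lemma notin_p_nonzero: "t \<notin> p \<Longrightarrow> t \<noteq> \<zero>"
  using additive_subgroup.zero_closed[OF ideal.axioms(1)[OF p_ideal]] by blast

lemma s_pow_notin_p: "s [^] (n::nat) \<notin> p"
proof (induction n)
  case 0 then show ?case using one_notin_p by simp
next
  case (Suc n) then show ?case using notin_p_mult[of "s [^] n" s] s by simp
qed

lemma v_pow_nonzero: "v [^] (n::nat) \<noteq> \<zero>"
proof (induction n)
  case (Suc n) then show ?case using integral[of "v [^] n" v] v(2) by auto
qed simp

text \<open>The contraction to \<open>R\<close> of the \<open>n\<close>-th power of the maximal ideal of the localisation at \<open>p\<close>, with the fixed denominator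
  \<open>s^n\<close>.\<close>
definition symbolic_power :: "nat \<Rightarrow> 'a set" where
  "symbolic_power n = {y \<in> carrier R. \<exists>r\<in>carrier R. s [^] n \<otimes> y = r \<otimes> v [^] n}"

lemma symbolic_powerI:
  "y \<in> carrier R \<Longrightarrow> r \<in> carrier R \<Longrightarrow> s [^] n \<otimes> y = r \<otimes> v [^] n \<Longrightarrow> y \<in> symbolic_power n"
  unfolding symbolic_power_def by blast

lemma symbolic_powerE:
  assumes "y \<in> symbolic_power n"
  obtains r where "y \<in> carrier R" "r \<in> carrier R" "s [^] n \<otimes> y = r \<otimes> v [^] n"
  using assms unfolding symbolic_power_def by blast

lemma symbolic_power_closed: "y \<in> symbolic_power n \<Longrightarrow> y \<in> carrier R"
  by (simp add: symbolic_power_def)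

lemma symbolic_power_ideal: "ideal (symbolic_power n) R"
proof (rule idealI_closed)
  show "symbolic_power n \<subseteq> carrier R" by (auto dest: symbolic_power_closed)
  have "\<zero> \<in> symbolic_power n" by (rule symbolic_powerI[of _ \<zero>]) auto
  then show "symbolic_power n \<noteq> {}" by blast
  fix y assume y: "y \<in> symbolic_power n"
  obtain r where r: "y \<in> carrier R" "r \<in> carrier R" "s [^] n \<otimes> y = r \<otimes> v [^] n"
    using y by (rule symbolic_powerE)
  show "x \<otimes> y \<in> symbolic_power n" if x: "x \<in> carrier R" for x
  proof (rule symbolic_powerI)
    have "s [^] n \<otimes> (x \<otimes> y) = x \<otimes> (s [^] n \<otimes> y)" using x r by (simp add: m_lcomm)
    then show "s [^] n \<otimes> (x \<otimes> y) = (x \<otimes> r) \<otimes> v [^] n" using x r by (simp add: m_assoc)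
  qed (use x r in auto)
  fix x assume "x \<in> symbolic_power n"
  then obtain q where q: "x \<in> carrier R" "q \<in> carrier R" "s [^] n \<otimes> x = q \<otimes> v [^] n"
    by (rule symbolic_powerE)
  show "x \<oplus> y \<in> symbolic_power n"
    by (rule symbolic_powerI[of _ "q \<oplus> r"]) (use q r in \<open>simp_all add: r_distr l_distr\<close>)
qed

lemma symbolic_power_mult: "r \<in> carrier R \<Longrightarrow> y \<in> symbolic_power n \<Longrightarrow> r \<otimes> y \<in> symbolic_power n"
  using ideal.I_l_closed[OF symbolic_power_ideal] by blast

lemma symbolic_power_add: "x \<in> symbolic_power n \<Longrightarrow> y \<in> symbolic_power n \<Longrightarrow> x \<oplus> y \<in> symbolic_power n"
  using additive_subgroup.a_closed[OF ideal.axioms(1)[OF symbolic_power_ideal]] by blast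

lemma symbolic_power_0: "symbolic_power 0 = carrier R"
  by (auto simp: symbolic_power_def)

lemma symbolic_power_Suc_mult:
  assumes "x \<in> symbolic_power n" "y \<in> p"
  shows "x \<otimes> y \<in> symbolic_power (Suc n)"
proof -
  obtain q where q: "x \<in> carrier R" "q \<in> carrier R" "s [^] n \<otimes> x = q \<otimes> v [^] n"
    using assms(1) by (rule symbolic_powerE)
  obtain r where r: "r \<in> carrier R" "s \<otimes> y = r \<otimes> v" using principal[OF assms(2)] by blast
  have y: "y \<in> carrier R" using assms(2) by (rule p_closed)
  have "s [^] Suc n \<otimes> (x \<otimes> y) = (s [^] n \<otimes> x) \<otimes> (s \<otimes> y)" using q(1,2) y by (simp add: m_ac)
  also have "\<dots> = (q \<otimes> r) \<otimes> v [^] Suc n" unfolding q(3) r(2) using q(2) r(1) by (simp add: m_ac)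
  finally show ?thesis by (rule symbolic_powerI[rotated 2]) (use q r y in auto)
qed

lemma ideal_power_subset_symbolic_power: "p [^]\<^bsub>ideals_set R\<^esub> n \<subseteq> symbolic_power n"
proof (induction n)
  case 0
  show ?case unfolding symbolic_power_0 ideal_power_0 by simp
next
  case (Suc n)
  show ?case
  proof
    fix x assume "x \<in> p [^]\<^bsub>ideals_set R\<^esub> Suc n"
    then have "x \<in> (p [^]\<^bsub>ideals_set R\<^esub> n) \<cdot>\<^bsub>R\<^esub> p" by (simp only: ideal_power_Suc)
    then show "x \<in> symbolic_power (Suc n)"
      by (induction rule: ideal_prod.induct)
        (use Suc in \<open>auto intro: symbolic_power_Suc_mult symbolic_power_add\<close>)
  qed
qed

lemma symbolic_power_comaximal:
  assumes "t \<in> carrier R" "t \<notin> p"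
  shows "\<exists>a\<in>carrier R. \<exists>b\<in>symbolic_power n. a \<otimes> t \<oplus> b = \<one>"
  using ideal_power_comaximal[OF maximal assms, of n] ideal_power_subset_symbolic_power[of n] by blast

text \<open>By comaximality \<open>t\<close> is invertible modulo the symbolic power.\<close>
lemma symbolic_power_saturated:
  assumes t: "t \<in> carrier R" "t \<notin> p" and y: "y \<in> carrier R" "t \<otimes> y \<in> symbolic_power n"
  shows "y \<in> symbolic_power n"
proof -
  obtain a b where a: "a \<in> carrier R" and b: "b \<in> symbolic_power n" and ab: "a \<otimes> t \<oplus> b = \<one>"
    using symbolic_power_comaximal[OF t] by blast
  have "a \<otimes> (t \<otimes> y) \<oplus> y \<otimes> b = (a \<otimes> t \<oplus> b) \<otimes> y"
    using a t(1) y(1) symbolic_power_closed[OF b] by (simp add: l_distr r_distr m_ac)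
  also have "\<dots> = y" unfolding ab using y(1) by simp
  finally show ?thesis
    using symbolic_power_add[OF symbolic_power_mult[OF a y(2)] symbolic_power_mult[OF y(1) b]] by simp
qed

lemma multiple_v_pow_mem:
  assumes "n \<le> k" "r \<in> carrier R"
  shows "r \<otimes> v [^] k \<in> symbolic_power n"
proof -
  have "v [^] k = v [^] (k - n) \<otimes> v [^] n" using assms by (simp add: nat_pow_mult)
  then have "s [^] n \<otimes> (r \<otimes> v [^] k) = (s [^] n \<otimes> r \<otimes> v [^] (k - n)) \<otimes> v [^] n"
    using assms by (simp add: m_assoc)
  then show ?thesis by (rule symbolic_powerI[rotated 2]) (use assms in auto)
qed

lemma v_pow_mem: "v [^] (n::nat) \<in> symbolic_power n"
  using multiple_v_pow_mem[of n n \<one>] by simp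

lemma symbolic_power_antimono: "n \<le> m \<Longrightarrow> symbolic_power m \<subseteq> symbolic_power n"
proof
  fix y assume "n \<le> m" "y \<in> symbolic_power m"
  then show "y \<in> symbolic_power n"
    by (metis symbolic_powerE multiple_v_pow_mem s_closed s_pow_notin_p nat_pow_closed symbolic_power_saturated)
qed

text \<open>If \<open>i < n\<close>, then cancelling \<open>v^i\<close> would put the product \<open>s^n w\<close> of elements outside \<open>p\<close> into \<open>R v\<close>.\<close>
lemma unit_v_pow_mem_iff:
  assumes w: "w \<in> carrier R" "w \<notin> p"
  shows "w \<otimes> v [^] i \<in> symbolic_power n \<longleftrightarrow> n \<le> i"
proof
  assume "w \<otimes> v [^] i \<in> symbolic_power n"
  then obtain r where r: "r \<in> carrier R" "s [^] n \<otimes> (w \<otimes> v [^] i) = r \<otimes> v [^] n"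
    by (rule symbolic_powerE)
  show "n \<le> i"
  proof (rule ccontr)
    assume "\<not> n \<le> i"
    then obtain k where k: "n = Suc k + i" by (metis add.commute add_Suc_right less_imp_Suc_add not_le)
    have "(s [^] n \<otimes> w) \<otimes> v [^] i = (r \<otimes> v [^] Suc k) \<otimes> v [^] i"
      using r w unfolding k by (simp add: m_ac nat_pow_mult[symmetric])
    then have "s [^] n \<otimes> w = r \<otimes> v [^] Suc k"
      using m_rcancel[OF v_pow_nonzero[of i], of "s [^] n \<otimes> w" "r \<otimes> v [^] Suc k"] r w by simp
    also have "\<dots> \<in> p" using p_mult[of "r \<otimes> v [^] k" v] v r by (simp add: m_assoc)
    finally show False using notin_p_mult[of "s [^] n" w] s_pow_notin_p w by simp
  qed
qed (rule multiple_v_pow_mem[OF _ w(1)])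

text \<open>The element \<open>s^n\<close> is invertible modulo \<open>p^n\<close>, so \<open>y\<close> lies in \<open>p^n\<close> as soon as \<open>s^n y\<close> does.\<close>
lemma ideal_power_eq_symbolic_power: "p [^]\<^bsub>ideals_set R\<^esub> n = symbolic_power n"
proof
  show "p [^]\<^bsub>ideals_set R\<^esub> n \<subseteq> symbolic_power n" by (rule ideal_power_subset_symbolic_power)
  show "symbolic_power n \<subseteq> p [^]\<^bsub>ideals_set R\<^esub> n"
  proof
    fix y assume "y \<in> symbolic_power n"
    then obtain r where r: "y \<in> carrier R" "r \<in> carrier R" "s [^] n \<otimes> y = r \<otimes> v [^] n"
      by (rule symbolic_powerE)
    note id = ideal_power_ideal[OF p_ideal, of n]
    have sc: "s [^] n \<in> carrier R" by simp
    obtain a b where a: "a \<in> carrier R" and b: "b \<in> p [^]\<^bsub>ideals_set R\<^esub> n" and ab: "a \<otimes> s [^] n \<oplus> b = \<one>"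
      using ideal_power_comaximal[OF maximal sc s_pow_notin_p, of n] by blast
    have bR: "b \<in> carrier R" using ideal.Icarr[OF id b] .
    have "y = (a \<otimes> s [^] n \<oplus> b) \<otimes> y" unfolding ab using r(1) by simp
    also have "\<dots> = a \<otimes> (s [^] n \<otimes> y) \<oplus> b \<otimes> y"
      using a bR r(1) by (simp add: l_distr m_assoc)
    also have "\<dots> = (a \<otimes> r) \<otimes> v [^] n \<oplus> b \<otimes> y"
      unfolding r(3) using a r(2) by (simp add: m_assoc)
    also have "\<dots> \<in> p [^]\<^bsub>ideals_set R\<^esub> n"
      using additive_subgroup.a_closed[OF ideal.axioms(1)[OF id]
          ideal.I_l_closed[OF id pow_mem_ideal_power[OF p_ideal v(1)], of "a \<otimes> r"] ideal.I_r_closed[OF id b r(1)]]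
        a r(2) by simp
    finally show "y \<in> p [^]\<^bsub>ideals_set R\<^esub> n" .
  qed
qed

text \<open>The exponent \<open>j\<close> is the valuation of \<open>x\<close> at \<open>p\<close>. An element \<open>a \<in> p\<close> can be divided by \<open>v\<close> after multiplication
  by \<open>s\<close>, say \<open>s a = r v\<close>. This process stops, since the ideal \<open>J a\<close> of all elements that some \<open>t \<notin> p\<close>
  multiplies into \<open>R a\<close> becomes strictly larger when \<open>a\<close> is replaced by \<open>r\<close>.\<close>
lemma normal_form:
  assumes "x \<in> carrier R" "x \<noteq> \<zero>"
  shows "\<exists>(j::nat) t u. t \<in> carrier R \<and> t \<notin> p \<and> u \<in> carrier R \<and> u \<notin> p \<and> t \<otimes> x = u \<otimes> v [^] j"
proof (rule ccontr)
  define good where "good x \<longleftrightarrow>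
    (\<exists>(j::nat) t u. t \<in> carrier R \<and> t \<notin> p \<and> u \<in> carrier R \<and> u \<notin> p \<and> t \<otimes> x = u \<otimes> v [^] j)" for x
  assume "\<not> (\<exists>(j::nat) t u. t \<in> carrier R \<and> t \<notin> p \<and> u \<in> carrier R \<and> u \<notin> p \<and> t \<otimes> x = u \<otimes> v [^] j)"
  then have bad: "\<not> good x" by (simp add: good_def)
  define J where "J a = {y \<in> carrier R. \<exists>t\<in>carrier R. t \<notin> p \<and> (\<exists>z\<in>carrier R. t \<otimes> y = z \<otimes> a)}" for a
  have JI: "y \<in> J a" if "y \<in> carrier R" "t \<in> carrier R" "t \<notin> p" "z \<in> carrier R" "t \<otimes> y = z \<otimes> a" for y t z a
    unfolding J_def using that by blast
  have JE: "y \<in> carrier R \<and> (\<exists>t z. t \<in> carrier R \<and> t \<notin> p \<and> z \<in> carrier R \<and> t \<otimes> y = z \<otimes> a)" if "y \<in> J a" for y a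
    using that unfolding J_def by blast
  define B where "B = {a \<in> carrier R. a \<noteq> \<zero> \<and> \<not> good a}"
  have Jid: "ideal (J a) R" if a: "a \<in> carrier R" for a
  proof (rule idealI_closed)
    show "J a \<subseteq> carrier R" using JE by blast
    have "\<zero> \<in> J a" by (rule JI[of _ \<one> \<zero>]) (use a one_notin_p in auto)
    then show "J a \<noteq> {}" by blast
    fix y assume y: "y \<in> J a"
    obtain t z where t: "y \<in> carrier R" "t \<in> carrier R" "t \<notin> p" "z \<in> carrier R" "t \<otimes> y = z \<otimes> a"
      using JE[OF y] by auto
    show "w \<otimes> y \<in> J a" if w: "w \<in> carrier R" for w
    proof -
      have "t \<otimes> (w \<otimes> y) = w \<otimes> (t \<otimes> y)" using t(1-4) w by (simp add: m_lcomm)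
      also have "\<dots> = (w \<otimes> z) \<otimes> a" unfolding t(5) using t w a by (simp add: m_assoc)
      finally show ?thesis using t w by (intro JI[of "w \<otimes> y" t "w \<otimes> z"]) auto
    qed
    fix x assume "x \<in> J a"
    then obtain t' z' where t': "x \<in> carrier R" "t' \<in> carrier R" "t' \<notin> p" "z' \<in> carrier R" "t' \<otimes> x = z' \<otimes> a"
      using JE[of x a] by auto
    have "(t \<otimes> t') \<otimes> (x \<oplus> y) = t \<otimes> (t' \<otimes> x) \<oplus> t' \<otimes> (t \<otimes> y)"
      using t(1-4) t'(1-4) by (simp add: r_distr m_ac)
    also have "\<dots> = (t \<otimes> z' \<oplus> t' \<otimes> z) \<otimes> a"
      unfolding t(5) t'(5) using t(2,4) t'(2,4) a by (simp add: l_distr m_assoc)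
    finally show "x \<oplus> y \<in> J a"
      using t t' notin_p_mult[OF t(2) t'(2) t(3) t'(3)]
      by (intro JI[of "x \<oplus> y" "t \<otimes> t'" "t \<otimes> z' \<oplus> t' \<otimes> z"]) auto
  qed
  have "\<exists>I\<in>J ` B. \<forall>I'\<in>J ` B. I \<subseteq> I' \<longrightarrow> I' = I"
  proof (rule exists_maximal_ideal_in)
    show "J ` B \<noteq> {}" using bad assms by (auto simp: B_def)
    show "ideal I R" if "I \<in> J ` B" for I using that Jid by (auto simp: B_def)
  qed
  then obtain a where a: "a \<in> B" and max: "\<forall>b\<in>B. J a \<subseteq> J b \<longrightarrow> J b = J a" by auto
  then have aR: "a \<in> carrier R" "a \<noteq> \<zero>" "\<not> good a" by (auto simp: B_def)
  have "a \<in> p"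
  proof (rule ccontr)
    assume "a \<notin> p"
    then have "good a" unfolding good_def using aR one_notin_p
      by (intro exI[of _ 0] exI[of _ \<one>] exI[of _ a]) simp
    then show False using aR by blast
  qed
  then obtain r where r: "r \<in> carrier R" "s \<otimes> a = r \<otimes> v" using principal by blast
  have "r \<noteq> \<zero>"
  proof
    assume "r = \<zero>"
    then have "s \<otimes> a = \<zero>" using r by simp
    then show False using integral[of s a] aR notin_p_nonzero[OF s(2)] by auto
  qed
  moreover have "\<not> good r"
  proof
    assume "good r"
    then obtain j t u where t: "t \<in> carrier R" "t \<notin> p" "u \<in> carrier R" "u \<notin> p" "t \<otimes> r = u \<otimes> v [^] (j::nat)"
      unfolding good_def by blast
    have "(t \<otimes> s) \<otimes> a = (t \<otimes> r) \<otimes> v" using t(1) r aR(1) by (simp add: m_assoc)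
    also have "\<dots> = u \<otimes> v [^] Suc j" unfolding t(5) using t(3) by (simp add: m_assoc)
    finally have "good a" unfolding good_def
      using t notin_p_mult[OF t(1) s(1) t(2) s(2)]
      by (intro exI[of _ "Suc j"] exI[of _ "t \<otimes> s"] exI[of _ u]) simp
    then show False using aR by blast
  qed
  ultimately have "r \<in> B" using r by (simp add: B_def)
  moreover have "J a \<subseteq> J r"
  proof
    fix y assume "y \<in> J a"
    then obtain t z where t: "y \<in> carrier R" "t \<in> carrier R" "t \<notin> p" "z \<in> carrier R" "t \<otimes> y = z \<otimes> a"
      using JE by blast
    have "(t \<otimes> s) \<otimes> y = s \<otimes> (t \<otimes> y)" using t(1-4) by (simp add: m_ac)
    also have "\<dots> = z \<otimes> (s \<otimes> a)" unfolding t(5) using t(4) aR(1) by (simp add: m_lcomm)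
    also have "\<dots> = (z \<otimes> v) \<otimes> r" unfolding r(2) using t(4) r(1) by (simp add: m_ac)
    finally show "y \<in> J r"
      using t notin_p_mult[OF t(2) s(1) t(3) s(2)] by (intro JI[of y "t \<otimes> s" "z \<otimes> v"]) auto
  qed
  ultimately have "J r = J a" using max by blast
  moreover have "r \<in> J r" by (rule JI[of r \<one> \<one>]) (use r one_notin_p in auto)
  ultimately have "r \<in> J a" by simp
  then obtain t z where t: "t \<in> carrier R" "t \<notin> p" "z \<in> carrier R" "t \<otimes> r = z \<otimes> a"
    using JE by blast
  have "(t \<otimes> s) \<otimes> a = (t \<otimes> r) \<otimes> v" using t(1) r aR(1) by (simp add: m_assoc)
  also have "\<dots> = (z \<otimes> v) \<otimes> a" unfolding t(4) using t(3) aR(1) by (simp add: m_ac)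
  finally have "t \<otimes> s = z \<otimes> v" using m_rcancel[OF aR(2,1)] t by simp
  then show False using notin_p_mult[OF t(1) s(1) t(2) s(2)] p_mult[OF t(3) v(1)] by simp
qed

end

section \<open>Ideals of domains with uniformizers\<close>

text \<open>The localisations at the nonzero maximal ideals are discrete valuation rings; this holds in particular for Dedekind domains.\<close>
locale uniformized_domain = noetherian_domain R for R (structure) +
  assumes exists_uniformizer:
    "maximalideal p R \<Longrightarrow> p \<noteq> {\<zero>} \<Longrightarrow> \<exists>v s. uniformizer R p v s"

lemma dedekind_imp_uniformized_domain:
  assumes "dedekind_domain R K \<phi>"
  shows "uniformized_domain R"
  using assms dedekind_exists_uniformizer[OF assms]
  by (intro uniformized_domain.intro uniformized_domain_axioms.intro) (simp_all add: dedekind_domain_def)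

context uniformizer
begin

lemma mem_symbolic_power_iff:
  assumes "x \<in> carrier R" "t \<in> carrier R" "t \<notin> p" "u \<in> carrier R" "u \<notin> p" "t \<otimes> x = u \<otimes> v [^] j"
  shows "x \<in> symbolic_power n \<longleftrightarrow> n \<le> j"
proof
  assume "x \<in> symbolic_power n"
  then have "t \<otimes> x \<in> symbolic_power n" using symbolic_power_mult assms(2) by blast
  then show "n \<le> j" using unit_v_pow_mem_iff[OF assms(4,5)] assms(6) by simp
next
  assume "n \<le> j"
  then have "t \<otimes> x \<in> symbolic_power n" using unit_v_pow_mem_iff[OF assms(4,5)] assms(6) by simp
  then show "x \<in> symbolic_power n" using symbolic_power_saturated assms(1-3) by blast
qed

text \<open>Choose \<open>x \<in> I\<close> of least valuation \<open>j\<close> at \<open>p\<close>.\<close>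
lemma ideal_local_generator:
  assumes I: "ideal I R" "I \<noteq> {\<zero>}"
  shows "\<exists>j x t u. x \<in> I \<and> t \<in> carrier R \<and> t \<notin> p \<and> u \<in> carrier R \<and> u \<notin> p \<and>
    t \<otimes> x = u \<otimes> v [^] (j::nat) \<and> I \<subseteq> symbolic_power j"
proof -
  define P where "P j \<longleftrightarrow> (\<exists>x t u. x \<in> I \<and> t \<in> carrier R \<and> t \<notin> p \<and> u \<in> carrier R \<and> u \<notin> p \<and>
    t \<otimes> x = u \<otimes> v [^] j)" for j :: nat
  have nf: "\<exists>j. P j \<and> (\<exists>t u. t \<in> carrier R \<and> t \<notin> p \<and> u \<in> carrier R \<and> u \<notin> p \<and> t \<otimes> x = u \<otimes> v [^] j)"
    if "x \<in> I" "x \<noteq> \<zero>" for x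
    using normal_form[OF ideal.Icarr[OF I(1) that(1)] that(2)] that(1) unfolding P_def by blast
  have I0: "\<zero> \<in> I" using I(1) by (simp add: additive_subgroup.zero_closed ideal.axioms(1))
  then obtain x0 where "x0 \<in> I" "x0 \<noteq> \<zero>" using I(2) by auto
  then have ex: "\<exists>j. P j" using nf by blast
  have sub: "I \<subseteq> symbolic_power (LEAST j. P j)"
  proof
    fix y assume y: "y \<in> I"
    show "y \<in> symbolic_power (LEAST j. P j)"
    proof (cases "y = \<zero>")
      case True
      then show ?thesis
        using additive_subgroup.zero_closed[OF ideal.axioms(1)[OF symbolic_power_ideal]] by simp
    next
      case False
      then obtain i t u where i: "P i" and tu: "t \<in> carrier R" "t \<notin> p" "u \<in> carrier R" "u \<notin> p" "t \<otimes> y = u \<otimes> v [^] i"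
        using nf[OF y] by blast
      have "(LEAST j. P j) \<le> i" using i by (rule Least_le)
      then show ?thesis using mem_symbolic_power_iff[OF ideal.Icarr[OF I(1) y] tu] by simp
    qed
  qed
  have "P (LEAST j. P j)" using ex by (rule LeastI_ex)
  then show ?thesis using sub unfolding P_def[of "LEAST j. P j"] by blast
qed

text \<open>The ideals \<open>I\<close> and \<open>p^j\<close> agree after localisation at \<open>p\<close>, and one multiplier \<open>t\<close> takes all of \<open>p^j\<close> into \<open>I\<close>:
  with a local generator \<open>t' x = u v^j\<close> of \<open>I\<close>, the multiplier \<open>u s^j\<close> works.\<close>
lemma ideal_localization:
  assumes I: "ideal I R" "I \<noteq> {\<zero>}"
  shows "\<exists>(j::nat) t. t \<in> carrier R \<and> t \<notin> p \<and> I \<subseteq> symbolic_power j \<and> (\<forall>y\<in>symbolic_power j. t \<otimes> y \<in> I)"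
proof -
  obtain j x t u where x: "x \<in> I" and t: "t \<in> carrier R" "t \<notin> p" and u: "u \<in> carrier R" "u \<notin> p"
    and tx: "t \<otimes> x = u \<otimes> v [^] (j::nat)" and sub: "I \<subseteq> symbolic_power j"
    using ideal_local_generator[OF I] by auto
  have xR: "x \<in> carrier R" using ideal.Icarr[OF I(1) x] .
  let ?t = "u \<otimes> s [^] j"
  have "?t \<otimes> y \<in> I" if "y \<in> symbolic_power j" for y
  proof -
    from that obtain r where r: "y \<in> carrier R" "r \<in> carrier R" "s [^] j \<otimes> y = r \<otimes> v [^] j"
      by (rule symbolic_powerE)
    have "?t \<otimes> y = u \<otimes> (s [^] j \<otimes> y)" using u r(1) by (simp add: m_assoc)
    also have "\<dots> = (r \<otimes> t) \<otimes> x" unfolding r(3) using r(2) u(1) t(1) xR tx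
      by (simp add: m_lcomm m_assoc)
    also have "\<dots> \<in> I" using ideal.I_l_closed[OF I(1) x] r t by simp
    finally show ?thesis .
  qed
  moreover have "?t \<notin> p" using notin_p_mult[of u "s [^] j"] u s_pow_notin_p by simp
  moreover have "?t \<in> carrier R" using u by simp
  ultimately show ?thesis using sub by blast
qed

end

context uniformized_domain
begin

text \<open>A maximal counterexample \<open>I\<close> is contained in a maximal ideal \<open>p\<close> and agrees with some \<open>p^j\<close> locally at \<open>p\<close>.
  The quotient \<open>J = (I : p^j)\<close> contains \<open>I\<close> and an element \<open>t \<notin> p\<close>, so it is strictly larger than \<open>I\<close> and
  satisfies \<open>P\<close>. Since \<open>t\<close> and \<open>p^j\<close> are comaximal, \<open>p^j \<inter> J = I\<close>.\<close>
lemma nonzero_ideal_induct [consumes 2, case_names carrier step]: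
  assumes "ideal I R" "I \<noteq> {\<zero>}"
    and carrier: "P (carrier R)"
    and step: "\<And>p n J. \<lbrakk>maximalideal p R; p \<noteq> {\<zero>}; n \<ge> (1::nat); ideal J R; J \<noteq> {\<zero>}; \<not> J \<subseteq> p; P J\<rbrakk>
      \<Longrightarrow> P (p [^]\<^bsub>ideals_set R\<^esub> n \<inter> J)"
  shows "P I"
proof (rule ccontr)
  assume "\<not> P I"
  let ?F = "{I. ideal I R \<and> I \<noteq> {\<zero>} \<and> \<not> P I}"
  have "\<exists>I\<in>?F. \<forall>J\<in>?F. I \<subseteq> J \<longrightarrow> J = I"
    by (rule exists_maximal_ideal_in) (use assms(1,2) \<open>\<not> P I\<close> in auto)
  then obtain I where "I \<in> ?F" and max: "\<forall>J\<in>?F. I \<subseteq> J \<longrightarrow> J = I" by (rule bexE)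
  then have I: "ideal I R" "I \<noteq> {\<zero>}" "\<not> P I" by simp_all
  have "I \<noteq> carrier R" using I(3) carrier by auto
  then obtain p where p: "maximalideal p R" "I \<subseteq> p"
    using exists_maximalideal_above[OF I(1)] by metis
  have I0: "\<zero> \<in> I" using I(1) by (simp add: additive_subgroup.zero_closed ideal.axioms(1))
  have "p \<noteq> {\<zero>}" using I(2) I0 p(2) by auto
  then obtain v s where "uniformizer R p v s" using exists_uniformizer p(1) by metis
  then interpret U: uniformizer R p v s .
  obtain j :: nat and t where t: "t \<in> carrier R" "t \<notin> p" and sub: "I \<subseteq> U.symbolic_power j"
    and tI: "\<forall>y\<in>U.symbolic_power j. t \<otimes> y \<in> I"
    using U.ideal_localization[OF I(1,2)] by auto
  have "j \<noteq> 0"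
  proof
    assume "j = 0"
    then have "t \<otimes> \<one> \<in> I" using tI by (simp add: U.symbolic_power_0)
    then show False using t p(2) by auto
  qed
  \<comment> \<open>The ideal quotient \<open>(I : p^j)\<close>.\<close>
  define J where "J = {r \<in> carrier R. \<forall>y\<in>U.symbolic_power j. r \<otimes> y \<in> I}"
  have "J = \<Inter> ((\<lambda>y. {r \<in> carrier R. r \<otimes> y \<in> I}) ` U.symbolic_power j)"
    using U.v_pow_mem[of j] by (auto simp: J_def)
  moreover have "ideal (\<Inter> ((\<lambda>y. {r \<in> carrier R. r \<otimes> y \<in> I}) ` U.symbolic_power j)) R"
  proof (rule i_Intersect)
    show "ideal A R" if "A \<in> (\<lambda>y. {r \<in> carrier R. r \<otimes> y \<in> I}) ` U.symbolic_power j" for A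
      using that colon_ideal[OF I(1)] U.symbolic_power_closed by auto
    show "(\<lambda>y. {r \<in> carrier R. r \<otimes> y \<in> I}) ` U.symbolic_power j \<noteq> {}"
      using U.v_pow_mem[of j] by blast
  qed
  ultimately have Jid: "ideal J R" by simp
  have tJ: "t \<in> J" using t(1) tI unfolding J_def by blast
  have IJ: "I \<subseteq> J"
  proof
    fix y assume y: "y \<in> I"
    show "y \<in> J" unfolding J_def
      using ideal.Icarr[OF I(1) y] ideal.I_r_closed[OF I(1) y] U.symbolic_power_closed by blast
  qed
  have "J \<noteq> I" using tJ t(2) p(2) by blast
  moreover have "J \<noteq> {\<zero>}" using IJ I(2) I0 by auto
  ultimately have "P J" using max IJ Jid by blast
  moreover have "\<not> J \<subseteq> p" using tJ t(2) by blast
  ultimately have "P (p [^]\<^bsub>ideals_set R\<^esub> j \<inter> J)"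
    using step[OF p(1) \<open>p \<noteq> {\<zero>}\<close> _ Jid \<open>J \<noteq> {\<zero>}\<close>] \<open>j \<noteq> 0\<close> by simp
  moreover have "U.symbolic_power j \<inter> J = I"
  proof
    show "I \<subseteq> U.symbolic_power j \<inter> J" using sub IJ by blast
    show "U.symbolic_power j \<inter> J \<subseteq> I"
    proof
      fix r assume r: "r \<in> U.symbolic_power j \<inter> J"
      obtain a b where a: "a \<in> carrier R" and b: "b \<in> U.symbolic_power j" and ab: "a \<otimes> t \<oplus> b = \<one>"
        using U.symbolic_power_comaximal[OF t, of j] by blast
      have rR: "r \<in> carrier R" using r U.symbolic_power_closed by blast
      have bR: "b \<in> carrier R" using b by (rule U.symbolic_power_closed)
      have "r = (a \<otimes> t \<oplus> b) \<otimes> r" unfolding ab using rR by simp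
      also have "\<dots> = a \<otimes> (t \<otimes> r) \<oplus> r \<otimes> b" using a rR bR t(1) by (simp add: l_distr m_assoc m_comm[of b r])
      also have "\<dots> \<in> I"
      proof (rule additive_subgroup.a_closed[OF ideal.axioms(1)[OF I(1)]])
        show "a \<otimes> (t \<otimes> r) \<in> I"
          using ideal.I_l_closed[OF I(1) _ a] tJ r unfolding J_def by blast
        show "r \<otimes> b \<in> I" using r b unfolding J_def by blast
      qed
      finally show "r \<in> I" .
    qed
  qed
  ultimately show False using I(3) U.ideal_power_eq_symbolic_power by simp
qed

text \<open>In the induction step \<open>p\<close> differs from the maximal ideals that occur in the decomposition of \<open>J\<close>, because these contain \<open>J\<close>
  and \<open>p\<close> does not.\<close>
lemma nonzero_ideal_decomposition:
  assumes "ideal I R" "I \<noteq> {\<zero>}"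
  shows "\<exists>(k::nat) p (n :: nat \<Rightarrow> nat). (\<forall>i\<in>{1..k}. maximalideal (p i) R \<and> n i \<ge> 1) \<and> inj_on p {1..k} \<and>
    I = {r \<in> carrier R. \<forall>i\<in>{1..k}. r \<in> p i [^]\<^bsub>ideals_set R\<^esub> n i}"
  using assms
proof (induction rule: nonzero_ideal_induct)
  case carrier
  have "carrier R = {r \<in> carrier R. \<forall>i\<in>{1..0::nat}. r \<in> undefined i [^]\<^bsub>ideals_set R\<^esub> (undefined i :: nat)}"
    by simp
  then show ?case by (intro exI[of _ 0] exI[of _ undefined]) simp
next
  case (step P m J)
  obtain k p and n :: "nat \<Rightarrow> nat" where *: "\<And>i. i \<in> {1..k} \<Longrightarrow> maximalideal (p i) R \<and> n i \<ge> 1" "inj_on p {1..k}"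
    and J: "J = {r \<in> carrier R. \<forall>i\<in>{1..k}. r \<in> p i [^]\<^bsub>ideals_set R\<^esub> n i}"
    using step.IH by blast
  have ne: "p i \<noteq> P" if "i \<in> {1..k}" for i
  proof
    assume "p i = P"
    then have "J \<subseteq> P [^]\<^bsub>ideals_set R\<^esub> n i" using that J by blast
    also have "\<dots> \<subseteq> P"
      using ideal_power_subset[OF maximalideal.axioms(1)[OF step.hyps(1)]] *(1)[OF that] by blast
    finally show False using step.hyps(6) by blast
  qed
  let ?p = "p(Suc k := P)" and ?n = "n(Suc k := m)"
  have "\<forall>i\<in>{1..Suc k}. maximalideal (?p i) R \<and> ?n i \<ge> 1"
    using * step.hyps(1,3) by (auto simp: le_Suc_eq)
  moreover have "inj_on ?p {1..Suc k}"
  proof (rule inj_onI)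
    fix i j assume "i \<in> {1..Suc k}" "j \<in> {1..Suc k}" "?p i = ?p j"
    then show "i = j"
      using ne[of i] ne[of j] inj_onD[OF *(2), of i j] by (auto simp: le_Suc_eq split: if_splits)
  qed
  moreover have "P [^]\<^bsub>ideals_set R\<^esub> m \<inter> J = {r \<in> carrier R. \<forall>i\<in>{1..Suc k}. r \<in> ?p i [^]\<^bsub>ideals_set R\<^esub> ?n i}"
  proof -
    have "(\<forall>i\<in>{1..Suc k}. r \<in> ?p i [^]\<^bsub>ideals_set R\<^esub> ?n i) \<longleftrightarrow>
        r \<in> P [^]\<^bsub>ideals_set R\<^esub> m \<and> (\<forall>i\<in>{1..k}. r \<in> p i [^]\<^bsub>ideals_set R\<^esub> n i)" for r
    proof -
      have "{1..Suc k} = insert (Suc k) {1..k}" by auto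
      moreover have "(\<forall>i\<in>{1..k}. r \<in> ?p i [^]\<^bsub>ideals_set R\<^esub> ?n i) \<longleftrightarrow> (\<forall>i\<in>{1..k}. r \<in> p i [^]\<^bsub>ideals_set R\<^esub> n i)"
        by (intro ball_cong refl) simp
      ultimately show ?thesis by simp
    qed
    then show ?thesis
      using ideal.Icarr[OF ideal_power_ideal[OF maximalideal.axioms(1)[OF step.hyps(1)]]]
      by (auto simp: J)
  qed
  ultimately show ?case by blast
qed

end

section \<open>Weakly IN modules\<close>

lemma (in abelian_group) minus_eq_zero_iff:
  assumes "a \<in> carrier G" "b \<in> carrier G"
  shows "a \<ominus> b = \<zero> \<longleftrightarrow> a = b"
proof
  assume "a \<ominus> b = \<zero>"
  moreover have "a = (a \<ominus> b) \<oplus> b" using assms by (simp add: minus_eq a_assoc l_neg)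
  ultimately show "a = b" using assms by simp
qed (use assms in \<open>simp add: minus_eq r_neg\<close>)

lemma (in module) smult_eq_smult_iff:
  assumes "r \<in> carrier R" "q \<in> carrier R" "x \<in> carrier M"
  shows "r \<odot>\<^bsub>M\<^esub> x = q \<odot>\<^bsub>M\<^esub> x \<longleftrightarrow> (r \<ominus> q) \<odot>\<^bsub>M\<^esub> x = \<zero>\<^bsub>M\<^esub>"
proof -
  have "(r \<ominus> q) \<odot>\<^bsub>M\<^esub> x = r \<odot>\<^bsub>M\<^esub> x \<ominus>\<^bsub>M\<^esub> q \<odot>\<^bsub>M\<^esub> x"
    using assms by (simp add: R.minus_eq M.minus_eq smult_l_distr smult_l_minus)
  then show ?thesis using M.minus_eq_zero_iff assms by simp
qed

context module
begin

lemma cyclic_submodule: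
  assumes x: "x \<in> carrier M"
  shows "submodule ((\<lambda>r. r \<odot>\<^bsub>M\<^esub> x) ` carrier R) R M"
proof (rule submoduleI)
  show "(\<lambda>r. r \<odot>\<^bsub>M\<^esub> x) ` carrier R \<subseteq> carrier M" using x by auto
  have "\<zero>\<^bsub>M\<^esub> = \<zero> \<odot>\<^bsub>M\<^esub> x" using x by simp
  then show "\<zero>\<^bsub>M\<^esub> \<in> (\<lambda>r. r \<odot>\<^bsub>M\<^esub> x) ` carrier R" by (rule image_eqI) simp
next
  fix y assume "y \<in> (\<lambda>r. r \<odot>\<^bsub>M\<^esub> x) ` carrier R"
  then obtain r where r: "r \<in> carrier R" "y = r \<odot>\<^bsub>M\<^esub> x" by blast
  have "\<ominus>\<^bsub>M\<^esub> y = (\<ominus> r) \<odot>\<^bsub>M\<^esub> x" using r x by (simp add: smult_l_minus)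
  then show "\<ominus>\<^bsub>M\<^esub> y \<in> (\<lambda>r. r \<odot>\<^bsub>M\<^esub> x) ` carrier R" by (rule image_eqI) (use r in simp)
  fix z assume "z \<in> (\<lambda>r. r \<odot>\<^bsub>M\<^esub> x) ` carrier R"
  then obtain q where q: "q \<in> carrier R" "z = q \<odot>\<^bsub>M\<^esub> x" by blast
  have "y \<oplus>\<^bsub>M\<^esub> z = (r \<oplus> q) \<odot>\<^bsub>M\<^esub> x" using r q x by (simp add: smult_l_distr)
  then show "y \<oplus>\<^bsub>M\<^esub> z \<in> (\<lambda>r. r \<odot>\<^bsub>M\<^esub> x) ` carrier R" by (rule image_eqI) (use r q in simp)
next
  fix a y assume a: "a \<in> carrier R" and "y \<in> (\<lambda>r. r \<odot>\<^bsub>M\<^esub> x) ` carrier R"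
  then obtain r where r: "r \<in> carrier R" "y = r \<odot>\<^bsub>M\<^esub> x" by blast
  have "a \<odot>\<^bsub>M\<^esub> y = (a \<otimes> r) \<odot>\<^bsub>M\<^esub> x" using r a x by (simp add: smult_assoc1)
  then show "a \<odot>\<^bsub>M\<^esub> y \<in> (\<lambda>r. r \<odot>\<^bsub>M\<^esub> x) ` carrier R" by (rule image_eqI) (use r a in simp)
qed

lemma zero_submodule: "submodule {\<zero>\<^bsub>M\<^esub>} R M"
  by (rule submoduleI) auto

lemma multipliers_into_submodule_ideal:
  assumes N: "submodule N R M" and x: "x \<in> carrier M"
  shows "ideal {r \<in> carrier R. r \<odot>\<^bsub>M\<^esub> x \<in> N} R"
proof (rule R.idealI_closed)
  note E = submoduleE[OF N]
  let ?I = "{r \<in> carrier R. r \<odot>\<^bsub>M\<^esub> x \<in> N}"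
  show "?I \<subseteq> carrier R" by auto
  have "\<zero>\<^bsub>M\<^esub> \<in> N" using N by (auto simp: submodule_def subgroup_def)
  then have "\<zero> \<in> ?I" using x by simp
  then show "?I \<noteq> {}" by blast
  show "r \<oplus> q \<in> ?I" if "r \<in> ?I" "q \<in> ?I" for r q
    using that E(5) x by (simp add: smult_l_distr)
  show "a \<otimes> r \<in> ?I" if "a \<in> carrier R" "r \<in> ?I" for a r
    using that E(4) x by (simp add: smult_assoc1)
qed

lemma annihilator_ideal: "x \<in> carrier M \<Longrightarrow> ideal {r \<in> carrier R. r \<odot>\<^bsub>M\<^esub> x = \<zero>\<^bsub>M\<^esub>} R"
  using multipliers_into_submodule_ideal[OF zero_submodule] by simp

lemma weakly_IN_comaximal:
  assumes "weakly_IN R M" "submodule N R M" "submodule L R M" "N \<inter> L = {\<zero>\<^bsub>M\<^esub>}"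
  shows "\<exists>a\<in>Ann R M N. \<exists>b\<in>Ann R M L. a \<oplus> b = \<one>"
proof -
  have "Ann R M N <+>\<^bsub>R\<^esub> Ann R M L = carrier R"
    using assms unfolding weakly_IN_def by blast
  then have "\<one> \<in> Ann R M N <+>\<^bsub>R\<^esub> Ann R M L" by simp
  then show ?thesis unfolding set_add_def' by fastforce
qed

lemma weakly_IN_independent:
  assumes W: "weakly_IN R M" and x: "x \<in> carrier M" and y: "y \<in> carrier M"
    and indep: "\<And>a b. a \<in> carrier R \<Longrightarrow> b \<in> carrier R \<Longrightarrow> a \<odot>\<^bsub>M\<^esub> x = b \<odot>\<^bsub>M\<^esub> y \<Longrightarrow> a \<odot>\<^bsub>M\<^esub> x = \<zero>\<^bsub>M\<^esub>"
  shows "\<exists>a\<in>carrier R. \<exists>b\<in>carrier R. a \<odot>\<^bsub>M\<^esub> x = \<zero>\<^bsub>M\<^esub> \<and> b \<odot>\<^bsub>M\<^esub> y = \<zero>\<^bsub>M\<^esub> \<and> a \<oplus> b = \<one>"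
proof -
  let ?N = "(\<lambda>r. r \<odot>\<^bsub>M\<^esub> x) ` carrier R" and ?L = "(\<lambda>r. r \<odot>\<^bsub>M\<^esub> y) ` carrier R"
  have N: "submodule ?N R M" and L: "submodule ?L R M" using cyclic_submodule x y by auto
  have "z = \<zero>\<^bsub>M\<^esub>" if z: "z \<in> ?N" "z \<in> ?L" for z
  proof -
    from z(1) obtain a where a: "a \<in> carrier R" "z = a \<odot>\<^bsub>M\<^esub> x" by (rule imageE) auto
    from z(2) obtain b where b: "b \<in> carrier R" "z = b \<odot>\<^bsub>M\<^esub> y" by (rule imageE) auto
    show ?thesis using indep[OF a(1) b(1)] a b by simp
  qed
  moreover have "\<zero>\<^bsub>M\<^esub> \<in> ?N" "\<zero>\<^bsub>M\<^esub> \<in> ?L"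
    using N L by (auto simp: submodule_def subgroup_def)
  ultimately have "?N \<inter> ?L = {\<zero>\<^bsub>M\<^esub>}" by blast
  then obtain a b where a: "a \<in> Ann R M ?N" and b: "b \<in> Ann R M ?L" and ab: "a \<oplus> b = \<one>"
    using weakly_IN_comaximal[OF W N L] by blast
  have "x \<in> ?N" using x by (intro image_eqI[of _ _ \<one>]) auto
  moreover have "y \<in> ?L" using y by (intro image_eqI[of _ _ \<one>]) auto
  ultimately have "a \<odot>\<^bsub>M\<^esub> x = \<zero>\<^bsub>M\<^esub>" "b \<odot>\<^bsub>M\<^esub> y = \<zero>\<^bsub>M\<^esub>" using a b unfolding Ann_def by blast+
  moreover have "a \<in> carrier R" "b \<in> carrier R" using a b unfolding Ann_def by blast+
  ultimately show ?thesis using ab by blast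
qed

lemma comaximal_imp_Ann_sum:
  assumes "submodule N R M" "submodule L R M" "a \<in> Ann R M N" "b \<in> Ann R M L" "a \<oplus> b = \<one>"
  shows "Ann R M N <+>\<^bsub>R\<^esub> Ann R M L = carrier R"
proof
  show "Ann R M N <+>\<^bsub>R\<^esub> Ann R M L \<subseteq> carrier R"
    unfolding set_add_def' Ann_def by auto
  show "carrier R \<subseteq> Ann R M N <+>\<^bsub>R\<^esub> Ann R M L"
  proof
    fix r assume r: "r \<in> carrier R"
    have ab: "a \<in> carrier R" "b \<in> carrier R" using assms(3,4) by (auto simp: Ann_def)
    have ml: "r \<otimes> c \<in> Ann R M H" if "c \<in> Ann R M H" "submodule H R M" for c H
    proof -
      have "H \<subseteq> carrier M" using that(2) by (rule submoduleE)
      then show ?thesis using that(1) r by (auto simp: Ann_def smult_assoc1 subset_iff)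
    qed
    have "r = r \<otimes> a \<oplus> r \<otimes> b" using r ab assms(5) by (metis R.r_distr R.r_one)
    then show "r \<in> Ann R M N <+>\<^bsub>R\<^esub> Ann R M L"
      using ml[OF assms(3,1)] ml[OF assms(4,2)] unfolding set_add_def' by blast
  qed
qed

text \<open>One of two submodules with intersection \<open>0\<close> is \<open>0\<close>, and the annihilator of \<open>0\<close> is \<open>R\<close>.\<close>
lemma uniform_imp_weakly_IN:
  assumes uniform: "\<And>x y. x \<in> carrier M \<Longrightarrow> y \<in> carrier M \<Longrightarrow> x \<noteq> \<zero>\<^bsub>M\<^esub> \<Longrightarrow> y \<noteq> \<zero>\<^bsub>M\<^esub> \<Longrightarrow>
    \<exists>a\<in>carrier R. \<exists>b\<in>carrier R. a \<odot>\<^bsub>M\<^esub> x = b \<odot>\<^bsub>M\<^esub> y \<and> a \<odot>\<^bsub>M\<^esub> x \<noteq> \<zero>\<^bsub>M\<^esub>"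
  shows "weakly_IN R M"
  unfolding weakly_IN_def
proof (intro allI impI)
  fix N L assume N: "submodule N R M" and L: "submodule L R M" and NL: "N \<inter> L = {\<zero>\<^bsub>M\<^esub>}"
  have z: "\<zero> \<in> Ann R M H" if "submodule H R M" for H
    using submoduleE(1)[OF that] by (auto simp: Ann_def)
  have o: "\<one> \<in> Ann R M {\<zero>\<^bsub>M\<^esub>}" by (auto simp: Ann_def)
  have 0: "\<zero>\<^bsub>M\<^esub> \<in> N" "\<zero>\<^bsub>M\<^esub> \<in> L" using NL by auto
  have "N = {\<zero>\<^bsub>M\<^esub>} \<or> L = {\<zero>\<^bsub>M\<^esub>}"
  proof (rule ccontr)
    assume "\<not> (N = {\<zero>\<^bsub>M\<^esub>} \<or> L = {\<zero>\<^bsub>M\<^esub>})"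
    then obtain x y where xy: "x \<in> N" "x \<noteq> \<zero>\<^bsub>M\<^esub>" "y \<in> L" "y \<noteq> \<zero>\<^bsub>M\<^esub>" using 0 by auto
    then obtain a b where ab: "a \<in> carrier R" "b \<in> carrier R" "a \<odot>\<^bsub>M\<^esub> x = b \<odot>\<^bsub>M\<^esub> y" "a \<odot>\<^bsub>M\<^esub> x \<noteq> \<zero>\<^bsub>M\<^esub>"
      using uniform[of x y] submoduleE(1)[OF N] submoduleE(1)[OF L] by blast
    have "a \<odot>\<^bsub>M\<^esub> x \<in> N" using submoduleE(4)[OF N ab(1) xy(1)] .
    moreover have "a \<odot>\<^bsub>M\<^esub> x \<in> L" unfolding ab(3) using submoduleE(4)[OF L ab(2) xy(3)] .
    ultimately show False using NL ab(4) by blast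
  qed
  then show "Ann R M N <+>\<^bsub>R\<^esub> Ann R M L = carrier R"
  proof
    assume "N = {\<zero>\<^bsub>M\<^esub>}"
    then show ?thesis using comaximal_imp_Ann_sum[OF N L _ z[OF L], of \<one>] o by simp
  next
    assume "L = {\<zero>\<^bsub>M\<^esub>}"
    then show ?thesis using comaximal_imp_Ann_sum[OF N L z[OF N], of \<one>] o by simp
  qed
qed

end

definition ideal_torsion :: "('a, 'r) ring_scheme \<Rightarrow> ('a, 'b, 'm) module_scheme \<Rightarrow> 'a set \<Rightarrow> 'b set"
  where "ideal_torsion R M I = {x \<in> carrier M. \<forall>r\<in>I. r \<odot>\<^bsub>M\<^esub> x = \<zero>\<^bsub>M\<^esub>}"

locale uniformizer_module = module R M + uniformizer R p v s
  for R (structure) and M (structure) and p v s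
begin

text \<open>Being killed by a power of \<open>v\<close> would be too weak, since \<open>v\<close> may lie in other maximal ideals as well.\<close>
definition primary :: "'c \<Rightarrow> bool" where
  "primary x \<longleftrightarrow> (\<exists>n. x \<in> ideal_torsion R M (symbolic_power n))"

lemma primaryI: "x \<in> carrier M \<Longrightarrow> (\<And>r. r \<in> symbolic_power n \<Longrightarrow> r \<odot>\<^bsub>M\<^esub> x = \<zero>\<^bsub>M\<^esub>) \<Longrightarrow> primary x"
  unfolding primary_def ideal_torsion_def by blast

lemma primaryE:
  assumes "primary x"
  obtains n where "x \<in> carrier M" "\<forall>r\<in>symbolic_power n. r \<odot>\<^bsub>M\<^esub> x = \<zero>\<^bsub>M\<^esub>"
  using assms unfolding primary_def ideal_torsion_def by auto

lemma primary_closed: "primary x \<Longrightarrow> x \<in> carrier M"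
  by (auto simp: primary_def ideal_torsion_def)

lemma primary_smult: "primary x \<Longrightarrow> a \<in> carrier R \<Longrightarrow> primary (a \<odot>\<^bsub>M\<^esub> x)"
proof -
  assume x: "primary x" and a: "a \<in> carrier R"
  obtain n where n: "x \<in> carrier M" "\<forall>r\<in>symbolic_power n. r \<odot>\<^bsub>M\<^esub> x = \<zero>\<^bsub>M\<^esub>"
    using primaryE[OF x] .
  have "r \<odot>\<^bsub>M\<^esub> (a \<odot>\<^bsub>M\<^esub> x) = \<zero>\<^bsub>M\<^esub>" if r: "r \<in> symbolic_power n" for r
  proof -
    have rR: "r \<in> carrier R" using r by (rule symbolic_power_closed)
    have "r \<odot>\<^bsub>M\<^esub> (a \<odot>\<^bsub>M\<^esub> x) = a \<odot>\<^bsub>M\<^esub> (r \<odot>\<^bsub>M\<^esub> x)"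
      using rR a n(1) by (simp add: smult_assoc1[symmetric] R.m_comm)
    then show ?thesis using n(2) r a by simp
  qed
  then show ?thesis using n(1) a by (intro primaryI) auto
qed

lemma primary_add:
  assumes "primary x" "primary y"
  shows "primary (x \<oplus>\<^bsub>M\<^esub> y)"
proof -
  obtain n where n: "x \<in> carrier M" "\<forall>r\<in>symbolic_power n. r \<odot>\<^bsub>M\<^esub> x = \<zero>\<^bsub>M\<^esub>"
    using primaryE[OF assms(1)] .
  obtain m where m: "y \<in> carrier M" "\<forall>r\<in>symbolic_power m. r \<odot>\<^bsub>M\<^esub> y = \<zero>\<^bsub>M\<^esub>"
    using primaryE[OF assms(2)] .
  have "r \<odot>\<^bsub>M\<^esub> (x \<oplus>\<^bsub>M\<^esub> y) = \<zero>\<^bsub>M\<^esub>" if r: "r \<in> symbolic_power (max n m)" for r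
  proof -
    have "r \<in> symbolic_power n" "r \<in> symbolic_power m"
      using r symbolic_power_antimono[of n "max n m"] symbolic_power_antimono[of m "max n m"] by auto
    then show ?thesis using n m symbolic_power_closed[OF r] by (simp add: smult_r_distr)
  qed
  then show ?thesis using n(1) m(1) by (intro primaryI) auto
qed

text \<open>An element outside \<open>p\<close> is invertible modulo \<open>p^n\<close>.\<close>
lemma primary_unit_cancel:
  assumes x: "primary x" and t: "t \<in> carrier R" "t \<notin> p" and tx: "t \<odot>\<^bsub>M\<^esub> x = \<zero>\<^bsub>M\<^esub>"
  shows "x = \<zero>\<^bsub>M\<^esub>"
proof -
  obtain n where n: "x \<in> carrier M" "\<forall>r\<in>symbolic_power n. r \<odot>\<^bsub>M\<^esub> x = \<zero>\<^bsub>M\<^esub>"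
    using primaryE[OF x] .
  obtain a b where a: "a \<in> carrier R" and b: "b \<in> symbolic_power n" and ab: "a \<otimes> t \<oplus> b = \<one>"
    using symbolic_power_comaximal[OF t, of n] by blast
  have "x = (a \<otimes> t \<oplus> b) \<odot>\<^bsub>M\<^esub> x" unfolding ab using n(1) by simp
  also have "\<dots> = a \<odot>\<^bsub>M\<^esub> (t \<odot>\<^bsub>M\<^esub> x) \<oplus>\<^bsub>M\<^esub> b \<odot>\<^bsub>M\<^esub> x"
    using a t(1) symbolic_power_closed[OF b] n(1) by (simp add: smult_l_distr smult_assoc1)
  also have "\<dots> = \<zero>\<^bsub>M\<^esub>" unfolding tx n(2)[rule_format, OF b] using a by simp
  finally show ?thesis .
qed

lemma primary_unit_surj:
  assumes x: "primary x" and t: "t \<in> carrier R" "t \<notin> p"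
  shows "\<exists>a\<in>carrier R. t \<odot>\<^bsub>M\<^esub> (a \<odot>\<^bsub>M\<^esub> x) = x"
proof -
  obtain n where n: "x \<in> carrier M" "\<forall>r\<in>symbolic_power n. r \<odot>\<^bsub>M\<^esub> x = \<zero>\<^bsub>M\<^esub>"
    using primaryE[OF x] .
  obtain a b where a: "a \<in> carrier R" and b: "b \<in> symbolic_power n" and ab: "a \<otimes> t \<oplus> b = \<one>"
    using symbolic_power_comaximal[OF t, of n] by blast
  have "x = (a \<otimes> t \<oplus> b) \<odot>\<^bsub>M\<^esub> x" unfolding ab using n(1) by simp
  also have "\<dots> = t \<odot>\<^bsub>M\<^esub> (a \<odot>\<^bsub>M\<^esub> x) \<oplus>\<^bsub>M\<^esub> b \<odot>\<^bsub>M\<^esub> x"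
    using a t(1) symbolic_power_closed[OF b] n(1) by (simp add: smult_l_distr smult_assoc1[symmetric] R.m_comm)
  also have "\<dots> = t \<odot>\<^bsub>M\<^esub> (a \<odot>\<^bsub>M\<^esub> x)" unfolding n(2)[rule_format, OF b] using a t(1) n(1) by simp
  finally show ?thesis using a by metis
qed

lemma primary_v_pow:
  assumes "primary x"
  shows "\<exists>n::nat. v [^] n \<odot>\<^bsub>M\<^esub> x = \<zero>\<^bsub>M\<^esub>"
  using primaryE[OF assms] v_pow_mem by metis

lemma primary_p_kills:
  assumes x: "primary x" and vx: "v \<odot>\<^bsub>M\<^esub> x = \<zero>\<^bsub>M\<^esub>" and a: "a \<in> p"
  shows "a \<odot>\<^bsub>M\<^esub> x = \<zero>\<^bsub>M\<^esub>"
proof -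
  obtain r where r: "r \<in> carrier R" "s \<otimes> a = r \<otimes> v" using principal[OF a] by blast
  have aR: "a \<in> carrier R" using a by (rule p_closed)
  have xM: "x \<in> carrier M" using x by (rule primary_closed)
  have "s \<odot>\<^bsub>M\<^esub> (a \<odot>\<^bsub>M\<^esub> x) = (r \<otimes> v) \<odot>\<^bsub>M\<^esub> x" using r(2) aR xM by (metis smult_assoc1 s_closed)
  also have "\<dots> = \<zero>\<^bsub>M\<^esub>" using r(1) vx xM by (simp add: smult_assoc1)
  finally show ?thesis using primary_unit_cancel[OF primary_smult[OF x aR] s] by blast
qed

lemma primary_last_multiple:
  assumes y: "primary y" "y \<noteq> \<zero>\<^bsub>M\<^esub>"
  shows "\<exists>m::nat. v [^] m \<odot>\<^bsub>M\<^esub> y \<noteq> \<zero>\<^bsub>M\<^esub> \<and> v \<odot>\<^bsub>M\<^esub> (v [^] m \<odot>\<^bsub>M\<^esub> y) = \<zero>\<^bsub>M\<^esub>"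
proof -
  let ?P = "\<lambda>n::nat. v [^] n \<odot>\<^bsub>M\<^esub> y = \<zero>\<^bsub>M\<^esub>"
  have yM: "y \<in> carrier M" using y(1) by (rule primary_closed)
  have L: "?P (LEAST n. ?P n)" using primary_v_pow[OF y(1)] by (rule LeastI_ex)
  moreover have "\<not> ?P 0" using y yM by simp
  ultimately obtain m where m: "(LEAST n. ?P n) = Suc m" by (metis not0_implies_Suc)
  have "\<not> ?P m" using not_less_Least[of m ?P] m by simp
  moreover have "v \<odot>\<^bsub>M\<^esub> (v [^] m \<odot>\<^bsub>M\<^esub> y) = \<zero>\<^bsub>M\<^esub>"
    using L yM unfolding m by (simp add: smult_assoc1[symmetric] R.m_comm)
  ultimately show ?thesis by blast
qed

text \<open>Let \<open>z\<close> be the last nonzero element among the \<open>v^m y\<close>. As \<open>p\<close> kills \<open>x\<close>, each nonzero multiple of \<open>x\<close> generates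
  \<open>R x\<close>. So if \<open>x\<close> were not a multiple of \<open>y\<close>, then \<open>R x\<close> and \<open>R z\<close> would meet in \<open>0\<close>. But the annihilators
  of the primary elements \<open>x\<close> and \<open>z\<close> both lie in \<open>p\<close> and are not comaximal.\<close>
lemma weakly_IN_socle:
  assumes W: "weakly_IN R M" and x: "primary x" "v \<odot>\<^bsub>M\<^esub> x = \<zero>\<^bsub>M\<^esub>"
    and y: "primary y" "y \<noteq> \<zero>\<^bsub>M\<^esub>"
  shows "\<exists>r\<in>carrier R. x = r \<odot>\<^bsub>M\<^esub> y"
proof (rule ccontr)
  assume no: "\<not> (\<exists>r\<in>carrier R. x = r \<odot>\<^bsub>M\<^esub> y)"
  have xM: "x \<in> carrier M" and yM: "y \<in> carrier M" using x y by (auto dest: primary_closed)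
  have x0: "x \<noteq> \<zero>\<^bsub>M\<^esub>" using no yM by (metis smult_l_null R.zero_closed)
  obtain m :: nat where m: "v [^] m \<odot>\<^bsub>M\<^esub> y \<noteq> \<zero>\<^bsub>M\<^esub>" "v \<odot>\<^bsub>M\<^esub> (v [^] m \<odot>\<^bsub>M\<^esub> y) = \<zero>\<^bsub>M\<^esub>"
    using primary_last_multiple[OF y] by blast
  let ?z = "v [^] m \<odot>\<^bsub>M\<^esub> y"
  have z: "primary ?z" using primary_smult[OF y(1)] by simp
  have zM: "?z \<in> carrier M" using z by (rule primary_closed)
  have "a \<odot>\<^bsub>M\<^esub> x = \<zero>\<^bsub>M\<^esub>" if ab: "a \<in> carrier R" "b \<in> carrier R" "a \<odot>\<^bsub>M\<^esub> x = b \<odot>\<^bsub>M\<^esub> ?z" for a b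
  proof (cases "a \<in> p")
    case True
    then show ?thesis by (rule primary_p_kills[OF x])
  next
    case False
    obtain c where c: "c \<in> carrier R" "a \<odot>\<^bsub>M\<^esub> (c \<odot>\<^bsub>M\<^esub> x) = x"
      using primary_unit_surj[OF x(1) ab(1) False] by blast
    have "x = c \<odot>\<^bsub>M\<^esub> (a \<odot>\<^bsub>M\<^esub> x)" using c ab(1) xM by (simp add: smult_assoc1[symmetric] R.m_comm)
    also have "\<dots> = (c \<otimes> (b \<otimes> v [^] m)) \<odot>\<^bsub>M\<^esub> y"
      unfolding ab(3) using c(1) ab(2) yM by (simp add: smult_assoc1)
    finally have "x = (c \<otimes> (b \<otimes> v [^] m)) \<odot>\<^bsub>M\<^esub> y" .
    moreover have "c \<otimes> (b \<otimes> v [^] m) \<in> carrier R" using c(1) ab(2) by simp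
    ultimately show ?thesis using no by blast
  qed
  then obtain a b where ab: "a \<in> carrier R" "b \<in> carrier R" "a \<odot>\<^bsub>M\<^esub> x = \<zero>\<^bsub>M\<^esub>" "b \<odot>\<^bsub>M\<^esub> ?z = \<zero>\<^bsub>M\<^esub>" "a \<oplus> b = \<one>"
    using weakly_IN_independent[OF W xM zM] by blast
  have "a \<in> p" using primary_unit_cancel[OF x(1) ab(1) _ ab(3)] x0 by blast
  moreover have "b \<in> p" using primary_unit_cancel[OF z ab(2) _ ab(4)] m(1) by blast
  ultimately have "\<one> \<in> p"
    using additive_subgroup.a_closed[OF ideal.axioms(1)[OF p_ideal], of a b] ab(5) by simp
  then show False using one_notin_p by blast
qed

text \<open>Induction on \<open>n\<close>, applied to \<open>v x\<close> and \<open>v y\<close>: if \<open>v x = r v y\<close>, then \<open>x - r y\<close> is killed by \<open>v\<close> and the previous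
  lemma puts it into \<open>R y\<close>.\<close>
lemma weakly_IN_uniserial:
  assumes W: "weakly_IN R M"
  shows "primary x \<Longrightarrow> primary y \<Longrightarrow> v [^] Suc n \<odot>\<^bsub>M\<^esub> x = \<zero>\<^bsub>M\<^esub> \<Longrightarrow> v [^] n \<odot>\<^bsub>M\<^esub> y \<noteq> \<zero>\<^bsub>M\<^esub> \<Longrightarrow>
    \<exists>r\<in>carrier R. x = r \<odot>\<^bsub>M\<^esub> y"
proof (induction n arbitrary: x y)
  case 0
  have "v \<odot>\<^bsub>M\<^esub> x = \<zero>\<^bsub>M\<^esub>" "y \<noteq> \<zero>\<^bsub>M\<^esub>" using 0 by (auto dest: primary_closed)
  then show ?case using weakly_IN_socle[OF W 0(1) _ 0(2)] by blast
next
  case (Suc n)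
  have xM: "x \<in> carrier M" and yM: "y \<in> carrier M" using Suc.prems by (auto dest: primary_closed)
  have shift: "v [^] k \<odot>\<^bsub>M\<^esub> (v \<odot>\<^bsub>M\<^esub> w) = v [^] Suc k \<odot>\<^bsub>M\<^esub> w" if "w \<in> carrier M" for w and k :: nat
    using that by (simp add: smult_assoc1)
  have "\<exists>r\<in>carrier R. v \<odot>\<^bsub>M\<^esub> x = r \<odot>\<^bsub>M\<^esub> (v \<odot>\<^bsub>M\<^esub> y)"
  proof (rule Suc.IH)
    show "primary (v \<odot>\<^bsub>M\<^esub> x)" "primary (v \<odot>\<^bsub>M\<^esub> y)" using Suc.prems primary_smult by auto
    show "v [^] Suc n \<odot>\<^bsub>M\<^esub> (v \<odot>\<^bsub>M\<^esub> x) = \<zero>\<^bsub>M\<^esub>" unfolding shift[OF xM] by (rule Suc.prems(3))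
    show "v [^] n \<odot>\<^bsub>M\<^esub> (v \<odot>\<^bsub>M\<^esub> y) \<noteq> \<zero>\<^bsub>M\<^esub>" unfolding shift[OF yM] by (rule Suc.prems(4))
  qed
  then obtain r where r: "r \<in> carrier R" "v \<odot>\<^bsub>M\<^esub> x = r \<odot>\<^bsub>M\<^esub> (v \<odot>\<^bsub>M\<^esub> y)" by blast
  let ?d = "x \<oplus>\<^bsub>M\<^esub> (\<ominus> r) \<odot>\<^bsub>M\<^esub> y"
  have d: "primary ?d" using primary_add[OF Suc.prems(1) primary_smult[OF Suc.prems(2)]] r(1) by simp
  have "v \<odot>\<^bsub>M\<^esub> ?d = v \<odot>\<^bsub>M\<^esub> x \<oplus>\<^bsub>M\<^esub> (\<ominus> r) \<odot>\<^bsub>M\<^esub> (v \<odot>\<^bsub>M\<^esub> y)"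
    using xM yM r(1) by (simp add: smult_r_distr smult_assoc1[symmetric] R.m_comm)
  also have "\<dots> = \<zero>\<^bsub>M\<^esub>" unfolding r(2) using yM r(1) by (simp add: smult_l_minus M.r_neg)
  finally have "v \<odot>\<^bsub>M\<^esub> ?d = \<zero>\<^bsub>M\<^esub>" .
  moreover have "y \<noteq> \<zero>\<^bsub>M\<^esub>"
  proof
    assume "y = \<zero>\<^bsub>M\<^esub>"
    then have "v [^] Suc n \<odot>\<^bsub>M\<^esub> y = \<zero>\<^bsub>M\<^esub>" by simp
    then show False using Suc.prems(4) by blast
  qed
  ultimately obtain q where q: "q \<in> carrier R" "?d = q \<odot>\<^bsub>M\<^esub> y"
    using weakly_IN_socle[OF W d _ Suc.prems(2)] by blast
  have "x = ?d \<oplus>\<^bsub>M\<^esub> r \<odot>\<^bsub>M\<^esub> y"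
    using xM yM r(1) by (simp add: smult_l_minus M.a_assoc M.l_neg)
  also have "\<dots> = (q \<oplus> r) \<odot>\<^bsub>M\<^esub> y" unfolding q(2) using q(1) r(1) yM by (simp add: smult_l_distr)
  finally show ?case using q(1) r(1) by blast
qed

text \<open>By uniseriality an element that survives the highest possible power of \<open>v\<close> is a generator.\<close>
lemma weakly_IN_power_torsion_cyclic:
  assumes W: "weakly_IN R M"
  shows "\<exists>g\<in>ideal_torsion R M (symbolic_power n). \<forall>x\<in>ideal_torsion R M (symbolic_power n).
    \<exists>r\<in>carrier R. x = r \<odot>\<^bsub>M\<^esub> g"
proof -
  let ?T = "ideal_torsion R M (symbolic_power n)"
  have prim: "primary x" if "x \<in> ?T" for x using that unfolding primary_def by blast
  have z: "\<zero>\<^bsub>M\<^esub> \<in> ?T" by (auto simp: ideal_torsion_def dest: symbolic_power_closed)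
  define P where "P m \<longleftrightarrow> (\<exists>g\<in>?T. v [^] m \<odot>\<^bsub>M\<^esub> g \<noteq> \<zero>\<^bsub>M\<^esub>)" for m :: nat
  have bound: "m < n" if "P m" for m
  proof (rule ccontr)
    assume "\<not> m < n"
    then have "v [^] m \<in> symbolic_power n" using multiple_v_pow_mem[of n m \<one>] by simp
    then show False using that by (auto simp: P_def ideal_torsion_def)
  qed
  show ?thesis
  proof (cases "\<exists>m. P m")
    case False
    then have "\<not> P 0" by blast
    then have "\<forall>x\<in>?T. x = \<zero>\<^bsub>M\<^esub>" by (auto simp: P_def ideal_torsion_def)
    then have "\<forall>x\<in>?T. \<exists>r\<in>carrier R. x = r \<odot>\<^bsub>M\<^esub> \<zero>\<^bsub>M\<^esub>" by (metis smult_r_null R.zero_closed)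
    then show ?thesis using z by blast
  next
    case True
    define m where "m = (GREATEST m. P m)"
    have Pm: "P m" unfolding m_def using True bound by (metis GreatestI_ex_nat less_imp_le)
    have "\<not> P (Suc m)"
      unfolding m_def using Greatest_le_nat[of P _ n] bound by (metis less_imp_le not_less_eq_eq order_refl)
    then have kill: "v [^] Suc m \<odot>\<^bsub>M\<^esub> x = \<zero>\<^bsub>M\<^esub>" if "x \<in> ?T" for x
      using that unfolding P_def by blast
    obtain g where g: "g \<in> ?T" "v [^] m \<odot>\<^bsub>M\<^esub> g \<noteq> \<zero>\<^bsub>M\<^esub>" using Pm unfolding P_def by blast
    have "\<exists>r\<in>carrier R. x = r \<odot>\<^bsub>M\<^esub> g" if x: "x \<in> ?T" for x
      using weakly_IN_uniserial[OF W prim[OF x] prim[OF g(1)] kill[OF x] g(2)] .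
    then show ?thesis using g(1) by blast
  qed
qed

text \<open>Let \<open>N\<close> be the set of primary elements and \<open>L\<close> the set of elements killed by something outside \<open>p\<close>. They meet in \<open>0\<close>
  and span \<open>M\<close>, so the comaximal ideals \<open>Ann N\<close> and \<open>Ann L\<close> have product \<open>0\<close> by faithfulness. In a domain
  one of them is \<open>0\<close> and the other one is \<open>R\<close>, that is, \<open>L = 0\<close> or \<open>N = 0\<close>. The latter would give \<open>m \<in> L\<close>.\<close>
lemma weakly_IN_faithful_torsion_primary:
  assumes W: "weakly_IN R M"
    and tors: "\<And>x. x \<in> carrier M \<Longrightarrow> \<exists>r\<in>carrier R. r \<noteq> \<zero> \<and> r \<odot>\<^bsub>M\<^esub> x = \<zero>\<^bsub>M\<^esub>"
    and faithful: "\<And>r. r \<in> carrier R \<Longrightarrow> (\<And>x. x \<in> carrier M \<Longrightarrow> r \<odot>\<^bsub>M\<^esub> x = \<zero>\<^bsub>M\<^esub>) \<Longrightarrow> r = \<zero>"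
    and m: "m \<in> carrier M" "\<And>r. r \<in> carrier R \<Longrightarrow> r \<odot>\<^bsub>M\<^esub> m = \<zero>\<^bsub>M\<^esub> \<Longrightarrow> r \<in> p"
    and x: "x \<in> carrier M"
  shows "primary x"
proof -
  let ?N = "{x. primary x}" and ?L = "{x \<in> carrier M. \<exists>t\<in>carrier R. t \<notin> p \<and> t \<odot>\<^bsub>M\<^esub> x = \<zero>\<^bsub>M\<^esub>}"
  have z: "primary \<zero>\<^bsub>M\<^esub>" by (rule primaryI[of _ 0]) (auto dest: symbolic_power_closed)
  have neg: "\<ominus>\<^bsub>M\<^esub> y = (\<ominus> \<one>) \<odot>\<^bsub>M\<^esub> y" if "y \<in> carrier M" for y
    using that by (simp add: smult_l_minus)
  have N: "submodule ?N R M"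
  proof (rule submoduleI)
    show "?N \<subseteq> carrier M" by (auto dest: primary_closed)
    show "\<ominus>\<^bsub>M\<^esub> y \<in> ?N" if "y \<in> ?N" for y
      using that neg primary_closed primary_smult by simp
  qed (use z primary_add primary_smult in auto)
  have Lsm: "a \<odot>\<^bsub>M\<^esub> y \<in> ?L" if a: "a \<in> carrier R" and "y \<in> ?L" for a y
  proof -
    from \<open>y \<in> ?L\<close> obtain t where t: "y \<in> carrier M" "t \<in> carrier R" "t \<notin> p" "t \<odot>\<^bsub>M\<^esub> y = \<zero>\<^bsub>M\<^esub>" by blast
    have "t \<odot>\<^bsub>M\<^esub> (a \<odot>\<^bsub>M\<^esub> y) = a \<odot>\<^bsub>M\<^esub> (t \<odot>\<^bsub>M\<^esub> y)"
      using t(1,2) a by (simp add: smult_assoc1[symmetric] R.m_comm)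
    then show ?thesis using t a by auto
  qed
  have L: "submodule ?L R M"
  proof (rule submoduleI)
    show "?L \<subseteq> carrier M" by blast
    show "\<zero>\<^bsub>M\<^esub> \<in> ?L" using one_notin_p by (auto intro!: bexI[of _ \<one>])
    show "\<ominus>\<^bsub>M\<^esub> y \<in> ?L" if "y \<in> ?L" for y
    proof -
      have "y \<in> carrier M" using that by blast
      then show ?thesis using Lsm[OF _ that, of "\<ominus> \<one>"] neg by simp
    qed
    show "a \<odot>\<^bsub>M\<^esub> y \<in> ?L" if "a \<in> carrier R" "y \<in> ?L" for a y by (rule Lsm[OF that])
    fix y w assume "y \<in> ?L" "w \<in> ?L"
    then obtain t u where t: "y \<in> carrier M" "t \<in> carrier R" "t \<notin> p" "t \<odot>\<^bsub>M\<^esub> y = \<zero>\<^bsub>M\<^esub>"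
      and u: "w \<in> carrier M" "u \<in> carrier R" "u \<notin> p" "u \<odot>\<^bsub>M\<^esub> w = \<zero>\<^bsub>M\<^esub>" by blast
    have "(t \<otimes> u) \<odot>\<^bsub>M\<^esub> (y \<oplus>\<^bsub>M\<^esub> w) = (u \<otimes> t) \<odot>\<^bsub>M\<^esub> y \<oplus>\<^bsub>M\<^esub> (t \<otimes> u) \<odot>\<^bsub>M\<^esub> w"
      using t(1,2) u(1,2) by (simp add: smult_r_distr R.m_comm)
    also have "\<dots> = \<zero>\<^bsub>M\<^esub>" using t u by (simp add: smult_assoc1)
    finally show "y \<oplus>\<^bsub>M\<^esub> w \<in> ?L"
      using t u notin_p_mult[OF t(2) u(2) t(3) u(3)] by auto
  qed
  have "?N \<inter> ?L = {\<zero>\<^bsub>M\<^esub>}"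
    using primary_unit_cancel z submoduleE(2)[OF L] one_notin_p by (auto intro!: bexI[of _ \<one>])
  then obtain a b where a: "a \<in> Ann R M ?N" and b: "b \<in> Ann R M ?L" and ab: "a \<oplus> b = \<one>"
    using weakly_IN_comaximal[OF W N L] by blast
  have aR: "a \<in> carrier R" and bR: "b \<in> carrier R" using a b by (auto simp: Ann_def)
  have split: "\<exists>y w. y \<in> ?N \<and> w \<in> ?L \<and> x = y \<oplus>\<^bsub>M\<^esub> w" if x: "x \<in> carrier M" for x
  proof -
    obtain r where r: "r \<in> carrier R" "r \<noteq> \<zero>" "r \<odot>\<^bsub>M\<^esub> x = \<zero>\<^bsub>M\<^esub>" using tors[OF x] by blast
    obtain j t u where t: "t \<in> carrier R" "t \<notin> p" and u: "u \<in> carrier R" "u \<notin> p" and tr: "t \<otimes> r = u \<otimes> v [^] (j::nat)"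
      using normal_form[OF r(1,2)] by blast
    \<comment> \<open>The multiplier \<open>?w\<close> is outside \<open>p\<close> and makes \<open>x\<close> primary, as \<open>p^j ?w \<subseteq> R r\<close>; its comaximality with \<open>p^j\<close> splits \<open>x\<close>.\<close>
    let ?w = "u \<otimes> s [^] j"
    have wR: "?w \<in> carrier R" using u by simp
    have wp: "?w \<notin> p" using notin_p_mult[of u "s [^] j"] u s_pow_notin_p by simp
    have wx: "y \<odot>\<^bsub>M\<^esub> (?w \<odot>\<^bsub>M\<^esub> x) = \<zero>\<^bsub>M\<^esub>" if y: "y \<in> symbolic_power j" for y
    proof -
      obtain q where q: "y \<in> carrier R" "q \<in> carrier R" "s [^] j \<otimes> y = q \<otimes> v [^] j"
        using y by (rule symbolic_powerE)
      have "y \<otimes> ?w = u \<otimes> (s [^] j \<otimes> y)" using q(1) u by (simp add: R.m_ac)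
      also have "\<dots> = q \<otimes> (t \<otimes> r)" unfolding q(3) tr using q(2) u by (simp add: R.m_lcomm)
      finally have "y \<odot>\<^bsub>M\<^esub> (?w \<odot>\<^bsub>M\<^esub> x) = (q \<otimes> t \<otimes> r) \<odot>\<^bsub>M\<^esub> x"
        using q(1,2) wR x t(1) r(1) by (simp add: smult_assoc1[symmetric] R.m_assoc)
      also have "\<dots> = \<zero>\<^bsub>M\<^esub>" using q(2) t(1) r x by (simp add: smult_assoc1)
      finally show ?thesis .
    qed
    obtain c d where c: "c \<in> carrier R" and d: "d \<in> symbolic_power j" and cd: "c \<otimes> ?w \<oplus> d = \<one>"
      using symbolic_power_comaximal[OF wR wp, of j] by blast
    have dR: "d \<in> carrier R" using d by (rule symbolic_power_closed)
    have "primary (?w \<odot>\<^bsub>M\<^esub> x)" by (rule primaryI[of _ j]) (use wx wR x in auto)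
    then have "c \<odot>\<^bsub>M\<^esub> (?w \<odot>\<^bsub>M\<^esub> x) \<in> ?N" using primary_smult c by blast
    moreover have "d \<odot>\<^bsub>M\<^esub> x \<in> ?L"
    proof -
      have "?w \<odot>\<^bsub>M\<^esub> (d \<odot>\<^bsub>M\<^esub> x) = d \<odot>\<^bsub>M\<^esub> (?w \<odot>\<^bsub>M\<^esub> x)"
        using wR dR x by (simp add: smult_assoc1[symmetric] R.m_comm)
      then show ?thesis using wx[OF d] wR wp dR x by auto
    qed
    moreover have "x = c \<odot>\<^bsub>M\<^esub> (?w \<odot>\<^bsub>M\<^esub> x) \<oplus>\<^bsub>M\<^esub> d \<odot>\<^bsub>M\<^esub> x"
    proof -
      have "x = (c \<otimes> ?w \<oplus> d) \<odot>\<^bsub>M\<^esub> x" unfolding cd using x by simp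
      then show ?thesis using c wR dR x by (simp add: smult_l_distr smult_assoc1)
    qed
    ultimately show ?thesis by blast
  qed
  have "a \<otimes> b = \<zero>"
  proof (rule faithful)
    fix x assume "x \<in> carrier M"
    then obtain y w where yw: "y \<in> ?N" "w \<in> ?L" "x = y \<oplus>\<^bsub>M\<^esub> w" using split by blast
    have yM: "y \<in> carrier M" and wM: "w \<in> carrier M" using yw primary_closed by auto
    have "a \<odot>\<^bsub>M\<^esub> y = \<zero>\<^bsub>M\<^esub>" using a yw(1) unfolding Ann_def by blast
    moreover have "b \<odot>\<^bsub>M\<^esub> w = \<zero>\<^bsub>M\<^esub>" using b yw(2) unfolding Ann_def by blast
    moreover have "(a \<otimes> b) \<odot>\<^bsub>M\<^esub> x = b \<odot>\<^bsub>M\<^esub> (a \<odot>\<^bsub>M\<^esub> y) \<oplus>\<^bsub>M\<^esub> a \<odot>\<^bsub>M\<^esub> (b \<odot>\<^bsub>M\<^esub> w)"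
      unfolding yw(3) using yM wM aR bR by (simp add: smult_r_distr smult_assoc1[symmetric] R.m_comm)
    ultimately show "(a \<otimes> b) \<odot>\<^bsub>M\<^esub> x = \<zero>\<^bsub>M\<^esub>" using aR bR by simp
  qed (use aR bR in simp)
  then consider "a = \<zero>" | "b = \<zero>" using integral[of a b] aR bR by blast
  then show ?thesis
  proof cases
    case 1
    then have b1: "b = \<one>" using ab bR by simp
    obtain y w where yw: "y \<in> ?N" "w \<in> ?L" "x = y \<oplus>\<^bsub>M\<^esub> w" using split[OF x] by blast
    have "b \<odot>\<^bsub>M\<^esub> w = \<zero>\<^bsub>M\<^esub>" using b yw(2) unfolding Ann_def by blast
    then have "w = \<zero>\<^bsub>M\<^esub>" using yw(2) b1 by simp
    then show ?thesis using yw primary_closed by simp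
  next
    case 2
    then have a1: "a = \<one>" using ab aR by simp
    obtain y w where yw: "y \<in> ?N" "w \<in> ?L" "m = y \<oplus>\<^bsub>M\<^esub> w" using split[OF m(1)] by blast
    have "a \<odot>\<^bsub>M\<^esub> y = \<zero>\<^bsub>M\<^esub>" using a yw(1) unfolding Ann_def by blast
    then have "y = \<zero>\<^bsub>M\<^esub>" using yw(1) a1 primary_closed by simp
    then have "m \<in> ?L" using yw(2,3) by simp
    then show ?thesis using m(2) by blast
  qed
qed

end

section \<open>Modules over uniformized domains\<close>

locale uniformized_domain_module = module R M + uniformized_domain R
  for R (structure) and M (structure)
begin

lemma uniformizer_moduleI: "uniformizer R p v s \<Longrightarrow> uniformizer_module R M p v s"
  by (intro uniformizer_module.intro module_axioms)

text \<open>For \<open>I = p^n \<inter> J\<close> write \<open>1 = a + b\<close> with \<open>a \<in> J\<close> and \<open>b \<in> p^n\<close>. Then \<open>a\<close> and \<open>b\<close> act as the projections of the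
  part killed by \<open>I\<close> onto the parts killed by \<open>p^n\<close> and by \<open>J\<close>, and the sum \<open>g + h\<close> of generators of these
  two parts is a generator.\<close>
lemma weakly_IN_ideal_torsion_cyclic:
  assumes W: "weakly_IN R M" and I: "ideal I R" "I \<noteq> {\<zero>}"
  shows "\<exists>g\<in>ideal_torsion R M I. \<forall>x\<in>ideal_torsion R M I. \<exists>r\<in>carrier R. x = r \<odot>\<^bsub>M\<^esub> g"
  using I
proof (induction rule: nonzero_ideal_induct)
  case carrier
  have "x = \<zero>\<^bsub>M\<^esub>" if "x \<in> ideal_torsion R M (carrier R)" for x
    using that smult_one unfolding ideal_torsion_def by fastforce
  moreover have "\<zero>\<^bsub>M\<^esub> \<in> ideal_torsion R M (carrier R)" by (simp add: ideal_torsion_def)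
  moreover have "\<zero>\<^bsub>M\<^esub> = \<zero> \<odot>\<^bsub>M\<^esub> \<zero>\<^bsub>M\<^esub>" by simp
  ultimately show ?case using R.zero_closed by metis
next
  case (step p n J)
  obtain v s where "uniformizer R p v s" using exists_uniformizer step.hyps(1,2) by metis
  then interpret U: uniformizer_module R M p v s by (rule uniformizer_moduleI)
  let ?Q = "U.symbolic_power n"
  obtain t where t: "t \<in> J" "t \<notin> p" using step.hyps(6) by blast
  have Jc: "j \<in> carrier R" if "j \<in> J" for j using ideal.Icarr[OF step.hyps(4) that] .
  have tR: "t \<in> carrier R" using Jc[OF t(1)] .
  obtain a0 b where a0: "a0 \<in> carrier R" and b: "b \<in> ?Q" and ab0: "a0 \<otimes> t \<oplus> b = \<one>"
    using U.symbolic_power_comaximal[OF tR t(2), of n] by blast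
  define a where "a = a0 \<otimes> t"
  have aJ: "a \<in> J" unfolding a_def using ideal.I_l_closed[OF step.hyps(4) t(1) a0] .
  have aR: "a \<in> carrier R" and bR: "b \<in> carrier R" using Jc[OF aJ] U.symbolic_power_closed[OF b] by auto
  have ab: "a \<oplus> b = \<one>" using ab0 a_def by simp
  obtain g where g: "g \<in> ideal_torsion R M ?Q" "\<forall>x\<in>ideal_torsion R M ?Q. \<exists>r\<in>carrier R. x = r \<odot>\<^bsub>M\<^esub> g"
    using U.weakly_IN_power_torsion_cyclic[OF W, of n] by blast
  obtain h where h: "h \<in> ideal_torsion R M J" "\<forall>x\<in>ideal_torsion R M J. \<exists>r\<in>carrier R. x = r \<odot>\<^bsub>M\<^esub> h"
    using step.IH by blast
  have gM: "g \<in> carrier M" "\<And>r. r \<in> ?Q \<Longrightarrow> r \<odot>\<^bsub>M\<^esub> g = \<zero>\<^bsub>M\<^esub>"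
    and hM: "h \<in> carrier M" "\<And>r. r \<in> J \<Longrightarrow> r \<odot>\<^bsub>M\<^esub> h = \<zero>\<^bsub>M\<^esub>"
    using g(1) h(1) by (auto simp: ideal_torsion_def)
  have "g \<oplus>\<^bsub>M\<^esub> h \<in> ideal_torsion R M (?Q \<inter> J)"
    using gM hM Jc by (simp add: ideal_torsion_def smult_r_distr)
  moreover have "\<exists>r\<in>carrier R. x = r \<odot>\<^bsub>M\<^esub> (g \<oplus>\<^bsub>M\<^esub> h)" if x: "x \<in> ideal_torsion R M (?Q \<inter> J)" for x
  proof -
    have xM: "x \<in> carrier M" and kill: "\<And>r. r \<in> ?Q \<Longrightarrow> r \<in> J \<Longrightarrow> r \<odot>\<^bsub>M\<^esub> x = \<zero>\<^bsub>M\<^esub>"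
      using x by (auto simp: ideal_torsion_def)
    have "c \<odot>\<^bsub>M\<^esub> (a \<odot>\<^bsub>M\<^esub> x) = \<zero>\<^bsub>M\<^esub>" if c: "c \<in> ?Q" for c
    proof -
      have cR: "c \<in> carrier R" using c by (rule U.symbolic_power_closed)
      have "c \<otimes> a \<in> J" using ideal.I_l_closed[OF step.hyps(4) aJ cR] .
      moreover have "c \<otimes> a \<in> ?Q" using ideal.I_r_closed[OF U.symbolic_power_ideal c aR] .
      ultimately show ?thesis using kill[of "c \<otimes> a"] cR aR xM by (simp add: smult_assoc1)
    qed
    then have "a \<odot>\<^bsub>M\<^esub> x \<in> ideal_torsion R M ?Q" using aR xM by (simp add: ideal_torsion_def)
    then obtain q where q: "q \<in> carrier R" "a \<odot>\<^bsub>M\<^esub> x = q \<odot>\<^bsub>M\<^esub> g" using g(2) by blast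
    have "c \<odot>\<^bsub>M\<^esub> (b \<odot>\<^bsub>M\<^esub> x) = \<zero>\<^bsub>M\<^esub>" if c: "c \<in> J" for c
    proof -
      have cR: "c \<in> carrier R" using c by (rule Jc)
      have "c \<otimes> b \<in> J" using ideal.I_r_closed[OF step.hyps(4) c bR] .
      moreover have "c \<otimes> b \<in> ?Q" using ideal.I_l_closed[OF U.symbolic_power_ideal b cR] .
      ultimately show ?thesis using kill[of "c \<otimes> b"] cR bR xM by (simp add: smult_assoc1)
    qed
    then have "b \<odot>\<^bsub>M\<^esub> x \<in> ideal_torsion R M J" using bR xM by (simp add: ideal_torsion_def)
    then obtain r where r: "r \<in> carrier R" "b \<odot>\<^bsub>M\<^esub> x = r \<odot>\<^bsub>M\<^esub> h" using h(2) by blast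
    have ag: "a \<odot>\<^bsub>M\<^esub> g = g"
    proof -
      have "g = (a \<oplus> b) \<odot>\<^bsub>M\<^esub> g" unfolding ab using gM by simp
      then show ?thesis using aR bR gM(1) gM(2)[OF b] by (simp add: smult_l_distr)
    qed
    have bh: "b \<odot>\<^bsub>M\<^esub> h = h"
    proof -
      have "h = (a \<oplus> b) \<odot>\<^bsub>M\<^esub> h" unfolding ab using hM by simp
      then show ?thesis using aR bR hM(1) hM(2)[OF aJ] by (simp add: smult_l_distr)
    qed
    have "(q \<otimes> a \<oplus> r \<otimes> b) \<odot>\<^bsub>M\<^esub> (g \<oplus>\<^bsub>M\<^esub> h)
        = (q \<odot>\<^bsub>M\<^esub> (a \<odot>\<^bsub>M\<^esub> g) \<oplus>\<^bsub>M\<^esub> r \<odot>\<^bsub>M\<^esub> (b \<odot>\<^bsub>M\<^esub> g)) \<oplus>\<^bsub>M\<^esub> (q \<odot>\<^bsub>M\<^esub> (a \<odot>\<^bsub>M\<^esub> h) \<oplus>\<^bsub>M\<^esub> r \<odot>\<^bsub>M\<^esub> (b \<odot>\<^bsub>M\<^esub> h))"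
      using q(1) r(1) aR bR gM(1) hM(1) by (simp add: smult_l_distr smult_r_distr smult_assoc1)
    also have "\<dots> = q \<odot>\<^bsub>M\<^esub> g \<oplus>\<^bsub>M\<^esub> r \<odot>\<^bsub>M\<^esub> h"
      unfolding ag bh gM(2)[OF b] hM(2)[OF aJ] using q(1) r(1) gM(1) hM(1) by simp
    also have "\<dots> = a \<odot>\<^bsub>M\<^esub> x \<oplus>\<^bsub>M\<^esub> b \<odot>\<^bsub>M\<^esub> x" using q(2) r(2) by simp
    also have "\<dots> = (a \<oplus> b) \<odot>\<^bsub>M\<^esub> x" using aR bR xM by (simp add: smult_l_distr)
    also have "\<dots> = x" unfolding ab using xM by simp
    finally have "x = (q \<otimes> a \<oplus> r \<otimes> b) \<odot>\<^bsub>M\<^esub> (g \<oplus>\<^bsub>M\<^esub> h)" by simp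
    moreover have "q \<otimes> a \<oplus> r \<otimes> b \<in> carrier R" using q(1) r(1) aR bR by simp
    ultimately show ?thesis by blast
  qed
  ultimately show ?case unfolding U.ideal_power_eq_symbolic_power by blast
qed

text \<open>If \<open>g\<close> has annihilator \<open>0\<close>, then \<open>M\<close> is uniform because \<open>R\<close> is a domain. Otherwise let \<open>I\<close> be the annihilator of \<open>g\<close>
  and suppose that the annihilators of \<open>N\<close> and \<open>L\<close> are contained in a maximal ideal \<open>p\<close>, at which \<open>I\<close> agrees with \<open>p^j\<close>. Neither of the ideals
  of multipliers of \<open>g\<close> into \<open>N\<close> and \<open>L\<close> is contained in \<open>p^j\<close>, since an element outside \<open>p\<close> would then
  kill \<open>N\<close> or \<open>L\<close>. Locally both contain a power of \<open>v\<close> with exponent less than \<open>j\<close>, so they share an element outside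
  \<open>p^j\<close>. It multiplies \<open>g\<close> into \<open>N \<inter> L = 0\<close> and thus lies in \<open>I \<subseteq> p^j\<close>, a contradiction.\<close>
lemma cyclic_imp_weakly_IN:
  assumes g: "g \<in> carrier M" and gen: "\<And>x. x \<in> carrier M \<Longrightarrow> \<exists>r\<in>carrier R. x = r \<odot>\<^bsub>M\<^esub> g"
  shows "weakly_IN R M"
proof (cases "\<forall>r\<in>carrier R. r \<odot>\<^bsub>M\<^esub> g = \<zero>\<^bsub>M\<^esub> \<longrightarrow> r = \<zero>")
  case True
  show ?thesis
  proof (rule uniform_imp_weakly_IN)
    fix x y assume xy: "x \<in> carrier M" "y \<in> carrier M" "x \<noteq> \<zero>\<^bsub>M\<^esub>" "y \<noteq> \<zero>\<^bsub>M\<^esub>"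
    obtain a where a: "a \<in> carrier R" "x = a \<odot>\<^bsub>M\<^esub> g" using gen[OF xy(1)] by blast
    obtain b where b: "b \<in> carrier R" "y = b \<odot>\<^bsub>M\<^esub> g" using gen[OF xy(2)] by blast
    have "a \<noteq> \<zero>" "b \<noteq> \<zero>" using a b xy g by auto
    then have "b \<otimes> a \<noteq> \<zero>" using integral[of b a] a(1) b(1) by blast
    then have "b \<odot>\<^bsub>M\<^esub> x \<noteq> \<zero>\<^bsub>M\<^esub>"
      using True a b g by (metis R.m_closed smult_assoc1)
    moreover have "b \<odot>\<^bsub>M\<^esub> x = a \<odot>\<^bsub>M\<^esub> y"
      using a b g by (simp add: smult_assoc1[symmetric] R.m_comm)
    ultimately show "\<exists>a\<in>carrier R. \<exists>b\<in>carrier R. a \<odot>\<^bsub>M\<^esub> x = b \<odot>\<^bsub>M\<^esub> y \<and> a \<odot>\<^bsub>M\<^esub> x \<noteq> \<zero>\<^bsub>M\<^esub>"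
      using a(1) b(1) by blast
  qed
next
  case False
  define pre where "pre N = {r \<in> carrier R. r \<odot>\<^bsub>M\<^esub> g \<in> N}" for N
  have pre_ideal: "ideal (pre N) R" if N: "submodule N R M" for N
    unfolding pre_def by (rule multipliers_into_submodule_ideal[OF N g])
  have Ann_iff: "r \<in> Ann R M N \<longleftrightarrow> r \<in> carrier R \<and> (\<forall>c\<in>pre N. (r \<otimes> c) \<odot>\<^bsub>M\<^esub> g = \<zero>\<^bsub>M\<^esub>)"
    if N: "submodule N R M" for N r
  proof
    assume "r \<in> Ann R M N"
    then show "r \<in> carrier R \<and> (\<forall>c\<in>pre N. (r \<otimes> c) \<odot>\<^bsub>M\<^esub> g = \<zero>\<^bsub>M\<^esub>)"
      using g by (auto simp: Ann_def pre_def smult_assoc1)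
  next
    assume r: "r \<in> carrier R \<and> (\<forall>c\<in>pre N. (r \<otimes> c) \<odot>\<^bsub>M\<^esub> g = \<zero>\<^bsub>M\<^esub>)"
    have "r \<odot>\<^bsub>M\<^esub> x = \<zero>\<^bsub>M\<^esub>" if x: "x \<in> N" for x
    proof -
      obtain c where c: "c \<in> carrier R" "x = c \<odot>\<^bsub>M\<^esub> g" using gen x submoduleE(1)[OF N] by blast
      then have "c \<in> pre N" using x by (simp add: pre_def)
      then have "(r \<otimes> c) \<odot>\<^bsub>M\<^esub> g = \<zero>\<^bsub>M\<^esub>" using r by blast
      then show ?thesis using r c g by (simp add: smult_assoc1)
    qed
    then show "r \<in> Ann R M N" using r by (simp add: Ann_def)
  qed
  define I where "I = pre {\<zero>\<^bsub>M\<^esub>}"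
  have I: "ideal I R" unfolding I_def by (rule pre_ideal[OF zero_submodule])
  have I_iff: "r \<in> I \<longleftrightarrow> r \<in> carrier R \<and> r \<odot>\<^bsub>M\<^esub> g = \<zero>\<^bsub>M\<^esub>" for r by (auto simp: I_def pre_def)
  have "I \<noteq> {\<zero>}" using False I_iff by auto
  show ?thesis
    unfolding weakly_IN_def
  proof (intro allI impI)
    fix N L assume N: "submodule N R M" and L: "submodule L R M" and NL: "N \<inter> L = {\<zero>\<^bsub>M\<^esub>}"
    have Ann_ideal: "ideal (Ann R M H) R" if H: "submodule H R M" for H
    proof -
      have "Ann R M H = \<Inter> ((\<lambda>c. {r \<in> carrier R. r \<otimes> c \<in> I}) ` pre H)"
        using ideal.Icarr[OF pre_ideal[OF H]] additive_subgroup.zero_closed[OF ideal.axioms(1)[OF pre_ideal[OF H]]]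
        by (auto simp: Ann_iff[OF H] I_iff)
      moreover have "ideal (\<Inter> ((\<lambda>c. {r \<in> carrier R. r \<otimes> c \<in> I}) ` pre H)) R"
      proof (rule R.i_Intersect)
        show "ideal A R" if "A \<in> (\<lambda>c. {r \<in> carrier R. r \<otimes> c \<in> I}) ` pre H" for A
          using that colon_ideal[OF I] ideal.Icarr[OF pre_ideal[OF H]] by auto
        show "(\<lambda>c. {r \<in> carrier R. r \<otimes> c \<in> I}) ` pre H \<noteq> {}"
          using additive_subgroup.zero_closed[OF ideal.axioms(1)[OF pre_ideal[OF H]]] by blast
      qed
      ultimately show ?thesis by simp
    qed
    show "Ann R M N <+>\<^bsub>R\<^esub> Ann R M L = carrier R"
    proof (rule ccontr)
      assume ne: "Ann R M N <+>\<^bsub>R\<^esub> Ann R M L \<noteq> carrier R"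
      have "ideal (Ann R M N <+>\<^bsub>R\<^esub> Ann R M L) R" by (rule R.add_ideals[OF Ann_ideal[OF N] Ann_ideal[OF L]])
      then obtain p where p: "maximalideal p R" and sub: "Ann R M N <+>\<^bsub>R\<^esub> Ann R M L \<subseteq> p"
        using exists_maximalideal_above ne by metis
      have A0: "\<zero> \<in> Ann R M H" if "submodule H R M" for H
        using additive_subgroup.zero_closed[OF ideal.axioms(1)[OF Ann_ideal[OF that]]] .
      have AN: "r \<in> p" if "r \<in> Ann R M N" for r
      proof -
        have "r = r \<oplus> \<zero>" using ideal.Icarr[OF Ann_ideal[OF N] that] by simp
        then show ?thesis using that A0[OF L] sub unfolding set_add_def' by blast
      qed
      have AL: "r \<in> p" if "r \<in> Ann R M L" for r
      proof -
        have "r = \<zero> \<oplus> r" using ideal.Icarr[OF Ann_ideal[OF L] that] by simp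
        then show ?thesis using that A0[OF N] sub unfolding set_add_def' by blast
      qed
      have "I \<subseteq> Ann R M N"
      proof
        fix r assume r: "r \<in> I"
        have "(r \<otimes> c) \<odot>\<^bsub>M\<^esub> g = \<zero>\<^bsub>M\<^esub>" if "c \<in> pre N" for c
          using ideal.I_r_closed[OF I r, of c] that by (simp add: pre_def I_iff)
        then show "r \<in> Ann R M N" using r by (simp add: Ann_iff[OF N] I_iff)
      qed
      then have Ip: "I \<subseteq> p" using AN by blast
      have "\<zero> \<in> I" using g by (simp add: I_iff)
      then have "p \<noteq> {\<zero>}" using Ip \<open>I \<noteq> {\<zero>}\<close> by auto
      then obtain v s where "uniformizer R p v s" using exists_uniformizer p by metis
      then interpret U: uniformizer_module R M p v s by (rule uniformizer_moduleI)
      obtain j :: nat and t where t: "t \<in> carrier R" "t \<notin> p" and Isub: "I \<subseteq> U.symbolic_power j"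
        and tI: "\<forall>y\<in>U.symbolic_power j. t \<otimes> y \<in> I"
        using U.ideal_localization[OF I \<open>I \<noteq> {\<zero>}\<close>] by auto
      have nsub: "\<not> pre H \<subseteq> U.symbolic_power j" if H: "submodule H R M" "\<forall>r\<in>Ann R M H. r \<in> p" for H
      proof
        assume "pre H \<subseteq> U.symbolic_power j"
        then have "t \<in> Ann R M H" using tI t(1) by (auto simp: Ann_iff[OF H(1)] I_iff)
        then show False using H(2) t(2) by blast
      qed
      have 0: "\<zero> \<in> U.symbolic_power j"
        using additive_subgroup.zero_closed[OF ideal.axioms(1)[OF U.symbolic_power_ideal]] .
      obtain a where a: "a \<in> pre N" "a \<notin> U.symbolic_power j" using nsub[OF N] AN by blast
      obtain b where b: "b \<in> pre L" "b \<notin> U.symbolic_power j" using nsub[OF L] AL by blast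
      have aR: "a \<in> carrier R" "a \<noteq> \<zero>" and bR: "b \<in> carrier R" "b \<noteq> \<zero>"
        using a b 0 by (auto simp: pre_def)
      obtain i t1 u1 where 1: "t1 \<in> carrier R" "t1 \<notin> p" "u1 \<in> carrier R" "u1 \<notin> p" "t1 \<otimes> a = u1 \<otimes> v [^] (i::nat)"
        using U.normal_form[OF aR] by auto
      obtain i' t2 u2 where 2: "t2 \<in> carrier R" "t2 \<notin> p" "u2 \<in> carrier R" "u2 \<notin> p" "t2 \<otimes> b = u2 \<otimes> v [^] (i'::nat)"
        using U.normal_form[OF bR] by auto
      have i: "i < j" using U.mem_symbolic_power_iff[OF aR(1) 1, of j] a(2) by simp
      have i': "i' < j" using U.mem_symbolic_power_iff[OF bR(1) 2, of j] b(2) by simp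
      let ?k = "max i i'" and ?w = "u1 \<otimes> u2"
      have w: "?w \<in> carrier R" "?w \<notin> p" using 1 2 U.notin_p_mult by auto
      have vk: "v [^] ?k = v [^] (?k - i) \<otimes> v [^] i" "v [^] ?k = v [^] (?k - i') \<otimes> v [^] i'"
        by (simp_all add: nat_pow_mult)
      have "?w \<otimes> v [^] ?k = (u2 \<otimes> v [^] (?k - i)) \<otimes> (u1 \<otimes> v [^] i)"
        unfolding vk(1) using 1(3) 2(3) by (simp add: R.m_ac)
      also have "\<dots> = (u2 \<otimes> v [^] (?k - i) \<otimes> t1) \<otimes> a"
        unfolding 1(5)[symmetric] using 1(1) 2(3) aR(1) by (simp add: R.m_assoc)
      finally have wN: "?w \<otimes> v [^] ?k \<in> pre N"
        using ideal.I_l_closed[OF pre_ideal[OF N] a(1)] 1(1) 2(3) by simp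
      have "?w \<otimes> v [^] ?k = (u1 \<otimes> v [^] (?k - i')) \<otimes> (u2 \<otimes> v [^] i')"
        unfolding vk(2) using 1(3) 2(3) by (simp add: R.m_ac)
      also have "\<dots> = (u1 \<otimes> v [^] (?k - i') \<otimes> t2) \<otimes> b"
        unfolding 2(5)[symmetric] using 2(1) 1(3) bR(1) by (simp add: R.m_assoc)
      finally have wL: "?w \<otimes> v [^] ?k \<in> pre L"
        using ideal.I_l_closed[OF pre_ideal[OF L] b(1)] 2(1) 1(3) by simp
      have "?w \<otimes> v [^] ?k \<in> I" using wN wL NL unfolding I_def pre_def by blast
      then have "?w \<otimes> v [^] ?k \<in> U.symbolic_power j" using Isub by blast
      then have "j \<le> ?k" using U.unit_v_pow_mem_iff[OF w] by simp
      then show False using i i' by simp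
    qed
  qed
qed

end

section \<open>Module homomorphisms\<close>

lemma module_hom_zero:
  assumes "module R M" "module R N" "h \<in> module_hom R M N"
  shows "h \<zero>\<^bsub>M\<^esub> = \<zero>\<^bsub>N\<^esub>"
proof -
  interpret M: module R M by fact
  interpret N: module R N by fact
  have h0: "h \<zero>\<^bsub>M\<^esub> \<in> carrier N" using assms(3) M.M.zero_closed unfolding module_hom_def by blast
  have "h (\<zero>\<^bsub>R\<^esub> \<odot>\<^bsub>M\<^esub> \<zero>\<^bsub>M\<^esub>) = \<zero>\<^bsub>R\<^esub> \<odot>\<^bsub>N\<^esub> h \<zero>\<^bsub>M\<^esub>"
    using assms(3) M.M.zero_closed M.R.zero_closed unfolding module_hom_def by blast
  then show ?thesis using h0 by simp
qed

lemma module_hom_closed: "h \<in> module_hom R M N \<Longrightarrow> x \<in> carrier M \<Longrightarrow> h x \<in> carrier N"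
  unfolding module_hom_def by blast

lemma module_hom_add:
  "h \<in> module_hom R M N \<Longrightarrow> x \<in> carrier M \<Longrightarrow> y \<in> carrier M \<Longrightarrow> h (x \<oplus>\<^bsub>M\<^esub> y) = h x \<oplus>\<^bsub>N\<^esub> h y"
  unfolding module_hom_def by blast

lemma module_hom_smult:
  "h \<in> module_hom R M N \<Longrightarrow> r \<in> carrier R \<Longrightarrow> x \<in> carrier M \<Longrightarrow> h (r \<odot>\<^bsub>M\<^esub> x) = r \<odot>\<^bsub>N\<^esub> h x"
  unfolding module_hom_def by blast

lemma module_hom_image_submodule:
  assumes M: "module R M" and N: "module R N" and h: "h \<in> module_hom R M N"
  shows "submodule (h ` carrier M) R N"
proof -
  interpret M: module R M by fact
  interpret N: module R N by fact
  show ?thesis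
  proof (rule N.submoduleI)
    show "h ` carrier M \<subseteq> carrier N" using module_hom_closed[OF h] by auto
    show "\<zero>\<^bsub>N\<^esub> \<in> h ` carrier M"
      by (rule image_eqI[of _ _ "\<zero>\<^bsub>M\<^esub>"]) (use module_hom_zero[OF M N h] in auto)
    have sm: "a \<odot>\<^bsub>N\<^esub> y \<in> h ` carrier M" if a: "a \<in> carrier R" and y: "y \<in> h ` carrier M" for a y
    proof -
      obtain x where x: "x \<in> carrier M" "y = h x" using y by blast
      show ?thesis
        by (rule image_eqI[of _ _ "a \<odot>\<^bsub>M\<^esub> x"]) (use x a module_hom_smult[OF h] in auto)
    qed
    then show "a \<in> carrier R \<Longrightarrow> y \<in> h ` carrier M \<Longrightarrow> a \<odot>\<^bsub>N\<^esub> y \<in> h ` carrier M" for a y .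
    show "\<ominus>\<^bsub>N\<^esub> y \<in> h ` carrier M" if y: "y \<in> h ` carrier M" for y
    proof -
      have "y \<in> carrier N" using y module_hom_closed[OF h] by auto
      then have "\<ominus>\<^bsub>N\<^esub> y = (\<ominus>\<^bsub>R\<^esub> \<one>\<^bsub>R\<^esub>) \<odot>\<^bsub>N\<^esub> y" by (simp add: N.smult_l_minus)
      then show ?thesis using sm[OF _ y, of "\<ominus>\<^bsub>R\<^esub> \<one>\<^bsub>R\<^esub>"] by simp
    qed
    fix y z assume "y \<in> h ` carrier M" "z \<in> h ` carrier M"
    then obtain x w where xw: "x \<in> carrier M" "y = h x" "w \<in> carrier M" "z = h w" by blast
    show "y \<oplus>\<^bsub>N\<^esub> z \<in> h ` carrier M"
      by (rule image_eqI[of _ _ "x \<oplus>\<^bsub>M\<^esub> w"]) (use xw module_hom_add[OF h] in auto)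
  qed
qed

lemma module_iso_image:
  assumes "h \<in> module_hom R M N" "inj_on h (carrier M)"
  shows "module_iso R M (N\<lparr>carrier := h ` carrier M\<rparr>)"
  unfolding module_iso_def
proof (rule bexI)
  show "bij_betw h (carrier M) (carrier (N\<lparr>carrier := h ` carrier M\<rparr>))"
    using assms(2) by (simp add: bij_betw_def)
  show "h \<in> module_hom R M (N\<lparr>carrier := h ` carrier M\<rparr>)"
    using assms(1) by (simp add: module_hom_def)
qed

text \<open>Common multiples are inherited by modules that embed into \<open>N\<close>.\<close>
lemma uniform_pullback_imp_weakly_IN:
  assumes M: "module R M" and N: "module R N" and h: "h \<in> module_hom R M N" "inj_on h (carrier M)"
    and uniform: "\<And>x y. x \<in> carrier M \<Longrightarrow> y \<in> carrier M \<Longrightarrow> h x \<noteq> \<zero>\<^bsub>N\<^esub> \<Longrightarrow> h y \<noteq> \<zero>\<^bsub>N\<^esub> \<Longrightarrow>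
      \<exists>a\<in>carrier R. \<exists>b\<in>carrier R. a \<odot>\<^bsub>N\<^esub> h x = b \<odot>\<^bsub>N\<^esub> h y \<and> a \<odot>\<^bsub>N\<^esub> h x \<noteq> \<zero>\<^bsub>N\<^esub>"
  shows "weakly_IN R M"
proof (rule module.uniform_imp_weakly_IN[OF M])
  interpret M: module R M by fact
  fix x y assume x: "x \<in> carrier M" "x \<noteq> \<zero>\<^bsub>M\<^esub>" and y: "y \<in> carrier M" "y \<noteq> \<zero>\<^bsub>M\<^esub>"
  have h0: "h \<zero>\<^bsub>M\<^esub> = \<zero>\<^bsub>N\<^esub>" by (rule module_hom_zero[OF M N h(1)])
  have nz: "h z \<noteq> \<zero>\<^bsub>N\<^esub>" if "z \<in> carrier M" "z \<noteq> \<zero>\<^bsub>M\<^esub>" for z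
    using inj_onD[OF h(2), of z "\<zero>\<^bsub>M\<^esub>"] h0 that by auto
  obtain a b where ab: "a \<in> carrier R" "b \<in> carrier R" "a \<odot>\<^bsub>N\<^esub> h x = b \<odot>\<^bsub>N\<^esub> h y" "a \<odot>\<^bsub>N\<^esub> h x \<noteq> \<zero>\<^bsub>N\<^esub>"
    using uniform[OF x(1) y(1) nz[OF x] nz[OF y]] by blast
  have "h (a \<odot>\<^bsub>M\<^esub> x) = h (b \<odot>\<^bsub>M\<^esub> y)"
    using ab module_hom_smult[OF h(1)] x(1) y(1) by simp
  then have "a \<odot>\<^bsub>M\<^esub> x = b \<odot>\<^bsub>M\<^esub> y" using inj_onD[OF h(2)] ab x(1) y(1) by simp
  moreover have "a \<odot>\<^bsub>M\<^esub> x \<noteq> \<zero>\<^bsub>M\<^esub>"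
  proof
    assume "a \<odot>\<^bsub>M\<^esub> x = \<zero>\<^bsub>M\<^esub>"
    then have "h (a \<odot>\<^bsub>M\<^esub> x) = \<zero>\<^bsub>N\<^esub>" using h0 by simp
    then show False using ab(1,4) module_hom_smult[OF h(1) ab(1) x(1)] by simp
  qed
  ultimately show "\<exists>a\<in>carrier R. \<exists>b\<in>carrier R. a \<odot>\<^bsub>M\<^esub> x = b \<odot>\<^bsub>M\<^esub> y \<and> a \<odot>\<^bsub>M\<^esub> x \<noteq> \<zero>\<^bsub>M\<^esub>"
    using ab(1,2) by blast
qed

section \<open>Baer's criterion\<close>

text \<open>Partial extensions of \<open>g\<close> along \<open>f\<close> are represented by their graphs in \<open>B \<times> E\<close>, and Zorn's lemma yields a maximal
  one. It is defined everywhere: for \<open>b \<in> B\<close> the multipliers of \<open>b\<close> into its domain form an ideal \<open>I\<close>, and if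
  \<open>e0\<close> represents the induced homomorphism \<open>I \<rightarrow> E\<close>, then \<open>b \<mapsto> e0\<close> extends the graph.\<close>
lemma Baer_criterion:
  fixes R (structure)
  assumes E: "module R E"
    and ext: "\<And>I k. \<lbrakk>ideal I R; k \<in> I \<rightarrow> carrier E;
        \<And>r q. r \<in> I \<Longrightarrow> q \<in> I \<Longrightarrow> k (r \<oplus> q) = k r \<oplus>\<^bsub>E\<^esub> k q;
        \<And>a r. a \<in> carrier R \<Longrightarrow> r \<in> I \<Longrightarrow> k (a \<otimes> r) = a \<odot>\<^bsub>E\<^esub> k r\<rbrakk>
      \<Longrightarrow> \<exists>e\<in>carrier E. \<forall>r\<in>I. k r = r \<odot>\<^bsub>E\<^esub> e"
  shows "injective_module R E"
  unfolding injective_module_def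
proof (intro conjI allI impI)
  show "module R E" by fact
  fix A B :: "('a, 'a) module" and f g
  assume A: "module R A" and B: "module R B" and f: "f \<in> module_hom R A B" and inj: "inj_on f (carrier A)"
    and g: "g \<in> module_hom R A E"
  interpret A: module R A by fact
  interpret B: module R B by fact
  interpret E: module R E by fact
  have fc: "f x \<in> carrier B" "g x \<in> carrier E" if "x \<in> carrier A" for x
    using f g that unfolding module_hom_def by blast+
  have fl: "f (r \<odot>\<^bsub>A\<^esub> x \<oplus>\<^bsub>A\<^esub> y) = r \<odot>\<^bsub>B\<^esub> f x \<oplus>\<^bsub>B\<^esub> f y" "g (r \<odot>\<^bsub>A\<^esub> x \<oplus>\<^bsub>A\<^esub> y) = r \<odot>\<^bsub>E\<^esub> g x \<oplus>\<^bsub>E\<^esub> g y"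
    if "r \<in> carrier R" "x \<in> carrier A" "y \<in> carrier A" for r x y
    using f g that by (simp_all add: module_hom_def)
  have f0: "f \<zero>\<^bsub>A\<^esub> = \<zero>\<^bsub>B\<^esub>" "g \<zero>\<^bsub>A\<^esub> = \<zero>\<^bsub>E\<^esub>"
    using module_hom_zero[OF A B f] module_hom_zero[OF A E g] by auto
  define graph where "graph G \<longleftrightarrow> (\<forall>x\<in>carrier A. (f x, g x) \<in> G) \<and> G \<subseteq> carrier B \<times> carrier E \<and>
    (\<forall>r b e b' e'. r \<in> carrier R \<longrightarrow> (b, e) \<in> G \<longrightarrow> (b', e') \<in> G \<longrightarrow>
      (r \<odot>\<^bsub>B\<^esub> b \<oplus>\<^bsub>B\<^esub> b', r \<odot>\<^bsub>E\<^esub> e \<oplus>\<^bsub>E\<^esub> e') \<in> G) \<and> (\<forall>e. (\<zero>\<^bsub>B\<^esub>, e) \<in> G \<longrightarrow> e = \<zero>\<^bsub>E\<^esub>)" for G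
  have graphI: "graph G"
    if "\<And>x. x \<in> carrier A \<Longrightarrow> (f x, g x) \<in> G" "\<And>b e. (b, e) \<in> G \<Longrightarrow> b \<in> carrier B \<and> e \<in> carrier E"
      "\<And>r b e b' e'. r \<in> carrier R \<Longrightarrow> (b, e) \<in> G \<Longrightarrow> (b', e') \<in> G \<Longrightarrow>
        (r \<odot>\<^bsub>B\<^esub> b \<oplus>\<^bsub>B\<^esub> b', r \<odot>\<^bsub>E\<^esub> e \<oplus>\<^bsub>E\<^esub> e') \<in> G" "\<And>e. (\<zero>\<^bsub>B\<^esub>, e) \<in> G \<Longrightarrow> e = \<zero>\<^bsub>E\<^esub>" for G
    unfolding graph_def
  proof (intro conjI allI ballI impI)
    show "G \<subseteq> carrier B \<times> carrier E" using that(2) by auto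
  qed (simp_all add: that)
  have gbase: "(f x, g x) \<in> G" if "graph G" "x \<in> carrier A" for G x
    using that(1) unfolding graph_def by (elim conjE) (erule bspec[OF _ that(2)])
  have gcar: "b \<in> carrier B \<and> e \<in> carrier E" if "graph G" "(b, e) \<in> G" for G b e
  proof -
    have "G \<subseteq> carrier B \<times> carrier E" using that(1) unfolding graph_def by (elim conjE)
    then show ?thesis using that(2) by auto
  qed
  have glin: "(r \<odot>\<^bsub>B\<^esub> b \<oplus>\<^bsub>B\<^esub> b', r \<odot>\<^bsub>E\<^esub> e \<oplus>\<^bsub>E\<^esub> e') \<in> G"
    if "graph G" "r \<in> carrier R" "(b, e) \<in> G" "(b', e') \<in> G" for G r b e b' e'
  proof -
    have "\<forall>r b e b' e'. r \<in> carrier R \<longrightarrow> (b, e) \<in> G \<longrightarrow> (b', e') \<in> G \<longrightarrow>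
      (r \<odot>\<^bsub>B\<^esub> b \<oplus>\<^bsub>B\<^esub> b', r \<odot>\<^bsub>E\<^esub> e \<oplus>\<^bsub>E\<^esub> e') \<in> G"
      using that(1) unfolding graph_def by (elim conjE)
    then show ?thesis using that(2-4) by blast
  qed
  have gzero: "e = \<zero>\<^bsub>E\<^esub>" if "graph G" "(\<zero>\<^bsub>B\<^esub>, e) \<in> G" for G e
  proof -
    have "\<forall>e. (\<zero>\<^bsub>B\<^esub>, e) \<in> G \<longrightarrow> e = \<zero>\<^bsub>E\<^esub>"
      using that(1) unfolding graph_def by (elim conjE)
    then show ?thesis using that(2) by blast
  qed
  have base: "graph ((\<lambda>x. (f x, g x)) ` carrier A)"
  proof (rule graphI)
    fix r b e b' e'
    assume r: "r \<in> carrier R" and "(b, e) \<in> (\<lambda>x. (f x, g x)) ` carrier A" "(b', e') \<in> (\<lambda>x. (f x, g x)) ` carrier A"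
    then obtain x y where xy: "x \<in> carrier A" "y \<in> carrier A" "b = f x" "e = g x" "b' = f y" "e' = g y" by auto
    show "(r \<odot>\<^bsub>B\<^esub> b \<oplus>\<^bsub>B\<^esub> b', r \<odot>\<^bsub>E\<^esub> e \<oplus>\<^bsub>E\<^esub> e') \<in> (\<lambda>x. (f x, g x)) ` carrier A"
      by (rule image_eqI[of _ _ "r \<odot>\<^bsub>A\<^esub> x \<oplus>\<^bsub>A\<^esub> y"]) (use r xy fl in auto)
  next
    fix e assume "(\<zero>\<^bsub>B\<^esub>, e) \<in> (\<lambda>x. (f x, g x)) ` carrier A"
    then obtain x where x: "x \<in> carrier A" "f x = f \<zero>\<^bsub>A\<^esub>" "e = g x" using f0(1) by auto
    then have "x = \<zero>\<^bsub>A\<^esub>" using inj_onD[OF inj] by blast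
    then show "e = \<zero>\<^bsub>E\<^esub>" using x(3) f0(2) by simp
  qed (use fc in auto)
  have "\<exists>G\<in>Collect graph. \<forall>H\<in>Collect graph. G \<subseteq> H \<longrightarrow> H = G"
  proof (rule subset_Zorn_nonempty)
    show "Collect graph \<noteq> {}" using base by blast
    fix C assume ne: "C \<noteq> {}" and chain: "subset.chain (Collect graph) C"
    have C: "graph G" if "G \<in> C" for G using chain that by (auto simp: subset_chain_def)
    have "graph (\<Union>C)"
    proof (rule graphI)
      show "(f x, g x) \<in> \<Union>C" if "x \<in> carrier A" for x using ne C gbase[OF _ that] by blast
      show "b \<in> carrier B \<and> e \<in> carrier E" if "(b, e) \<in> \<Union>C" for b e using that gcar C by blast
      show "e = \<zero>\<^bsub>E\<^esub>" if "(\<zero>\<^bsub>B\<^esub>, e) \<in> \<Union>C" for e using that gzero C by blast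
      fix r b e b' e' assume r: "r \<in> carrier R" and "(b, e) \<in> \<Union>C" "(b', e') \<in> \<Union>C"
      then obtain G H where GH: "G \<in> C" "(b, e) \<in> G" "H \<in> C" "(b', e') \<in> H" by blast
      then have "G \<subseteq> H \<or> H \<subseteq> G" using chain by (auto simp: subset_chain_def)
      then obtain J where "J \<in> C" "(b, e) \<in> J" "(b', e') \<in> J" using GH by blast
      then show "(r \<odot>\<^bsub>B\<^esub> b \<oplus>\<^bsub>B\<^esub> b', r \<odot>\<^bsub>E\<^esub> e \<oplus>\<^bsub>E\<^esub> e') \<in> \<Union>C" using glin[OF C r] by blast
    qed
    then show "\<Union>C \<in> Collect graph" by simp
  qed
  then obtain G where "G \<in> Collect graph" and max: "\<forall>H\<in>Collect graph. G \<subseteq> H \<longrightarrow> H = G" by (rule bexE)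
  then have G: "graph G" by simp
  note Gc = gcar[OF G] and Gl = glin[OF G] and Gz = gzero[OF G]
  have G0: "(\<zero>\<^bsub>B\<^esub>, \<zero>\<^bsub>E\<^esub>) \<in> G" using gbase[OF G A.M.zero_closed] f0 by simp
  have Gs: "(r \<odot>\<^bsub>B\<^esub> b, r \<odot>\<^bsub>E\<^esub> e) \<in> G" if "r \<in> carrier R" "(b, e) \<in> G" for r b e
    using Gl[OF that G0] Gc[OF that(2)] that(1) by simp
  have Ga: "(b \<oplus>\<^bsub>B\<^esub> b', e \<oplus>\<^bsub>E\<^esub> e') \<in> G" if "(b, e) \<in> G" "(b', e') \<in> G" for b e b' e'
    using Gl[OF A.R.one_closed that] Gc[OF that(1)] by simp
  have Gn: "(\<ominus>\<^bsub>B\<^esub> b, \<ominus>\<^bsub>E\<^esub> e) \<in> G" if "(b, e) \<in> G" for b e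
    using Gs[OF _ that, of "\<ominus> \<one>"] Gc[OF that] by (simp add: B.smult_l_minus E.smult_l_minus)
  have uniq: "e = e'" if "(b, e) \<in> G" "(b, e') \<in> G" for b e e'
  proof -
    have "(b \<oplus>\<^bsub>B\<^esub> \<ominus>\<^bsub>B\<^esub> b, e \<oplus>\<^bsub>E\<^esub> \<ominus>\<^bsub>E\<^esub> e') \<in> G" by (rule Ga[OF that(1) Gn[OF that(2)]])
    then have "e \<oplus>\<^bsub>E\<^esub> \<ominus>\<^bsub>E\<^esub> e' = \<zero>\<^bsub>E\<^esub>" using Gz Gc[OF that(1)] by (simp add: B.M.r_neg)
    then show ?thesis using Gc[OF that(1)] Gc[OF that(2)] E.M.minus_equality E.M.minus_minus
      by (metis E.M.a_inv_closed)
  qed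
  define h where "h b = (THE e. (b, e) \<in> G)" for b
  have hI: "h b = e" if "(b, e) \<in> G" for b e
    unfolding h_def using that uniq by blast
  have total: "\<exists>e. (b, e) \<in> G" if b: "b \<in> carrier B" for b
  proof -
    define I where "I = {r \<in> carrier R. \<exists>e. (r \<odot>\<^bsub>B\<^esub> b, e) \<in> G}"
    define k where "k r = h (r \<odot>\<^bsub>B\<^esub> b)" for r
    have kG: "(r \<odot>\<^bsub>B\<^esub> b, k r) \<in> G" if "r \<in> I" for r
      using that hI unfolding I_def k_def by blast
    have IR: "r \<in> carrier R" if "r \<in> I" for r using that by (simp add: I_def)
    have II: "r \<in> I" "k r = e" if "r \<in> carrier R" "(r \<odot>\<^bsub>B\<^esub> b, e) \<in> G" for r e
      using that hI unfolding I_def k_def by blast+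
    have Iadd: "((r \<oplus> q) \<odot>\<^bsub>B\<^esub> b, k r \<oplus>\<^bsub>E\<^esub> k q) \<in> G" if "r \<in> I" "q \<in> I" for r q
      using Ga[OF kG[OF that(1)] kG[OF that(2)]] IR[OF that(1)] IR[OF that(2)] b by (simp add: B.smult_l_distr)
    have Imul: "((a \<otimes> r) \<odot>\<^bsub>B\<^esub> b, a \<odot>\<^bsub>E\<^esub> k r) \<in> G" if "a \<in> carrier R" "r \<in> I" for a r
      using Gs[OF that(1) kG[OF that(2)]] IR[OF that(2)] that(1) b by (simp add: B.smult_assoc1)
    have Iid: "ideal I R"
    proof (rule A.R.idealI_closed)
      show "I \<subseteq> carrier R" using IR by blast
      have "\<zero> \<in> I" by (rule II(1)[of _ "\<zero>\<^bsub>E\<^esub>"]) (use G0 b in auto)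
      then show "I \<noteq> {}" by blast
      show "r \<oplus> q \<in> I" if "r \<in> I" "q \<in> I" for r q
        using II(1)[OF _ Iadd[OF that]] IR[OF that(1)] IR[OF that(2)] by simp
      show "a \<otimes> r \<in> I" if "a \<in> carrier R" "r \<in> I" for a r
        using II(1)[OF _ Imul[OF that]] IR[OF that(2)] that(1) by simp
    qed
    have "\<exists>e\<in>carrier E. \<forall>r\<in>I. k r = r \<odot>\<^bsub>E\<^esub> e"
    proof (rule ext[OF Iid])
      show "k \<in> I \<rightarrow> carrier E" using Gc[OF kG] by blast
      show "k (r \<oplus> q) = k r \<oplus>\<^bsub>E\<^esub> k q" if "r \<in> I" "q \<in> I" for r q
        by (rule II(2)[OF _ Iadd[OF that]]) (use IR[OF that(1)] IR[OF that(2)] in simp)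
      show "k (a \<otimes> r) = a \<odot>\<^bsub>E\<^esub> k r" if "a \<in> carrier R" "r \<in> I" for a r
        by (rule II(2)[OF _ Imul[OF that]]) (use IR[OF that(2)] that(1) in simp)
    qed
    then obtain e0 where e0: "e0 \<in> carrier E" and ke: "\<And>r. r \<in> I \<Longrightarrow> k r = r \<odot>\<^bsub>E\<^esub> e0" by blast
    define H where "H = {(d \<oplus>\<^bsub>B\<^esub> r \<odot>\<^bsub>B\<^esub> b, e \<oplus>\<^bsub>E\<^esub> r \<odot>\<^bsub>E\<^esub> e0) | d e r. (d, e) \<in> G \<and> r \<in> carrier R}"
    have HI: "(d \<oplus>\<^bsub>B\<^esub> r \<odot>\<^bsub>B\<^esub> b, e \<oplus>\<^bsub>E\<^esub> r \<odot>\<^bsub>E\<^esub> e0) \<in> H" if "(d, e) \<in> G" "r \<in> carrier R" for d e r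
      using that unfolding H_def by blast
    have HE: "\<exists>d e r. x = d \<oplus>\<^bsub>B\<^esub> r \<odot>\<^bsub>B\<^esub> b \<and> y = e \<oplus>\<^bsub>E\<^esub> r \<odot>\<^bsub>E\<^esub> e0 \<and> (d, e) \<in> G \<and> r \<in> carrier R"
      if "(x, y) \<in> H" for x y
      using that unfolding H_def by blast
    have sub: "G \<subseteq> H"
    proof (rule subrelI)
      fix x y assume "(x, y) \<in> G"
      then show "(x, y) \<in> H" using HI[of x y \<zero>] Gc[of x y] b e0 by simp
    qed
    have "graph H"
    proof (rule graphI)
      show "(f x, g x) \<in> H" if "x \<in> carrier A" for x using gbase[OF G that] sub by blast
      show "x \<in> carrier B \<and> y \<in> carrier E" if xy: "(x, y) \<in> H" for x y
        using HE[OF xy] Gc b e0 by auto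
    next
      fix q x y x' y' assume q: "q \<in> carrier R" and xy: "(x, y) \<in> H" and xy': "(x', y') \<in> H"
      obtain d e r where 1: "x = d \<oplus>\<^bsub>B\<^esub> r \<odot>\<^bsub>B\<^esub> b" "y = e \<oplus>\<^bsub>E\<^esub> r \<odot>\<^bsub>E\<^esub> e0" "(d, e) \<in> G" "r \<in> carrier R"
        using HE[OF xy] by blast
      obtain d' e' r' where 2: "x' = d' \<oplus>\<^bsub>B\<^esub> r' \<odot>\<^bsub>B\<^esub> b" "y' = e' \<oplus>\<^bsub>E\<^esub> r' \<odot>\<^bsub>E\<^esub> e0" "(d', e') \<in> G" "r' \<in> carrier R"
        using HE[OF xy'] by blast
      note c = Gc[OF 1(3)] Gc[OF 2(3)] b e0 q 1(4) 2(4)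
      have "q \<odot>\<^bsub>B\<^esub> x \<oplus>\<^bsub>B\<^esub> x' = (q \<odot>\<^bsub>B\<^esub> d \<oplus>\<^bsub>B\<^esub> d') \<oplus>\<^bsub>B\<^esub> (q \<otimes> r \<oplus> r') \<odot>\<^bsub>B\<^esub> b"
        "q \<odot>\<^bsub>E\<^esub> y \<oplus>\<^bsub>E\<^esub> y' = (q \<odot>\<^bsub>E\<^esub> e \<oplus>\<^bsub>E\<^esub> e') \<oplus>\<^bsub>E\<^esub> (q \<otimes> r \<oplus> r') \<odot>\<^bsub>E\<^esub> e0"
        unfolding 1(1,2) 2(1,2) using c
        by (simp_all add: B.smult_l_distr B.smult_r_distr B.smult_assoc1 B.M.a_ac
            E.smult_l_distr E.smult_r_distr E.smult_assoc1 E.M.a_ac)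
      then show "(q \<odot>\<^bsub>B\<^esub> x \<oplus>\<^bsub>B\<^esub> x', q \<odot>\<^bsub>E\<^esub> y \<oplus>\<^bsub>E\<^esub> y') \<in> H"
        using HI[OF Gl[OF q 1(3) 2(3)], of "q \<otimes> r \<oplus> r'"] q 1(4) 2(4) by simp
    next
      fix y assume y: "(\<zero>\<^bsub>B\<^esub>, y) \<in> H"
      obtain d e r where 1: "\<zero>\<^bsub>B\<^esub> = d \<oplus>\<^bsub>B\<^esub> r \<odot>\<^bsub>B\<^esub> b" "y = e \<oplus>\<^bsub>E\<^esub> r \<odot>\<^bsub>E\<^esub> e0" "(d, e) \<in> G" "r \<in> carrier R"
        using HE[OF y] by blast
      have dB: "d \<in> carrier B" and eE: "e \<in> carrier E" using Gc[OF 1(3)] by auto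
      have "r \<odot>\<^bsub>B\<^esub> b = \<ominus>\<^bsub>B\<^esub> d"
        using 1(1,4) dB b by (metis B.M.minus_equality B.M.a_comm B.smult_closed)
      then have rG: "(r \<odot>\<^bsub>B\<^esub> b, \<ominus>\<^bsub>E\<^esub> e) \<in> G" using Gn[OF 1(3)] by simp
      have "r \<odot>\<^bsub>E\<^esub> e0 = \<ominus>\<^bsub>E\<^esub> e" using ke[OF II(1)[OF 1(4) rG]] II(2)[OF 1(4) rG] by simp
      then show "y = \<zero>\<^bsub>E\<^esub>" unfolding 1(2) using eE by (simp add: E.M.r_neg)
    qed
    then have "H = G" using max sub by blast
    moreover have "(b, e0) \<in> H" using HI[OF G0, of \<one>] b e0 by simp
    ultimately show ?thesis by blast
  qed
  have hG: "(b, h b) \<in> G" if "b \<in> carrier B" for b using total[OF that] hI by blast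
  have "h \<in> module_hom R B E"
    using Gc[OF hG] hI[OF Ga[OF hG hG]] hI[OF Gs[OF _ hG]] by (simp add: module_hom_def)
  moreover have "h (f x) = g x" if "x \<in> carrier A" for x using hI[OF gbase[OF G that]] .
  ultimately show "\<exists>h\<in>module_hom R B E. \<forall>x\<in>carrier A. h (f x) = g x" by blast
qed

section \<open>Cyclic modules\<close>

text \<open>Both modules are the quotient of \<open>R\<close> by the same ideal.\<close>
lemma cyclic_module_iso:
  assumes M: "module R M"
    and g: "g \<in> carrier M" "\<And>x. x \<in> carrier M \<Longrightarrow> \<exists>r\<in>carrier R. x = r \<odot>\<^bsub>M\<^esub> g"
    and f: "\<And>r. r \<in> carrier R \<Longrightarrow> f r \<in> carrier N"
      "\<And>y. y \<in> carrier N \<Longrightarrow> \<exists>r\<in>carrier R. y = f r"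
      "\<And>r q. r \<in> carrier R \<Longrightarrow> q \<in> carrier R \<Longrightarrow> f (r \<oplus>\<^bsub>R\<^esub> q) = f r \<oplus>\<^bsub>N\<^esub> f q"
      "\<And>a r. a \<in> carrier R \<Longrightarrow> r \<in> carrier R \<Longrightarrow> f (a \<otimes>\<^bsub>R\<^esub> r) = a \<odot>\<^bsub>N\<^esub> f r"
    and same: "\<And>r q. r \<in> carrier R \<Longrightarrow> q \<in> carrier R \<Longrightarrow> f r = f q \<longleftrightarrow> r \<odot>\<^bsub>M\<^esub> g = q \<odot>\<^bsub>M\<^esub> g"
  shows "module_iso R M N"
proof -
  interpret M: module R M by fact
  define c where "c x = (SOME r. r \<in> carrier R \<and> x = r \<odot>\<^bsub>M\<^esub> g)" for x
  have c: "c x \<in> carrier R" "x = c x \<odot>\<^bsub>M\<^esub> g" if "x \<in> carrier M" for x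
    using someI_ex[of "\<lambda>r. r \<in> carrier R \<and> x = r \<odot>\<^bsub>M\<^esub> g"] g(2)[OF that] unfolding c_def by blast+
  have h: "f (c (r \<odot>\<^bsub>M\<^esub> g)) = f r" if "r \<in> carrier R" for r
    using same c[of "r \<odot>\<^bsub>M\<^esub> g"] that g(1) by simp
  have "(\<lambda>x. f (c x)) \<in> module_hom R M N"
    unfolding module_hom_def
  proof (intro CollectI conjI ballI)
    show "(\<lambda>x. f (c x)) \<in> carrier M \<rightarrow> carrier N" using c(1) f(1) by simp
    fix x y assume x: "x \<in> carrier M" and y: "y \<in> carrier M"
    have "x \<oplus>\<^bsub>M\<^esub> y = (c x \<oplus>\<^bsub>R\<^esub> c y) \<odot>\<^bsub>M\<^esub> g"
      using c[OF x] c[OF y] g(1) by (simp add: M.smult_l_distr)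
    then show "f (c (x \<oplus>\<^bsub>M\<^esub> y)) = f (c x) \<oplus>\<^bsub>N\<^esub> f (c y)"
      using h[of "c x \<oplus>\<^bsub>R\<^esub> c y"] f(3) c(1)[OF x] c(1)[OF y] by simp
  next
    fix a x assume a: "a \<in> carrier R" and x: "x \<in> carrier M"
    have "a \<odot>\<^bsub>M\<^esub> x = (a \<otimes>\<^bsub>R\<^esub> c x) \<odot>\<^bsub>M\<^esub> g"
      using c[OF x] g(1) a by (simp add: M.smult_assoc1)
    then show "f (c (a \<odot>\<^bsub>M\<^esub> x)) = a \<odot>\<^bsub>N\<^esub> f (c x)"
      using h[of "a \<otimes>\<^bsub>R\<^esub> c x"] f(4) c(1)[OF x] a by simp
  qed
  moreover have "bij_betw (\<lambda>x. f (c x)) (carrier M) (carrier N)"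
  proof (rule bij_betw_imageI)
    show "inj_on (\<lambda>x. f (c x)) (carrier M)"
    proof (rule inj_onI)
      fix x y assume x: "x \<in> carrier M" and y: "y \<in> carrier M" and "f (c x) = f (c y)"
      then have "c x \<odot>\<^bsub>M\<^esub> g = c y \<odot>\<^bsub>M\<^esub> g" using same c(1) by blast
      then show "x = y" using c(2)[OF x] c(2)[OF y] by simp
    qed
    show "(\<lambda>x. f (c x)) ` carrier M = carrier N"
    proof
      show "(\<lambda>x. f (c x)) ` carrier M \<subseteq> carrier N" using c(1) f(1) by auto
      show "carrier N \<subseteq> (\<lambda>x. f (c x)) ` carrier M"
      proof
        fix y assume "y \<in> carrier N"
        then obtain r where r: "r \<in> carrier R" "y = f r" using f(2) by blast
        then show "y \<in> (\<lambda>x. f (c x)) ` carrier M"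
          using h[of r] g(1) by (intro image_eqI[of _ _ "r \<odot>\<^bsub>M\<^esub> g"]) auto
      qed
    qed
  qed
  ultimately show ?thesis unfolding module_iso_def by blast
qed

context
  fixes R (structure) and I
  assumes R: "cring R" and I: "ideal I R"
begin

interpretation cring R by (rule R)

lemma quot_module_module: "module R (quot_module R I)"
  unfolding quot_module_def
  using module_restrict_scalars[OF R ideal.quotient_is_cring[OF I R] ideal.rcos_ring_hom[OF I]] .

lemma quot_module_coset_closed: "r \<in> carrier R \<Longrightarrow> I +>\<^bsub>R\<^esub> r \<in> carrier (quot_module R I)"
  using a_rcosetsI[of I] ideal.Icarr[OF I] by (simp add: quot_module_def FactRing_def subset_iff)

lemma quot_moduleE: "C \<in> carrier (quot_module R I) \<Longrightarrow> \<exists>r\<in>carrier R. C = I +>\<^bsub>R\<^esub> r"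
  by (auto simp: quot_module_def FactRing_def A_RCOSETS_def RCOSETS_def a_r_coset_def)

lemma quot_module_coset_add:
  "r \<in> carrier R \<Longrightarrow> q \<in> carrier R \<Longrightarrow> I +>\<^bsub>R\<^esub> (r \<oplus> q) = (I +>\<^bsub>R\<^esub> r) \<oplus>\<^bsub>quot_module R I\<^esub> (I +>\<^bsub>R\<^esub> q)"
  using ideal.a_rcos_sum[OF I] by (simp add: quot_module_def FactRing_def)

lemma quot_module_coset_smult:
  "a \<in> carrier R \<Longrightarrow> r \<in> carrier R \<Longrightarrow> I +>\<^bsub>R\<^esub> (a \<otimes> r) = a \<odot>\<^bsub>quot_module R I\<^esub> (I +>\<^bsub>R\<^esub> r)"
  using ideal.rcoset_mult_add[OF I] by (simp add: quot_module_def FactRing_def)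

lemma quot_module_coset_eq_iff:
  "r \<in> carrier R \<Longrightarrow> q \<in> carrier R \<Longrightarrow> I +>\<^bsub>R\<^esub> r = I +>\<^bsub>R\<^esub> q \<longleftrightarrow> r \<ominus> q \<in> I"
  using quotient_eq_iff_same_a_r_cos[OF I] by blast

lemma quot_module_smult_one:
  assumes "r \<in> carrier R"
  shows "r \<odot>\<^bsub>quot_module R I\<^esub> (I +>\<^bsub>R\<^esub> \<one>) = I +>\<^bsub>R\<^esub> r"
  by (subst quot_module_coset_smult[symmetric]) (use assms in simp_all)

lemma quot_module_coset_generates:
  "C \<in> carrier (quot_module R I) \<Longrightarrow> \<exists>r\<in>carrier R. C = r \<odot>\<^bsub>quot_module R I\<^esub> (I +>\<^bsub>R\<^esub> \<one>)"
  using quot_moduleE[of C] quot_module_smult_one by metis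

end

section \<open>Faithful primary modules\<close>

text \<open>The modules of the third case. They turn out to be the injective hulls of \<open>R/p\<close>.\<close>
locale faithful_primary_module = uniformizer_module +
  assumes weakly_IN: "weakly_IN R M"
    and all_primary: "x \<in> carrier M \<Longrightarrow> primary x"
    and faithful: "r \<in> carrier R \<Longrightarrow> (\<And>x. x \<in> carrier M \<Longrightarrow> r \<odot>\<^bsub>M\<^esub> x = \<zero>\<^bsub>M\<^esub>) \<Longrightarrow> r = \<zero>"
begin

text \<open>If \<open>v^n\<close> kills \<open>x\<close>, then by faithfulness there is \<open>w\<close> with \<open>v^(n + 1) w \<noteq> 0\<close>, and \<open>x\<close> is a multiple of \<open>v w\<close> by
  uniseriality.\<close>
lemma v_pow_surj:
  assumes x: "x \<in> carrier M"
  shows "\<exists>y\<in>carrier M. v [^] (j::nat) \<odot>\<^bsub>M\<^esub> y = x"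
  using x
proof (induction j arbitrary: x)
  case 0
  then show ?case by (intro bexI[of _ x]) auto
next
  case (Suc j)
  obtain n :: nat where n: "v [^] n \<odot>\<^bsub>M\<^esub> x = \<zero>\<^bsub>M\<^esub>" using primary_v_pow[OF all_primary[OF Suc.prems]] by blast
  have shift: "v [^] Suc k \<odot>\<^bsub>M\<^esub> w = v [^] k \<odot>\<^bsub>M\<^esub> (v \<odot>\<^bsub>M\<^esub> w)" "v [^] Suc k \<odot>\<^bsub>M\<^esub> w = v \<odot>\<^bsub>M\<^esub> (v [^] k \<odot>\<^bsub>M\<^esub> w)"
    if "w \<in> carrier M" for w and k :: nat
    using that by (simp_all add: smult_assoc1[symmetric] R.m_comm)
  have "\<not> (\<forall>w\<in>carrier M. v [^] Suc n \<odot>\<^bsub>M\<^esub> w = \<zero>\<^bsub>M\<^esub>)"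
    using faithful[of "v [^] Suc n"] v_pow_nonzero[of "Suc n"] by auto
  then obtain w where w: "w \<in> carrier M" "v [^] Suc n \<odot>\<^bsub>M\<^esub> w \<noteq> \<zero>\<^bsub>M\<^esub>" by blast
  have vw: "v \<odot>\<^bsub>M\<^esub> w \<in> carrier M" using w(1) by simp
  have "v [^] n \<odot>\<^bsub>M\<^esub> (v \<odot>\<^bsub>M\<^esub> w) \<noteq> \<zero>\<^bsub>M\<^esub>" using w(2) unfolding shift(1)[OF w(1)] .
  moreover have "v [^] Suc n \<odot>\<^bsub>M\<^esub> x = \<zero>\<^bsub>M\<^esub>" unfolding shift(2)[OF Suc.prems] n by simp
  ultimately obtain r where r: "r \<in> carrier R" "x = r \<odot>\<^bsub>M\<^esub> (v \<odot>\<^bsub>M\<^esub> w)"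
    using weakly_IN_uniserial[OF weakly_IN all_primary[OF Suc.prems] all_primary[OF vw]] by blast
  have rw: "r \<odot>\<^bsub>M\<^esub> w \<in> carrier M" using r(1) w(1) by simp
  obtain y where y: "y \<in> carrier M" "v [^] j \<odot>\<^bsub>M\<^esub> y = r \<odot>\<^bsub>M\<^esub> w" using Suc.IH[OF rw] by blast
  have "v [^] Suc j \<odot>\<^bsub>M\<^esub> y = x"
    unfolding shift(2)[OF y(1)] y(2) r(2) using r(1) w(1) by (simp add: smult_assoc1[symmetric] R.m_comm)
  then show ?case using y(1) by blast
qed

text \<open>Up to elements outside \<open>p\<close>, which act bijectively, \<open>c\<close> is a power of \<open>v\<close>.\<close>
lemma divisible:
  assumes c: "c \<in> carrier R" "c \<noteq> \<zero>" and x: "x \<in> carrier M"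
  shows "\<exists>y\<in>carrier M. c \<odot>\<^bsub>M\<^esub> y = x"
proof -
  obtain j :: nat and t u where t: "t \<in> carrier R" "t \<notin> p" and u: "u \<in> carrier R" "u \<notin> p"
    and tc: "t \<otimes> c = u \<otimes> v [^] j"
    using normal_form[OF c] by blast
  obtain a where a: "a \<in> carrier R" "u \<odot>\<^bsub>M\<^esub> (a \<odot>\<^bsub>M\<^esub> (t \<odot>\<^bsub>M\<^esub> x)) = t \<odot>\<^bsub>M\<^esub> x"
    using primary_unit_surj[OF all_primary u, of "t \<odot>\<^bsub>M\<^esub> x"] t(1) x by auto
  obtain y where y: "y \<in> carrier M" "v [^] j \<odot>\<^bsub>M\<^esub> y = a \<odot>\<^bsub>M\<^esub> (t \<odot>\<^bsub>M\<^esub> x)"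
    using v_pow_surj[of "a \<odot>\<^bsub>M\<^esub> (t \<odot>\<^bsub>M\<^esub> x)" j] a(1) t(1) x by auto
  let ?d = "c \<odot>\<^bsub>M\<^esub> y \<oplus>\<^bsub>M\<^esub> \<ominus>\<^bsub>M\<^esub> x"
  have "t \<odot>\<^bsub>M\<^esub> (c \<odot>\<^bsub>M\<^esub> y) = (t \<otimes> c) \<odot>\<^bsub>M\<^esub> y" using t(1) c(1) y(1) by (simp add: smult_assoc1)
  also have "\<dots> = u \<odot>\<^bsub>M\<^esub> (v [^] j \<odot>\<^bsub>M\<^esub> y)" unfolding tc using u(1) y(1) by (simp add: smult_assoc1)
  also have "\<dots> = t \<odot>\<^bsub>M\<^esub> x" unfolding y(2) a(2) ..
  finally have "t \<odot>\<^bsub>M\<^esub> ?d = \<zero>\<^bsub>M\<^esub>"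
    using t(1) c(1) y(1) x by (simp add: smult_r_distr smult_r_minus M.r_neg)
  then have d: "?d = \<zero>\<^bsub>M\<^esub>" using primary_unit_cancel[OF all_primary t, of ?d] c(1) y(1) x by simp
  have "c \<odot>\<^bsub>M\<^esub> y = ?d \<oplus>\<^bsub>M\<^esub> x" using c(1) y(1) x by (simp add: M.a_assoc M.l_neg)
  then show ?thesis unfolding d using x y(1) by auto
qed

text \<open>Let \<open>c\<close> generate \<open>I\<close> locally at \<open>p\<close> and choose \<open>e\<close> with \<open>c e = k c\<close>. For \<open>r \<in> I\<close>, some \<open>w \<notin> p\<close> makes \<open>w r\<close> a multiple of
  \<open>c\<close>; so \<open>w\<close> kills \<open>k r - r e\<close>, and elements outside \<open>p\<close> act injectively.\<close>
lemma injective: "injective_module R M"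
proof (rule Baer_criterion[OF module_axioms])
  fix I k
  assume I: "ideal I R" and kc: "k \<in> I \<rightarrow> carrier M"
    and add: "\<And>r q. r \<in> I \<Longrightarrow> q \<in> I \<Longrightarrow> k (r \<oplus> q) = k r \<oplus>\<^bsub>M\<^esub> k q"
    and mul: "\<And>a r. a \<in> carrier R \<Longrightarrow> r \<in> I \<Longrightarrow> k (a \<otimes> r) = a \<odot>\<^bsub>M\<^esub> k r"
  show "\<exists>e\<in>carrier M. \<forall>r\<in>I. k r = r \<odot>\<^bsub>M\<^esub> e"
  proof (cases "I = {\<zero>}")
    case True
    have "k (\<zero> \<otimes> \<zero>) = \<zero> \<odot>\<^bsub>M\<^esub> k \<zero>" by (rule mul) (simp_all add: True)
    then have "k \<zero> = \<zero>\<^bsub>M\<^esub>" using kc True by simp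
    then have "\<forall>r\<in>I. k r = r \<odot>\<^bsub>M\<^esub> \<zero>\<^bsub>M\<^esub>" using True by simp
    then show ?thesis using M.zero_closed by blast
  next
    case False
    obtain j :: nat and c t u where c: "c \<in> I" and t: "t \<in> carrier R" "t \<notin> p" and u: "u \<in> carrier R" "u \<notin> p"
      and tc: "t \<otimes> c = u \<otimes> v [^] j" and sub: "I \<subseteq> symbolic_power j"
      using ideal_local_generator[OF I False] by blast
    have cR: "c \<in> carrier R" using ideal.Icarr[OF I c] .
    have "c \<noteq> \<zero>"
    proof
      assume "c = \<zero>"
      then have "u \<otimes> v [^] j = \<zero>" using tc t(1) by simp
      then show False using integral[of u "v [^] j"] u v_pow_nonzero[of j] notin_p_nonzero by simp
    qed
    have kcM: "k c \<in> carrier M" using kc c by blast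
    obtain e where e: "e \<in> carrier M" "c \<odot>\<^bsub>M\<^esub> e = k c" using divisible[OF cR \<open>c \<noteq> \<zero>\<close> kcM] by blast
    have "k r = r \<odot>\<^bsub>M\<^esub> e" if r: "r \<in> I" for r
    proof -
      have rR: "r \<in> carrier R" using ideal.Icarr[OF I r] .
      have krM: "k r \<in> carrier M" using kc r by blast
      obtain q where q: "q \<in> carrier R" "s [^] j \<otimes> r = q \<otimes> v [^] j"
        using sub r symbolic_powerE by blast
      let ?w = "u \<otimes> s [^] j"
      have w: "?w \<in> carrier R" "?w \<notin> p" using u notin_p_mult[of u "s [^] j"] s_pow_notin_p by auto
      have "?w \<otimes> r = u \<otimes> (s [^] j \<otimes> r)" using u(1) rR by (simp add: R.m_assoc)
      also have "\<dots> = (q \<otimes> t) \<otimes> c" unfolding q(2) using q(1) u(1) t(1) cR tc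
        by (simp add: R.m_lcomm R.m_assoc)
      finally have wr: "?w \<otimes> r = (q \<otimes> t) \<otimes> c" .
      have "?w \<odot>\<^bsub>M\<^esub> k r = k (?w \<otimes> r)" using mul[OF w(1) r] by simp
      also have "\<dots> = (q \<otimes> t) \<odot>\<^bsub>M\<^esub> (c \<odot>\<^bsub>M\<^esub> e)" unfolding wr e(2) using mul[OF _ c] q(1) t(1) by simp
      also have "\<dots> = (?w \<otimes> r) \<odot>\<^bsub>M\<^esub> e" unfolding wr using q(1) t(1) cR e(1) by (simp add: smult_assoc1)
      also have "\<dots> = ?w \<odot>\<^bsub>M\<^esub> (r \<odot>\<^bsub>M\<^esub> e)" using w(1) rR e(1) by (simp add: smult_assoc1)
      finally have eq: "?w \<odot>\<^bsub>M\<^esub> k r = ?w \<odot>\<^bsub>M\<^esub> (r \<odot>\<^bsub>M\<^esub> e)" .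
      let ?d = "k r \<oplus>\<^bsub>M\<^esub> \<ominus>\<^bsub>M\<^esub> (r \<odot>\<^bsub>M\<^esub> e)"
      have "?w \<odot>\<^bsub>M\<^esub> ?d = ?w \<odot>\<^bsub>M\<^esub> k r \<oplus>\<^bsub>M\<^esub> \<ominus>\<^bsub>M\<^esub> (?w \<odot>\<^bsub>M\<^esub> (r \<odot>\<^bsub>M\<^esub> e))"
        using w(1) krM rR e(1) by (simp add: smult_r_distr smult_r_minus)
      also have "\<dots> = \<zero>\<^bsub>M\<^esub>" unfolding eq using w(1) rR e(1) by (simp add: M.r_neg)
      finally have d: "?d = \<zero>\<^bsub>M\<^esub>" using primary_unit_cancel[OF all_primary w, of ?d] krM rR e(1) by simp
      have "k r = ?d \<oplus>\<^bsub>M\<^esub> r \<odot>\<^bsub>M\<^esub> e" using krM rR e(1) by (simp add: M.a_assoc M.l_neg)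
      then show ?thesis unfolding d using rR e(1) by simp
    qed
    then show ?thesis using e(1) by blast
  qed
qed

text \<open>A nonzero \<open>x\<close> with \<open>v x = 0\<close> generates a copy of \<open>R/p\<close>. It is essential, since every nonzero \<open>z\<close> has a nonzero
  multiple killed by \<open>v\<close>, and this is a multiple of \<open>x\<close> by \<open>weakly_IN_socle\<close>.\<close>
lemma injective_hull_quot: "injective_hull R (quot_module R p) M"
proof -
  have "\<not> (\<forall>x\<in>carrier M. \<one> \<odot>\<^bsub>M\<^esub> x = \<zero>\<^bsub>M\<^esub>)" using faithful[of \<one>] by auto
  then obtain y where y: "y \<in> carrier M" "y \<noteq> \<zero>\<^bsub>M\<^esub>" by auto
  obtain m :: nat where m: "v [^] m \<odot>\<^bsub>M\<^esub> y \<noteq> \<zero>\<^bsub>M\<^esub>" "v \<odot>\<^bsub>M\<^esub> (v [^] m \<odot>\<^bsub>M\<^esub> y) = \<zero>\<^bsub>M\<^esub>"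
    using primary_last_multiple[OF all_primary[OF y(1)] y(2)] by blast
  define x where "x = v [^] m \<odot>\<^bsub>M\<^esub> y"
  have x: "x \<in> carrier M" "x \<noteq> \<zero>\<^bsub>M\<^esub>" "v \<odot>\<^bsub>M\<^esub> x = \<zero>\<^bsub>M\<^esub>" using m y by (simp_all add: x_def)
  let ?S = "(\<lambda>r. r \<odot>\<^bsub>M\<^esub> x) ` carrier R" and ?Q = "quot_module R p"
  let ?N = "M\<lparr>carrier := ?S\<rparr>"
  have kill: "r \<odot>\<^bsub>M\<^esub> x = \<zero>\<^bsub>M\<^esub> \<longleftrightarrow> r \<in> p" if "r \<in> carrier R" for r
    using primary_p_kills[OF all_primary[OF x(1)] x(3)] primary_unit_cancel[OF all_primary[OF x(1)] that] x(2) by blast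
  have "module_iso R ?Q ?N"
  proof (rule cyclic_module_iso[where f = "\<lambda>r. r \<odot>\<^bsub>M\<^esub> x"])
    show "module R ?Q" by (rule quot_module_module[OF R.is_cring p_ideal])
    show "p +>\<^bsub>R\<^esub> \<one> \<in> carrier ?Q" by (rule quot_module_coset_closed[OF R.is_cring p_ideal]) simp
    show "\<exists>r\<in>carrier R. C = r \<odot>\<^bsub>?Q\<^esub> (p +>\<^bsub>R\<^esub> \<one>)" if "C \<in> carrier ?Q" for C
      by (rule quot_module_coset_generates[OF R.is_cring p_ideal that])
    fix r q assume r: "r \<in> carrier R" and q: "q \<in> carrier R"
    show "(r \<oplus> q) \<odot>\<^bsub>M\<^esub> x = r \<odot>\<^bsub>M\<^esub> x \<oplus>\<^bsub>?N\<^esub> q \<odot>\<^bsub>M\<^esub> x" using r q x(1) by (simp add: smult_l_distr)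
    have "r \<odot>\<^bsub>M\<^esub> x = q \<odot>\<^bsub>M\<^esub> x \<longleftrightarrow> (r \<ominus> q) \<odot>\<^bsub>M\<^esub> x = \<zero>\<^bsub>M\<^esub>"
      by (rule smult_eq_smult_iff[OF r q x(1)])
    also have "\<dots> \<longleftrightarrow> r \<ominus> q \<in> p" using kill r q by simp
    also have "\<dots> \<longleftrightarrow> p +>\<^bsub>R\<^esub> r = p +>\<^bsub>R\<^esub> q"
      using quot_module_coset_eq_iff[OF R.is_cring p_ideal r q] by simp
    also have "\<dots> \<longleftrightarrow> r \<odot>\<^bsub>?Q\<^esub> (p +>\<^bsub>R\<^esub> \<one>) = q \<odot>\<^bsub>?Q\<^esub> (p +>\<^bsub>R\<^esub> \<one>)"
      unfolding quot_module_smult_one[OF R.is_cring p_ideal r] quot_module_smult_one[OF R.is_cring p_ideal q] ..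
    finally show "r \<odot>\<^bsub>M\<^esub> x = q \<odot>\<^bsub>M\<^esub> x \<longleftrightarrow> r \<odot>\<^bsub>?Q\<^esub> (p +>\<^bsub>R\<^esub> \<one>) = q \<odot>\<^bsub>?Q\<^esub> (p +>\<^bsub>R\<^esub> \<one>)" .
  qed (use x(1) in \<open>auto simp: smult_assoc1\<close>)
  then obtain h where h: "h \<in> module_hom R ?Q ?N" "bij_betw h (carrier ?Q) (carrier ?N)"
    unfolding module_iso_def by blast
  have Sc: "?S \<subseteq> carrier M" using x(1) by auto
  have "h \<in> carrier ?Q \<rightarrow> ?S" using h(1) by (simp add: module_hom_def)
  then have "h \<in> carrier ?Q \<rightarrow> carrier M" using Sc by (rule Pi_mono[THEN subsetD, rotated])
  then have "h \<in> module_hom R ?Q M" using h(1) by (simp add: module_hom_def)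
  moreover have "inj_on h (carrier ?Q)" and im: "h ` carrier ?Q = ?S"
    using h(2) by (auto simp: bij_betw_def)
  moreover have "essential_submodule R M (h ` carrier ?Q)"
    unfolding im essential_submodule_def
  proof (intro conjI allI impI)
    show "submodule ?S R M" by (rule cyclic_submodule[OF x(1)])
    fix H assume H: "submodule H R M" and HS: "H \<inter> ?S = {\<zero>\<^bsub>M\<^esub>}"
    have "z = \<zero>\<^bsub>M\<^esub>" if z: "z \<in> H" for z
    proof (rule ccontr)
      assume "z \<noteq> \<zero>\<^bsub>M\<^esub>"
      have zM: "z \<in> carrier M" using z submoduleE(1)[OF H] by blast
      obtain l :: nat where l: "v [^] l \<odot>\<^bsub>M\<^esub> z \<noteq> \<zero>\<^bsub>M\<^esub>" "v \<odot>\<^bsub>M\<^esub> (v [^] l \<odot>\<^bsub>M\<^esub> z) = \<zero>\<^bsub>M\<^esub>"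
        using primary_last_multiple[OF all_primary[OF zM] \<open>z \<noteq> \<zero>\<^bsub>M\<^esub>\<close>] by blast
      have vz: "v [^] l \<odot>\<^bsub>M\<^esub> z \<in> H" using submoduleE(4)[OF H _ z] by simp
      have "v [^] l \<odot>\<^bsub>M\<^esub> z \<in> carrier M" using zM by simp
      then have "\<exists>r\<in>carrier R. v [^] l \<odot>\<^bsub>M\<^esub> z = r \<odot>\<^bsub>M\<^esub> x"
        using weakly_IN_socle[OF weakly_IN all_primary l(2) all_primary[OF x(1)] x(2)] by blast
      then have "v [^] l \<odot>\<^bsub>M\<^esub> z \<in> H \<inter> ?S" using vz by blast
      then show False using HS l(1) by blast
    qed
    moreover have "\<zero>\<^bsub>M\<^esub> \<in> H" using HS by blast
    ultimately show "H = {\<zero>\<^bsub>M\<^esub>}" by blast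
  qed
  ultimately show ?thesis unfolding injective_hull_def using injective by blast
qed

end

section \<open>Submodules of the field of fractions\<close>

lemma fractions_nonzero:
  assumes F: "field_of_fractions R K \<phi>" and r: "r \<in> carrier R" "r \<noteq> \<zero>\<^bsub>R\<^esub>"
  shows "\<phi> r \<in> carrier K" "\<phi> r \<noteq> \<zero>\<^bsub>K\<^esub>"
proof -
  interpret R: domain R using F by (simp add: field_of_fractions_def)
  interpret K: field K using F by (simp add: field_of_fractions_def)
  interpret h: ring_hom_cring R K \<phi> by unfold_locales (rule field_of_fractions.frac_hom[OF F])
  show "\<phi> r \<in> carrier K" using r by simp
  show "\<phi> r \<noteq> \<zero>\<^bsub>K\<^esub>"
    using inj_onD[OF field_of_fractions.frac_inj[OF F], of r "\<zero>\<^bsub>R\<^esub>"] r by auto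
qed

lemma fractions_module:
  assumes F: "field_of_fractions R K \<phi>"
  shows "module R (restrict_scalars \<phi> K)"
proof -
  interpret R: domain R using F by (simp add: field_of_fractions_def)
  interpret K: field K using F by (simp add: field_of_fractions_def)
  show ?thesis
    by (rule module_restrict_scalars[OF R.is_cring K.is_cring field_of_fractions.frac_hom[OF F]])
qed

text \<open>The fractions \<open>a/b\<close> and \<open>c/d\<close> have the common multiple \<open>a c\<close>.\<close>
lemma submodule_of_fractions_imp_weakly_IN:
  assumes F: "field_of_fractions R K \<phi>" and M: "module R M"
    and H: "submodule H R (restrict_scalars \<phi> K)"
    and iso: "module_iso R M ((restrict_scalars \<phi> K)\<lparr>carrier := H\<rparr>)"
  shows "weakly_IN R M"
proof -
  interpret R: domain R using F by (simp add: field_of_fractions_def)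
  interpret K: field K using F by (simp add: field_of_fractions_def)
  interpret f: ring_hom_cring R K \<phi> by unfold_locales (rule field_of_fractions.frac_hom[OF F])
  let ?K = "restrict_scalars \<phi> K"
  have modK: "module R ?K" by (rule fractions_module[OF F])
  have HK: "H \<subseteq> carrier K" using module.submoduleE(1)[OF modK H] by simp
  obtain h where h: "h \<in> module_hom R M (?K\<lparr>carrier := H\<rparr>)" "bij_betw h (carrier M) H"
    using iso by (auto simp: module_iso_def)
  have hH: "h x \<in> H" if "x \<in> carrier M" for x using module_hom_closed[OF h(1) that] by simp
  have hK: "h \<in> module_hom R M ?K" using h(1) hH HK by (auto simp: module_hom_def)
  have inj: "inj_on h (carrier M)" using h(2) by (simp add: bij_betw_def)
  show ?thesis
  proof (rule uniform_pullback_imp_weakly_IN[OF M modK hK inj])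
    fix x y assume x: "x \<in> carrier M" "h x \<noteq> \<zero>\<^bsub>?K\<^esub>" and y: "y \<in> carrier M" "h y \<noteq> \<zero>\<^bsub>?K\<^esub>"
    have hx: "h x \<in> carrier K" and hy: "h y \<in> carrier K" using hH x(1) y(1) HK by auto
    obtain a b where a: "a \<in> carrier R" and b: "b \<in> carrier R" "b \<noteq> \<zero>\<^bsub>R\<^esub>" and ab: "h x = \<phi> a \<otimes>\<^bsub>K\<^esub> inv\<^bsub>K\<^esub> (\<phi> b)"
      using field_of_fractions.frac_repr[OF F hx] by blast
    obtain c d where c: "c \<in> carrier R" and d: "d \<in> carrier R" "d \<noteq> \<zero>\<^bsub>R\<^esub>" and cd: "h y = \<phi> c \<otimes>\<^bsub>K\<^esub> inv\<^bsub>K\<^esub> (\<phi> d)"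
      using field_of_fractions.frac_repr[OF F hy] by blast
    have bU: "\<phi> b \<in> Units K" and dU: "\<phi> d \<in> Units K"
      using fractions_nonzero[OF F b] fractions_nonzero[OF F d] by (auto simp: K.field_Units)
    have cl: "\<phi> a \<in> carrier K" "\<phi> b \<in> carrier K" "\<phi> c \<in> carrier K" "\<phi> d \<in> carrier K"
      "inv\<^bsub>K\<^esub> (\<phi> b) \<in> carrier K" "inv\<^bsub>K\<^esub> (\<phi> d) \<in> carrier K"
      using a b c d bU dU by auto
    have 1: "\<phi> (c \<otimes>\<^bsub>R\<^esub> b) \<otimes>\<^bsub>K\<^esub> h x = \<phi> a \<otimes>\<^bsub>K\<^esub> \<phi> c"
    proof -
      have "\<phi> (c \<otimes>\<^bsub>R\<^esub> b) \<otimes>\<^bsub>K\<^esub> h x = (\<phi> a \<otimes>\<^bsub>K\<^esub> \<phi> c) \<otimes>\<^bsub>K\<^esub> (\<phi> b \<otimes>\<^bsub>K\<^esub> inv\<^bsub>K\<^esub> (\<phi> b))"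
        unfolding ab using c b(1) cl by (simp add: K.m_ac)
      then show ?thesis using bU cl by simp
    qed
    have 2: "\<phi> (a \<otimes>\<^bsub>R\<^esub> d) \<otimes>\<^bsub>K\<^esub> h y = \<phi> a \<otimes>\<^bsub>K\<^esub> \<phi> c"
    proof -
      have "\<phi> (a \<otimes>\<^bsub>R\<^esub> d) \<otimes>\<^bsub>K\<^esub> h y = (\<phi> a \<otimes>\<^bsub>K\<^esub> \<phi> c) \<otimes>\<^bsub>K\<^esub> (\<phi> d \<otimes>\<^bsub>K\<^esub> inv\<^bsub>K\<^esub> (\<phi> d))"
        unfolding cd using a d(1) cl by (simp add: K.m_ac)
      then show ?thesis using dU cl by simp
    qed
    have "\<phi> a \<noteq> \<zero>\<^bsub>K\<^esub>" "\<phi> c \<noteq> \<zero>\<^bsub>K\<^esub>" using x(2) y(2) ab cd cl by auto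
    then have "\<phi> a \<otimes>\<^bsub>K\<^esub> \<phi> c \<noteq> \<zero>\<^bsub>K\<^esub>" using K.integral[of "\<phi> a" "\<phi> c"] cl by blast
    moreover have "c \<otimes>\<^bsub>R\<^esub> b \<in> carrier R" "a \<otimes>\<^bsub>R\<^esub> d \<in> carrier R" using a b c d by auto
    ultimately show "\<exists>a\<in>carrier R. \<exists>b\<in>carrier R. a \<odot>\<^bsub>?K\<^esub> h x = b \<odot>\<^bsub>?K\<^esub> h y \<and> a \<odot>\<^bsub>?K\<^esub> h x \<noteq> \<zero>\<^bsub>?K\<^esub>"
      using 1 2 by (intro bexI[of _ "c \<otimes>\<^bsub>R\<^esub> b"] bexI[of _ "a \<otimes>\<^bsub>R\<^esub> d"]) simp_all
  qed
qed

text \<open>A homomorphism \<open>k\<close> from an ideal to \<open>K\<close> is multiplication by \<open>k c / c\<close> for any nonzero \<open>c\<close> in the ideal.\<close>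
lemma fractions_injective:
  assumes F: "field_of_fractions R K \<phi>"
  shows "injective_module R (restrict_scalars \<phi> K)"
proof (rule Baer_criterion[OF fractions_module[OF F]])
  interpret R: domain R using F by (simp add: field_of_fractions_def)
  interpret K: field K using F by (simp add: field_of_fractions_def)
  interpret f: ring_hom_cring R K \<phi> by unfold_locales (rule field_of_fractions.frac_hom[OF F])
  let ?K = "restrict_scalars \<phi> K"
  fix I k
  assume I: "ideal I R" and k: "k \<in> I \<rightarrow> carrier ?K"
    and smult: "\<And>a r. a \<in> carrier R \<Longrightarrow> r \<in> I \<Longrightarrow> k (a \<otimes>\<^bsub>R\<^esub> r) = a \<odot>\<^bsub>?K\<^esub> k r"
  have kK: "k r \<in> carrier K" if "r \<in> I" for r using k that by auto
  have IR: "r \<in> carrier R" if "r \<in> I" for r using ideal.Icarr[OF I that] .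
  have mul: "k (a \<otimes>\<^bsub>R\<^esub> r) = \<phi> a \<otimes>\<^bsub>K\<^esub> k r" if "a \<in> carrier R" "r \<in> I" for a r
    using smult[OF that] by simp
  have I0: "\<zero>\<^bsub>R\<^esub> \<in> I" using I by (simp add: additive_subgroup.zero_closed ideal.axioms(1))
  show "\<exists>e\<in>carrier ?K. \<forall>r\<in>I. k r = r \<odot>\<^bsub>?K\<^esub> e"
  proof (cases "I = {\<zero>\<^bsub>R\<^esub>}")
    case True
    have "k (\<zero>\<^bsub>R\<^esub> \<otimes>\<^bsub>R\<^esub> \<zero>\<^bsub>R\<^esub>) = \<phi> \<zero>\<^bsub>R\<^esub> \<otimes>\<^bsub>K\<^esub> k \<zero>\<^bsub>R\<^esub>" by (rule mul[OF R.zero_closed I0])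
    then have "k \<zero>\<^bsub>R\<^esub> = \<zero>\<^bsub>K\<^esub>" using kK[OF I0] by simp
    then show ?thesis using True by (intro bexI[of _ "\<zero>\<^bsub>K\<^esub>"]) auto
  next
    case False
    then obtain c where c: "c \<in> I" "c \<noteq> \<zero>\<^bsub>R\<^esub>" using I0 by auto
    note \<phi>c = fractions_nonzero[OF F IR[OF c(1)] c(2)]
    have U: "\<phi> c \<in> Units K" using \<phi>c by (simp add: K.field_Units)
    obtain i where i: "i \<in> carrier K" "\<phi> c \<otimes>\<^bsub>K\<^esub> i = \<one>\<^bsub>K\<^esub>"
      using K.Units_inv_closed[OF U] K.Units_r_inv[OF U] by blast
    let ?e = "k c \<otimes>\<^bsub>K\<^esub> i"
    have e: "?e \<in> carrier K" using kK[OF c(1)] i(1) by simp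
    have "k r = \<phi> r \<otimes>\<^bsub>K\<^esub> ?e" if r: "r \<in> I" for r
    proof -
      have "\<phi> c \<otimes>\<^bsub>K\<^esub> k r = k (r \<otimes>\<^bsub>R\<^esub> c)"
        using mul[OF IR[OF c(1)] r] R.m_comm[OF IR[OF c(1)] IR[OF r]] by simp
      also have "\<dots> = \<phi> r \<otimes>\<^bsub>K\<^esub> k c" by (rule mul[OF IR[OF r] c(1)])
      also have "\<dots> = \<phi> r \<otimes>\<^bsub>K\<^esub> (k c \<otimes>\<^bsub>K\<^esub> (\<phi> c \<otimes>\<^bsub>K\<^esub> i))"
        unfolding i(2) using kK[OF c(1)] by simp
      also have "\<dots> = \<phi> c \<otimes>\<^bsub>K\<^esub> (\<phi> r \<otimes>\<^bsub>K\<^esub> ?e)"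
        using i(1) \<phi>c(1) kK[OF c(1)] IR[OF r] by (simp add: K.m_ac)
      finally show ?thesis
        using K.m_lcancel[OF \<phi>c(2,1)] kK[OF r] e IR[OF r] by simp
    qed
    then show ?thesis using e by (intro bexI[of _ ?e]) auto
  qed
qed

text \<open>The map \<open>r x0 \<mapsto> \<phi> r\<close> extends to a homomorphism \<open>h\<close> on \<open>M\<close>. For \<open>x\<close> in its kernel \<open>R x \<inter> R x0 = 0\<close>, so the
  annihilator of \<open>x\<close> is comaximal with that of \<open>x0\<close>, which is \<open>0\<close>. Hence \<open>x = 0\<close>.\<close>
lemma weakly_IN_torsion_free_element_embeds:
  assumes F: "field_of_fractions R K \<phi>" and M: "module R M" and W: "weakly_IN R M"
    and x0: "x0 \<in> carrier M"
    and free: "\<And>r. r \<in> carrier R \<Longrightarrow> r \<odot>\<^bsub>M\<^esub> x0 = \<zero>\<^bsub>M\<^esub> \<Longrightarrow> r = \<zero>\<^bsub>R\<^esub>"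
  shows "\<exists>H. submodule H R (restrict_scalars \<phi> K) \<and>
    module_iso R M ((restrict_scalars \<phi> K)\<lparr>carrier := H\<rparr>)"
proof -
  interpret R: domain R using F by (simp add: field_of_fractions_def)
  interpret K: field K using F by (simp add: field_of_fractions_def)
  interpret M: module R M by fact
  interpret f: ring_hom_cring R K \<phi> by unfold_locales (rule field_of_fractions.frac_hom[OF F])
  let ?K = "restrict_scalars \<phi> K" and ?S = "(\<lambda>r. r \<odot>\<^bsub>M\<^esub> x0) ` carrier R"
  let ?N = "M\<lparr>carrier := ?S\<rparr>"
  have K: "module R ?K" by (rule fractions_module[OF F])
  have S: "submodule ?S R M" by (rule M.cyclic_submodule[OF x0])
  have N: "module R ?N" by (rule submodule.submodule_is_module[OF S M])
  have x0S: "x0 \<in> ?S" by (rule image_eqI[of _ _ "\<one>\<^bsub>R\<^esub>"]) (use x0 in auto)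
  have "module_iso R ?N (?K\<lparr>carrier := \<phi> ` carrier R\<rparr>)"
  proof (rule cyclic_module_iso[OF N, where g = x0 and f = \<phi>])
    fix r q assume r: "r \<in> carrier R" and q: "q \<in> carrier R"
    have "\<phi> r = \<phi> q \<longleftrightarrow> r = q"
      by (rule inj_on_eq_iff[OF field_of_fractions.frac_inj[OF F] r q])
    also have "\<dots> \<longleftrightarrow> r \<odot>\<^bsub>M\<^esub> x0 = q \<odot>\<^bsub>M\<^esub> x0"
      using free[of "r \<ominus>\<^bsub>R\<^esub> q"] M.smult_eq_smult_iff[OF r q x0] R.minus_eq_zero_iff[OF r q] r q by auto
    finally show "\<phi> r = \<phi> q \<longleftrightarrow> r \<odot>\<^bsub>?N\<^esub> x0 = q \<odot>\<^bsub>?N\<^esub> x0" by simp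
  qed (use x0S in auto)
  then obtain g where g: "g \<in> module_hom R ?N (?K\<lparr>carrier := \<phi> ` carrier R\<rparr>)" "inj_on g ?S"
    by (auto simp: module_iso_def bij_betw_def)
  have "g \<in> ?S \<rightarrow> \<phi> ` carrier R" using g(1) by (simp add: module_hom_def)
  then have "g \<in> ?S \<rightarrow> carrier K" by (rule Pi_mono[THEN subsetD, rotated]) auto
  then have gK: "g \<in> module_hom R ?N ?K" using g(1) by (simp add: module_hom_def)
  have "(\<lambda>x. x) \<in> module_hom R ?N M"
    using M.submoduleE(1)[OF S] by (auto simp: module_hom_def)
  then have "\<exists>h\<in>module_hom R M ?K. \<forall>x\<in>carrier ?N. h x = g x"
    by (intro injective_module_extend[OF fractions_injective[OF F] N M _ _ gK]) simp_all
  then obtain h where h: "h \<in> module_hom R M ?K" and hg: "\<And>x. x \<in> ?S \<Longrightarrow> h x = g x" by auto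
  have h0: "h \<zero>\<^bsub>M\<^esub> = \<zero>\<^bsub>K\<^esub>" using module_hom_zero[OF M K h] by simp
  have ker: "x = \<zero>\<^bsub>M\<^esub>" if x: "x \<in> carrier M" "h x = \<zero>\<^bsub>K\<^esub>" for x
  proof -
    have "a \<odot>\<^bsub>M\<^esub> x = \<zero>\<^bsub>M\<^esub>" if ab: "a \<in> carrier R" "b \<in> carrier R" "a \<odot>\<^bsub>M\<^esub> x = b \<odot>\<^bsub>M\<^esub> x0" for a b
    proof -
      have bS: "b \<odot>\<^bsub>M\<^esub> x0 \<in> ?S" using ab(2) by (rule imageI)
      have zS: "\<zero>\<^bsub>M\<^esub> \<in> ?S" using S by (auto simp: submodule_def subgroup_def)
      have "h (a \<odot>\<^bsub>M\<^esub> x) = \<zero>\<^bsub>K\<^esub>" using module_hom_smult[OF h ab(1) x(1)] x(2) ab(1) by simp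
      then have "g (b \<odot>\<^bsub>M\<^esub> x0) = g \<zero>\<^bsub>M\<^esub>" using hg[OF bS] hg[OF zS] h0 ab(3) by simp
      then show ?thesis using inj_onD[OF g(2) _ bS zS] ab(3) by simp
    qed
    then obtain a b where ab: "a \<in> carrier R" "b \<in> carrier R" "a \<odot>\<^bsub>M\<^esub> x = \<zero>\<^bsub>M\<^esub>" "b \<odot>\<^bsub>M\<^esub> x0 = \<zero>\<^bsub>M\<^esub>" "a \<oplus>\<^bsub>R\<^esub> b = \<one>\<^bsub>R\<^esub>"
      using M.weakly_IN_independent[OF W x(1) x0] by blast
    have "a = \<one>\<^bsub>R\<^esub>" using free[OF ab(2,4)] ab(1,5) by simp
    then show ?thesis using ab(3) x(1) by simp
  qed
  have "inj_on h (carrier M)"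
  proof (rule inj_onI)
    fix x y assume x: "x \<in> carrier M" and y: "y \<in> carrier M" and eq: "h x = h y"
    have hx: "h x \<in> carrier K" using module_hom_closed[OF h x] by simp
    have "x \<ominus>\<^bsub>M\<^esub> y = x \<oplus>\<^bsub>M\<^esub> (\<ominus>\<^bsub>R\<^esub> \<one>\<^bsub>R\<^esub>) \<odot>\<^bsub>M\<^esub> y" using y by (simp add: M.M.minus_eq M.smult_l_minus)
    then have "h (x \<ominus>\<^bsub>M\<^esub> y) = h x \<oplus>\<^bsub>K\<^esub> \<phi> (\<ominus>\<^bsub>R\<^esub> \<one>\<^bsub>R\<^esub>) \<otimes>\<^bsub>K\<^esub> h y"
      using module_hom_add[OF h x, of "(\<ominus>\<^bsub>R\<^esub> \<one>\<^bsub>R\<^esub>) \<odot>\<^bsub>M\<^esub> y"] module_hom_smult[OF h _ y, of "\<ominus>\<^bsub>R\<^esub> \<one>\<^bsub>R\<^esub>"] y by simp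
    also have "\<dots> = \<zero>\<^bsub>K\<^esub>" using eq[symmetric] hx by (simp add: K.l_minus K.r_neg)
    finally have "x \<ominus>\<^bsub>M\<^esub> y = \<zero>\<^bsub>M\<^esub>" using ker[of "x \<ominus>\<^bsub>M\<^esub> y"] x y by simp
    then show "x = y" using M.M.minus_eq_zero_iff x y by simp
  qed
  then show ?thesis
    using module_hom_image_submodule[OF M K h] module_iso_image[OF h] by blast
qed

section \<open>Injective hulls of simple modules\<close>

text \<open>By essentiality each nonzero \<open>z \<in> E\<close> has a nonzero multiple in the image of the simple module \<open>R/p\<close>, and any two nonzero
  elements of \<open>R/p\<close> are multiples of each other.\<close>
lemma injective_hull_imp_weakly_IN:
  assumes R: "cring R" and p: "maximalideal p R" and hull: "injective_hull R (quot_module R p) E"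
    and M: "module R M" and iso: "module_iso R M E"
  shows "weakly_IN R M"
proof -
  interpret R: cring R by fact
  have p_ideal: "ideal p R" using p by (rule maximalideal.axioms)
  let ?Q = "quot_module R p"
  note Q = quot_module_module[OF R p_ideal]
  interpret Q: module R ?Q by (rule Q)
  have E: "module R E" using hull by (simp add: injective_hull_def injective_module_def)
  interpret E: module R E by (rule E)
  obtain \<iota> where \<iota>: "\<iota> \<in> module_hom R ?Q E" "inj_on \<iota> (carrier ?Q)" "essential_submodule R E (\<iota> ` carrier ?Q)"
    using hull unfolding injective_hull_def by blast
  have \<iota>0: "\<iota> \<zero>\<^bsub>?Q\<^esub> = \<zero>\<^bsub>E\<^esub>" by (rule module_hom_zero[OF Q E \<iota>(1)])
  have coset: "p +>\<^bsub>R\<^esub> r \<in> carrier ?Q" if "r \<in> carrier R" for r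
    by (rule quot_module_coset_closed[OF R p_ideal that])
  have coset0: "p +>\<^bsub>R\<^esub> r = \<zero>\<^bsub>?Q\<^esub>" if r: "r \<in> p" for r
  proof -
    have rR: "r \<in> carrier R" using ideal.Icarr[OF p_ideal r] .
    have "r \<ominus>\<^bsub>R\<^esub> \<zero>\<^bsub>R\<^esub> \<in> p" using r rR by (simp add: R.minus_eq)
    then have "p +>\<^bsub>R\<^esub> r = p +>\<^bsub>R\<^esub> \<zero>\<^bsub>R\<^esub>"
      using quot_module_coset_eq_iff[OF R p_ideal rR R.zero_closed] by blast
    also have "\<dots> = \<zero>\<^bsub>R\<^esub> \<odot>\<^bsub>?Q\<^esub> (p +>\<^bsub>R\<^esub> \<one>\<^bsub>R\<^esub>)"
      by (rule quot_module_smult_one[OF R p_ideal R.zero_closed, symmetric])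
    also have "\<dots> = \<zero>\<^bsub>?Q\<^esub>" using coset by simp
    finally show ?thesis .
  qed
  have socle: "\<exists>a\<in>carrier R. \<exists>r\<in>carrier R. r \<notin> p \<and> a \<odot>\<^bsub>E\<^esub> z = \<iota> (p +>\<^bsub>R\<^esub> r) \<and> a \<odot>\<^bsub>E\<^esub> z \<noteq> \<zero>\<^bsub>E\<^esub>"
    if z: "z \<in> carrier E" "z \<noteq> \<zero>\<^bsub>E\<^esub>" for z
  proof -
    let ?S = "(\<lambda>a. a \<odot>\<^bsub>E\<^esub> z) ` carrier R"
    have S: "submodule ?S R E" by (rule E.cyclic_submodule[OF z(1)])
    have "z \<in> ?S" by (rule image_eqI[of _ _ "\<one>\<^bsub>R\<^esub>"]) (use z in auto)
    then have "?S \<noteq> {\<zero>\<^bsub>E\<^esub>}" using z(2) by blast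
    then have ne: "?S \<inter> \<iota> ` carrier ?Q \<noteq> {\<zero>\<^bsub>E\<^esub>}"
      using \<iota>(3) S unfolding essential_submodule_def by blast
    have "\<zero>\<^bsub>E\<^esub> \<in> ?S" using S by (auto simp: submodule_def subgroup_def)
    moreover have "\<zero>\<^bsub>E\<^esub> \<in> \<iota> ` carrier ?Q"
      using \<iota>(3) by (auto simp: essential_submodule_def submodule_def subgroup_def)
    ultimately obtain w where w: "w \<in> ?S" "w \<in> \<iota> ` carrier ?Q" "w \<noteq> \<zero>\<^bsub>E\<^esub>" using ne by blast
    obtain a where a: "a \<in> carrier R" "w = a \<odot>\<^bsub>E\<^esub> z" using w(1) by blast
    obtain C where C: "C \<in> carrier ?Q" "w = \<iota> C" using w(2) by blast
    obtain r where r: "r \<in> carrier R" "C = p +>\<^bsub>R\<^esub> r" using quot_moduleE[OF R p_ideal C(1)] by blast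
    have "r \<notin> p" using coset0[of r] r(2) C(2) w(3) \<iota>0 by auto
    then show ?thesis using a r C w(3) by blast
  qed
  obtain h where h: "h \<in> module_hom R M E" "bij_betw h (carrier M) (carrier E)"
    using iso by (auto simp: module_iso_def)
  show ?thesis
  proof (rule uniform_pullback_imp_weakly_IN[OF M E h(1)])
    show "inj_on h (carrier M)" using h(2) by (simp add: bij_betw_def)
    fix x y assume x: "x \<in> carrier M" "h x \<noteq> \<zero>\<^bsub>E\<^esub>" and y: "y \<in> carrier M" "h y \<noteq> \<zero>\<^bsub>E\<^esub>"
    have hx: "h x \<in> carrier E" and hy: "h y \<in> carrier E" using module_hom_closed[OF h(1)] x(1) y(1) by auto
    obtain a r where a: "a \<in> carrier R" and r: "r \<in> carrier R" and ar: "a \<odot>\<^bsub>E\<^esub> h x = \<iota> (p +>\<^bsub>R\<^esub> r)" "a \<odot>\<^bsub>E\<^esub> h x \<noteq> \<zero>\<^bsub>E\<^esub>"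
      using socle[OF hx x(2)] by blast
    obtain b t where b: "b \<in> carrier R" and t: "t \<in> carrier R" "t \<notin> p" and bt: "b \<odot>\<^bsub>E\<^esub> h y = \<iota> (p +>\<^bsub>R\<^esub> t)"
      using socle[OF hy y(2)] by blast
    obtain c d where c: "c \<in> carrier R" and d: "d \<in> p" and cd: "c \<otimes>\<^bsub>R\<^esub> t \<oplus>\<^bsub>R\<^esub> d = \<one>\<^bsub>R\<^esub>"
      using R.maximalideal_comaximal[OF p t] .
    have dR: "d \<in> carrier R" using ideal.Icarr[OF p_ideal d] .
    \<comment> \<open>The residue class of \<open>c\<close> is the inverse of that of \<open>t\<close>, so \<open>?q\<close> takes the class of \<open>t\<close> to that of \<open>r\<close>.\<close>
    let ?q = "r \<otimes>\<^bsub>R\<^esub> c"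
    have q: "?q \<in> carrier R" using r c by simp
    have "r = r \<otimes>\<^bsub>R\<^esub> (c \<otimes>\<^bsub>R\<^esub> t \<oplus>\<^bsub>R\<^esub> d)" unfolding cd using r by simp
    then have "r = ?q \<otimes>\<^bsub>R\<^esub> t \<oplus>\<^bsub>R\<^esub> r \<otimes>\<^bsub>R\<^esub> d"
      using r c t(1) dR by (simp add: R.r_distr R.m_assoc)
    then have "r \<ominus>\<^bsub>R\<^esub> ?q \<otimes>\<^bsub>R\<^esub> t = (?q \<otimes>\<^bsub>R\<^esub> t \<oplus>\<^bsub>R\<^esub> r \<otimes>\<^bsub>R\<^esub> d) \<ominus>\<^bsub>R\<^esub> ?q \<otimes>\<^bsub>R\<^esub> t" by (rule arg_cong)
    also have "\<dots> = r \<otimes>\<^bsub>R\<^esub> d" using r c t(1) dR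
      by (simp add: R.minus_eq R.a_assoc R.a_comm[of "r \<otimes>\<^bsub>R\<^esub> d"] R.r_neg2)
    finally have "r \<ominus>\<^bsub>R\<^esub> ?q \<otimes>\<^bsub>R\<^esub> t \<in> p" using ideal.I_l_closed[OF p_ideal d r] by simp
    then have "p +>\<^bsub>R\<^esub> r = p +>\<^bsub>R\<^esub> (?q \<otimes>\<^bsub>R\<^esub> t)"
      using quot_module_coset_eq_iff[OF R p_ideal r, of "?q \<otimes>\<^bsub>R\<^esub> t"] q t(1) by simp
    also have "\<dots> = ?q \<odot>\<^bsub>?Q\<^esub> (p +>\<^bsub>R\<^esub> t)" by (rule quot_module_coset_smult[OF R p_ideal q t(1)])
    finally have "\<iota> (p +>\<^bsub>R\<^esub> r) = ?q \<odot>\<^bsub>E\<^esub> \<iota> (p +>\<^bsub>R\<^esub> t)"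
      using module_hom_smult[OF \<iota>(1) q coset[OF t(1)]] by simp
    then have "a \<odot>\<^bsub>E\<^esub> h x = (?q \<otimes>\<^bsub>R\<^esub> b) \<odot>\<^bsub>E\<^esub> h y"
      unfolding ar(1) bt[symmetric] using q b hy by (simp add: E.smult_assoc1)
    moreover have "?q \<otimes>\<^bsub>R\<^esub> b \<in> carrier R" using q b by simp
    ultimately show "\<exists>a\<in>carrier R. \<exists>b\<in>carrier R. a \<odot>\<^bsub>E\<^esub> h x = b \<odot>\<^bsub>E\<^esub> h y \<and> a \<odot>\<^bsub>E\<^esub> h x \<noteq> \<zero>\<^bsub>E\<^esub>"
      using a ar(2) by blast
  qed
qed

section \<open>Direct sums of cyclic modules\<close>

context
  fixes R :: "('a, 'r) ring_scheme" (structure) and S :: "'i set" and I :: "'i \<Rightarrow> 'a set"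
  assumes R: "cring R" and S: "finite S" and I: "i \<in> S \<Longrightarrow> ideal (I i) R"
begin

interpretation cring R by (rule R)

abbreviation (input) "quot_sum \<equiv> direct_sum_module S (\<lambda>i. quot_module R (I i))"

definition residue_family :: "'a \<Rightarrow> 'i \<Rightarrow> 'a set" where
  "residue_family r = (\<lambda>i\<in>S. I i +>\<^bsub>R\<^esub> r)"

lemma residue_family_closed: "r \<in> carrier R \<Longrightarrow> residue_family r \<in> carrier quot_sum"
  using S quot_module_coset_closed[OF R I] by (auto simp: residue_family_def direct_sum_module_def)

lemma residue_family_add:
  "r \<in> carrier R \<Longrightarrow> q \<in> carrier R \<Longrightarrow> residue_family (r \<oplus> q) = residue_family r \<oplus>\<^bsub>quot_sum\<^esub> residue_family q"
  using quot_module_coset_add[OF R I, of _ r q] by (auto simp: residue_family_def direct_sum_module_def fun_eq_iff)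

lemma residue_family_smult:
  "a \<in> carrier R \<Longrightarrow> r \<in> carrier R \<Longrightarrow> residue_family (a \<otimes> r) = a \<odot>\<^bsub>quot_sum\<^esub> residue_family r"
  using quot_module_coset_smult[OF R I, of _ a r] by (auto simp: residue_family_def direct_sum_module_def fun_eq_iff)

lemma residue_family_eq_iff:
  assumes "r \<in> carrier R" "q \<in> carrier R"
  shows "residue_family r = residue_family q \<longleftrightarrow> (\<forall>i\<in>S. r \<ominus> q \<in> I i)"
proof -
  have "residue_family r = residue_family q \<longleftrightarrow> (\<forall>i\<in>S. I i +>\<^bsub>R\<^esub> r = I i +>\<^bsub>R\<^esub> q)"
    by (auto simp: residue_family_def fun_eq_iff restrict_def)
  also have "\<dots> \<longleftrightarrow> (\<forall>i\<in>S. r \<ominus> q \<in> I i)"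
    by (rule ball_cong[OF refl]) (rule quot_module_coset_eq_iff[OF R I assms])
  finally show ?thesis .
qed

lemma residue_family_surj:
  assumes comaximal: "\<And>i j. i \<in> S \<Longrightarrow> j \<in> S \<Longrightarrow> i \<noteq> j \<Longrightarrow> \<exists>a\<in>I i. \<exists>b\<in>I j. a \<oplus> b = \<one>"
    and y: "y \<in> carrier quot_sum"
  shows "\<exists>r\<in>carrier R. y = residue_family r"
proof -
  have yi: "y i \<in> carrier (quot_module R (I i))" if "i \<in> S" for i
    using y that by (auto simp: direct_sum_module_def)
  have ex: "\<forall>i\<in>S. \<exists>c. c \<in> carrier R \<and> y i = I i +>\<^bsub>R\<^esub> c"
  proof
    fix i assume i: "i \<in> S"
    show "\<exists>c. c \<in> carrier R \<and> y i = I i +>\<^bsub>R\<^esub> c"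
      using quot_moduleE[OF R I[OF i] yi[OF i]] by blast
  qed
  obtain c where c: "\<forall>i\<in>S. c i \<in> carrier R \<and> y i = I i +>\<^bsub>R\<^esub> c i"
    using bchoice[OF ex] by (rule exE)
  have cR: "c i \<in> carrier R" "y i = I i +>\<^bsub>R\<^esub> c i" if "i \<in> S" for i using bspec[OF c that] by auto
  have "\<exists>r\<in>carrier R. \<forall>i\<in>S. r \<ominus> c i \<in> I i"
    by (rule chinese_remainder[OF S I comaximal cR(1)])
  then obtain r where r: "r \<in> carrier R" "\<forall>i\<in>S. r \<ominus> c i \<in> I i" by (rule bexE)
  have "y i = residue_family r i" for i
  proof (cases "i \<in> S")
    case True
    then have "I i +>\<^bsub>R\<^esub> r = I i +>\<^bsub>R\<^esub> c i"
      using quot_module_coset_eq_iff[OF R I[OF True] r(1) cR(1)[OF True]] r(2) by blast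
    then show ?thesis using cR(2)[OF True] True by (simp add: residue_family_def)
  next
    case False
    then have "y i = undefined" using y by (auto simp: direct_sum_module_def PiE_def extensional_def)
    then show ?thesis using False by (simp add: residue_family_def)
  qed
  then show ?thesis using r(1) by blast
qed

end

text \<open>The preimage of the family of residue classes of \<open>1\<close> is a generator, because every family of residue classes comes from
  one element of \<open>R\<close>.\<close>
lemma direct_sum_iso_imp_cyclic:
  fixes R (structure)
  assumes R: "cring R" and S: "finite S" and I: "\<And>i. i \<in> S \<Longrightarrow> ideal (I i) R"
    and comaximal: "\<And>i j. i \<in> S \<Longrightarrow> j \<in> S \<Longrightarrow> i \<noteq> j \<Longrightarrow> \<exists>a\<in>I i. \<exists>b\<in>I j. a \<oplus> b = \<one>"
    and M: "module R M" and iso: "module_iso R M (direct_sum_module S (\<lambda>i. quot_module R (I i)))"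
  shows "\<exists>g\<in>carrier M. \<forall>x\<in>carrier M. \<exists>r\<in>carrier R. x = r \<odot>\<^bsub>M\<^esub> g"
proof -
  interpret M: module R M by fact
  let ?N = "direct_sum_module S (\<lambda>i. quot_module R (I i))"
  let ?f = "residue_family R S I"
  obtain h where h: "h \<in> module_hom R M ?N" "bij_betw h (carrier M) (carrier ?N)"
    using iso unfolding module_iso_def by blast
  have inj: "inj_on h (carrier M)" and im: "h ` carrier M = carrier ?N" using h(2) by (auto simp: bij_betw_def)
  have "?f \<one> \<in> carrier ?N" by (rule residue_family_closed[OF R S I M.R.one_closed])
  then have "?f \<one> \<in> h ` carrier M" unfolding im .
  then obtain g where g: "g \<in> carrier M" "h g = ?f \<one>" by (rule imageE) (erule that, rule sym)
  have "\<exists>r\<in>carrier R. x = r \<odot>\<^bsub>M\<^esub> g" if x: "x \<in> carrier M" for x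
  proof -
    have hx: "h x \<in> carrier ?N" by (rule module_hom_closed[OF h(1) x])
    have "\<exists>r\<in>carrier R. h x = ?f r" by (rule residue_family_surj[OF R S I comaximal hx])
    then obtain r where r: "r \<in> carrier R" "h x = ?f r" by (rule bexE)
    have "?f r = ?f (r \<otimes> \<one>)" using r(1) by simp
    also have "\<dots> = r \<odot>\<^bsub>?N\<^esub> ?f \<one>" by (rule residue_family_smult[OF R S I r(1) M.R.one_closed])
    also have "\<dots> = h (r \<odot>\<^bsub>M\<^esub> g)" using module_hom_smult[OF h(1) r(1) g(1)] g(2) by simp
    finally have "x = r \<odot>\<^bsub>M\<^esub> g" using inj_onD[OF inj _ x] r g(1) by simp
    then show ?thesis using r(1) by blast
  qed
  then show ?thesis using g(1) by blast
qed

lemma cyclic_iso_direct_sum: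
  fixes R (structure)
  assumes R: "cring R" and S: "finite S" and I: "\<And>i. i \<in> S \<Longrightarrow> ideal (I i) R"
    and comaximal: "\<And>i j. i \<in> S \<Longrightarrow> j \<in> S \<Longrightarrow> i \<noteq> j \<Longrightarrow> \<exists>a\<in>I i. \<exists>b\<in>I j. a \<oplus> b = \<one>"
    and M: "module R M" and g: "g \<in> carrier M" "\<And>x. x \<in> carrier M \<Longrightarrow> \<exists>r\<in>carrier R. x = r \<odot>\<^bsub>M\<^esub> g"
    and Ann: "\<And>r. r \<in> carrier R \<Longrightarrow> r \<odot>\<^bsub>M\<^esub> g = \<zero>\<^bsub>M\<^esub> \<longleftrightarrow> (\<forall>i\<in>S. r \<in> I i)"
  shows "module_iso R M (direct_sum_module S (\<lambda>i. quot_module R (I i)))"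
proof (rule cyclic_module_iso[OF M g, where f = "residue_family R S I"])
  interpret M: module R M by fact
  let ?N = "direct_sum_module S (\<lambda>i. quot_module R (I i))"
  show "residue_family R S I r \<in> carrier ?N" if "r \<in> carrier R" for r
    by (rule residue_family_closed[OF R S I that])
  show "\<exists>r\<in>carrier R. y = residue_family R S I r" if "y \<in> carrier ?N" for y
    by (rule residue_family_surj[OF R S I comaximal that])
  fix r q assume r: "r \<in> carrier R" and q: "q \<in> carrier R"
  show "residue_family R S I (r \<oplus> q) = residue_family R S I r \<oplus>\<^bsub>?N\<^esub> residue_family R S I q"
    by (rule residue_family_add[OF R S I r q])
  show "residue_family R S I (r \<otimes> q) = r \<odot>\<^bsub>?N\<^esub> residue_family R S I q"
    by (rule residue_family_smult[OF R S I r q])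
  show "residue_family R S I r = residue_family R S I q \<longleftrightarrow> r \<odot>\<^bsub>M\<^esub> g = q \<odot>\<^bsub>M\<^esub> g"
    using residue_family_eq_iff[OF R S I r q] M.smult_eq_smult_iff[OF r q g(1)] Ann[of "r \<ominus> q"] r q by simp
qed

section \<open>The classification\<close>

text \<open>A record without extension fields, so that \<open>M\<close> itself can serve as the injective hull in the type \<open>('a, 'b) module\<close>.\<close>
definition plain_module :: "('a, 'b, 'm) module_scheme \<Rightarrow> ('a, 'b) module" where
  "plain_module M = \<lparr>carrier = carrier M, monoid.mult = monoid.mult M, monoid.one = monoid.one M,
    ring.zero = ring.zero M, ring.add = ring.add M, module.smult = module.smult M\<rparr>"

lemma module_hom_plain_module: "module_hom R A (plain_module M) = module_hom R A M"
  by (simp add: module_hom_def plain_module_def)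

lemma injective_hull_plain_module:
  assumes "injective_hull R N M"
  shows "injective_hull R N (plain_module M)"
proof -
  have "monoid (add_monoid (plain_module M)) \<longleftrightarrow> monoid (add_monoid M)"
    unfolding monoid_def by (simp add: plain_module_def)
  then have cm: "Group.comm_monoid (add_monoid (plain_module M)) \<longleftrightarrow> Group.comm_monoid (add_monoid M)"
    unfolding comm_monoid_def comm_monoid_axioms_def by (simp add: plain_module_def)
  have "Units (add_monoid (plain_module M)) = Units (add_monoid M)"
    unfolding Units_def by (simp add: plain_module_def)
  then have "group (add_monoid (plain_module M)) \<longleftrightarrow> group (add_monoid M)"
    using \<open>monoid (add_monoid (plain_module M)) \<longleftrightarrow> monoid (add_monoid M)\<close>
    unfolding group_def group_axioms_def by (simp add: plain_module_def)
  then have "abelian_group (plain_module M) \<longleftrightarrow> abelian_group M"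
    unfolding abelian_group_def abelian_monoid_def abelian_group_axioms_def comm_group_def cm by simp
  moreover have "module_axioms R (plain_module M) \<longleftrightarrow> module_axioms R M"
    unfolding module_axioms_def by (simp add: plain_module_def)
  ultimately have mod: "module R (plain_module M) \<longleftrightarrow> module R M"
    unfolding module_def by simp
  have sub: "submodule H R (plain_module M) \<longleftrightarrow> submodule H R M" for H
    by (simp add: plain_module_def submodule_def submodule_axioms_def subgroup_def m_inv_def)
  have "essential_submodule R (plain_module M) H \<longleftrightarrow> essential_submodule R M H" for H
    unfolding essential_submodule_def sub by (simp add: plain_module_def)
  moreover have "injective_module R (plain_module M) \<longleftrightarrow> injective_module R M"
    unfolding injective_module_def mod module_hom_plain_module ..
  ultimately show ?thesis using assms unfolding injective_hull_def module_hom_plain_module by blast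
qed

lemma module_iso_plain_module: "module_iso R M (plain_module M)"
  unfolding module_iso_def
  by (rule bexI[of _ "\<lambda>x. x"]) (simp_all add: plain_module_def module_hom_def bij_betw_def)

context uniformized_domain_module
begin

lemma weakly_IN_not_faithful_iso:
  assumes W: "weakly_IN R M" and ne: "carrier M \<noteq> {\<zero>\<^bsub>M\<^esub>}"
    and a: "a \<in> carrier R" "a \<noteq> \<zero>" "\<And>x. x \<in> carrier M \<Longrightarrow> a \<odot>\<^bsub>M\<^esub> x = \<zero>\<^bsub>M\<^esub>"
  shows "\<exists>(k::nat) p (n :: nat \<Rightarrow> nat). k \<ge> 1 \<and> (\<forall>i\<in>{1..k}. maximalideal (p i) R \<and> n i \<ge> 1) \<and> inj_on p {1..k} \<and>
    module_iso R M (direct_sum_module {1..k} (\<lambda>i. quot_module R (p i [^]\<^bsub>ideals_set R\<^esub> n i)))"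
proof -
  \<comment> \<open>All of \<open>M\<close> is killed by the nonzero ideal generated by \<open>a\<close>.\<close>
  have A: "ideal (PIdl a) R" by (rule cgenideal_ideal[OF a(1)])
  have A0: "PIdl a \<noteq> {\<zero>}" using cgenideal_self[OF a(1)] a(2) by (metis singletonD)
  have "ideal_torsion R M (PIdl a) = carrier M"
  proof -
    have "x \<in> ideal_torsion R M (PIdl a)" if x: "x \<in> carrier M" for x
      unfolding ideal_torsion_def
    proof (intro CollectI conjI ballI)
      fix r assume "r \<in> PIdl a"
      then obtain q where q: "q \<in> carrier R" "r = q \<otimes> a" unfolding cgenideal_iff by (rule bexE)
      show "r \<odot>\<^bsub>M\<^esub> x = \<zero>\<^bsub>M\<^esub>" using q a(1) a(3)[OF x] x by (simp add: smult_assoc1)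
    qed (rule x)
    then show ?thesis by (auto simp: ideal_torsion_def)
  qed
  then have "\<exists>g\<in>carrier M. \<forall>x\<in>carrier M. \<exists>r\<in>carrier R. x = r \<odot>\<^bsub>M\<^esub> g"
    using weakly_IN_ideal_torsion_cyclic[OF W A A0] by simp
  then obtain g where g: "g \<in> carrier M" "\<forall>x\<in>carrier M. \<exists>r\<in>carrier R. x = r \<odot>\<^bsub>M\<^esub> g" by (rule bexE)
  define I where "I = {r \<in> carrier R. r \<odot>\<^bsub>M\<^esub> g = \<zero>\<^bsub>M\<^esub>}"
  have "ideal I R" unfolding I_def by (rule annihilator_ideal[OF g(1)])
  moreover have "a \<in> I" using a g(1) by (simp add: I_def)
  then have "I \<noteq> {\<zero>}" using a(2) by blast
  ultimately obtain k p and n :: "nat \<Rightarrow> nat" where p: "\<forall>i\<in>{1..k}. maximalideal (p i) R \<and> n i \<ge> 1" "inj_on p {1..k}"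
    and Ieq: "I = {r \<in> carrier R. \<forall>i\<in>{1..k}. r \<in> p i [^]\<^bsub>ideals_set R\<^esub> n i}"
    using nonzero_ideal_decomposition[of I] by blast
  have "k \<ge> 1"
  proof (rule ccontr)
    assume "\<not> k \<ge> 1"
    then have "\<one> \<in> I" unfolding Ieq by simp
    then have "g = \<zero>\<^bsub>M\<^esub>" using g(1) by (simp add: I_def)
    then have "x = \<zero>\<^bsub>M\<^esub>" if "x \<in> carrier M" for x using bspec[OF g(2) that] by auto
    then show False using ne M.zero_closed by blast
  qed
  moreover have "module_iso R M (direct_sum_module {1..k} (\<lambda>i. quot_module R (p i [^]\<^bsub>ideals_set R\<^esub> n i)))"
  proof (rule cyclic_iso_direct_sum[OF R.is_cring _ _ _ module_axioms g(1)])
    show "ideal (p i [^]\<^bsub>ideals_set R\<^esub> n i) R" if "i \<in> {1..k}" for i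
      using p(1) that ideal_power_ideal maximalideal.axioms(1) by blast
    show "\<exists>a\<in>p i [^]\<^bsub>ideals_set R\<^esub> n i. \<exists>b\<in>p j [^]\<^bsub>ideals_set R\<^esub> n j. a \<oplus> b = \<one>"
      if "i \<in> {1..k}" "j \<in> {1..k}" "i \<noteq> j" for i j
      using maximal_powers_comaximal p that by (metis inj_onD)
    show "\<exists>r\<in>carrier R. x = r \<odot>\<^bsub>M\<^esub> g" if "x \<in> carrier M" for x using g(2) that by blast
    show "r \<odot>\<^bsub>M\<^esub> g = \<zero>\<^bsub>M\<^esub> \<longleftrightarrow> (\<forall>i\<in>{1..k}. r \<in> p i [^]\<^bsub>ideals_set R\<^esub> n i)" if "r \<in> carrier R" for r
      using Ieq that unfolding I_def by blast
  qed simp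
  ultimately show ?thesis using p by blast
qed

text \<open>Any maximal ideal above the annihilator of a nonzero element will do for \<open>p\<close>.\<close>
lemma weakly_IN_faithful_torsion_hull:
  assumes W: "weakly_IN R M" and ne: "carrier M \<noteq> {\<zero>\<^bsub>M\<^esub>}"
    and tors: "\<And>x. x \<in> carrier M \<Longrightarrow> \<exists>r\<in>carrier R. r \<noteq> \<zero> \<and> r \<odot>\<^bsub>M\<^esub> x = \<zero>\<^bsub>M\<^esub>"
    and faithful: "\<And>r. r \<in> carrier R \<Longrightarrow> (\<And>x. x \<in> carrier M \<Longrightarrow> r \<odot>\<^bsub>M\<^esub> x = \<zero>\<^bsub>M\<^esub>) \<Longrightarrow> r = \<zero>"
  shows "\<exists>p. maximalideal p R \<and> injective_hull R (quot_module R p) M"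
proof -
  obtain m where m: "m \<in> carrier M" "m \<noteq> \<zero>\<^bsub>M\<^esub>" using ne M.zero_closed by blast
  define I where "I = {r \<in> carrier R. r \<odot>\<^bsub>M\<^esub> m = \<zero>\<^bsub>M\<^esub>}"
  have id: "ideal I R" unfolding I_def by (rule annihilator_ideal[OF m(1)])
  have "\<one> \<notin> I" using m by (simp add: I_def)
  then have "I \<noteq> carrier R" by auto
  then obtain p where p: "maximalideal p R" "I \<subseteq> p" using exists_maximalideal_above[OF id] by metis
  obtain r where "r \<in> carrier R" "r \<noteq> \<zero>" "r \<odot>\<^bsub>M\<^esub> m = \<zero>\<^bsub>M\<^esub>" using tors[OF m(1)] by blast
  then have "r \<in> p" "r \<noteq> \<zero>" using p(2) by (auto simp: I_def)
  then have "p \<noteq> {\<zero>}" by blast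
  then obtain v s where "uniformizer R p v s" using exists_uniformizer p(1) by metis
  then interpret U: uniformizer_module R M p v s by (rule uniformizer_moduleI)
  have "U.primary x" if "x \<in> carrier M" for x
    by (rule U.weakly_IN_faithful_torsion_primary[OF W tors faithful m(1) _ that])
      (use p(2) in \<open>auto simp: I_def\<close>)
  then interpret H: faithful_primary_module R M p v s
    by unfold_locales (use W faithful in auto)
  show ?thesis using p(1) H.injective_hull_quot by blast
qed

end

theorem theorem4p3:
  fixes R :: "('a, 'r) ring_scheme"
    and K :: "('k, 's) ring_scheme"
    and \<phi> :: "'a \<Rightarrow> 'k"
    and M :: "('a, 'b, 'm) module_scheme"
  assumes "dedekind_domain R K \<phi>"
    and "module R M"
    and "carrier M \<noteq> {\<zero>\<^bsub>M\<^esub>}"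
  shows "weakly_IN R M \<longleftrightarrow>
    (\<exists>H. submodule H R (restrict_scalars \<phi> K) \<and>
         module_iso R M ((restrict_scalars \<phi> K)\<lparr>carrier := H\<rparr>)) \<or>
    (\<exists>\<pp>. maximalideal \<pp> R \<and>
         (\<exists>E :: ('a, 'b) module. injective_hull R (quot_module R \<pp>) E \<and> module_iso R M E)) \<or>
    (\<exists>(k::nat) (\<pp> :: nat \<Rightarrow> 'a set) (n :: nat \<Rightarrow> nat). k \<ge> 1 \<and>
         (\<forall>i\<in>{1..k}. maximalideal (\<pp> i) R \<and> n i \<ge> 1) \<and>
         inj_on \<pp> {1..k} \<and>
         module_iso R M
           (direct_sum_module {1..k} (\<lambda>i. quot_module R (\<pp> i [^]\<^bsub>ideals_set R\<^esub> n i))))"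
    (is "_ \<longleftrightarrow> ?fractional \<or> ?hull \<or> ?cyclic")
proof -
  have F: "field_of_fractions R K \<phi>" using assms(1) by (simp add: dedekind_domain_def)
  interpret U: uniformized_domain_module R M
    by (intro uniformized_domain_module.intro assms(2) dedekind_imp_uniformized_domain[OF assms(1)])
  show ?thesis
  proof
    assume W: "weakly_IN R M"
    show "?fractional \<or> ?hull \<or> ?cyclic"
    proof (cases "\<exists>x0\<in>carrier M. \<forall>r\<in>carrier R. r \<odot>\<^bsub>M\<^esub> x0 = \<zero>\<^bsub>M\<^esub> \<longrightarrow> r = \<zero>\<^bsub>R\<^esub>")
      case True
      then obtain x0 where x0: "x0 \<in> carrier M" "\<forall>r\<in>carrier R. r \<odot>\<^bsub>M\<^esub> x0 = \<zero>\<^bsub>M\<^esub> \<longrightarrow> r = \<zero>\<^bsub>R\<^esub>" by blast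
      then have ?fractional
        by (intro weakly_IN_torsion_free_element_embeds[OF F assms(2) W x0(1)]) blast
      then show ?thesis by blast
    next
      case False
      show ?thesis
      proof (cases "\<exists>a\<in>carrier R. a \<noteq> \<zero>\<^bsub>R\<^esub> \<and> (\<forall>x\<in>carrier M. a \<odot>\<^bsub>M\<^esub> x = \<zero>\<^bsub>M\<^esub>)")
        case True
        then obtain a where "a \<in> carrier R" "a \<noteq> \<zero>\<^bsub>R\<^esub>" "\<And>x. x \<in> carrier M \<Longrightarrow> a \<odot>\<^bsub>M\<^esub> x = \<zero>\<^bsub>M\<^esub>" by blast
        then have ?cyclic by (rule U.weakly_IN_not_faithful_iso[OF W assms(3)])
        then show ?thesis by blast
      next
        case nf: False
        have "\<exists>p. maximalideal p R \<and> injective_hull R (quot_module R p) M"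
          by (rule U.weakly_IN_faithful_torsion_hull[OF W assms(3)]) (use False nf in blast)+
        then have ?hull
          using injective_hull_plain_module module_iso_plain_module by blast
        then show ?thesis by blast
      qed
    qed
  next
    assume "?fractional \<or> ?hull \<or> ?cyclic"
    then show "weakly_IN R M"
    proof (elim disjE exE conjE)
      fix H assume "submodule H R (restrict_scalars \<phi> K)"
        and "module_iso R M ((restrict_scalars \<phi> K)\<lparr>carrier := H\<rparr>)"
      then show ?thesis by (rule submodule_of_fractions_imp_weakly_IN[OF F assms(2)])
    next
      fix p and E :: "('a, 'b) module"
      assume "maximalideal p R" "injective_hull R (quot_module R p) E" "module_iso R M E"
      then show ?thesis using injective_hull_imp_weakly_IN[OF U.R.is_cring _ _ assms(2)] by blast
    next
      fix k :: nat and p and n :: "nat \<Rightarrow> nat"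
      assume p: "\<forall>i\<in>{1..k}. maximalideal (p i) R \<and> n i \<ge> 1" "inj_on p {1..k}"
        and iso: "module_iso R M (direct_sum_module {1..k} (\<lambda>i. quot_module R (p i [^]\<^bsub>ideals_set R\<^esub> n i)))"
      have "\<exists>g\<in>carrier M. \<forall>x\<in>carrier M. \<exists>r\<in>carrier R. x = r \<odot>\<^bsub>M\<^esub> g"
      proof (rule direct_sum_iso_imp_cyclic[OF U.R.is_cring _ _ _ assms(2) iso])
        show "ideal (p i [^]\<^bsub>ideals_set R\<^esub> n i) R" if "i \<in> {1..k}" for i
          using p(1) that U.ideal_power_ideal maximalideal.axioms(1) by blast
        show "\<exists>a\<in>p i [^]\<^bsub>ideals_set R\<^esub> n i. \<exists>b\<in>p j [^]\<^bsub>ideals_set R\<^esub> n j. a \<oplus>\<^bsub>R\<^esub> b = \<one>\<^bsub>R\<^esub>"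
          if "i \<in> {1..k}" "j \<in> {1..k}" "i \<noteq> j" for i j
          using U.maximal_powers_comaximal p that by (metis inj_onD)
      qed simp
      then show ?thesis using U.cyclic_imp_weakly_IN by blast
    qed
  qed
qed

end
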